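(* Let $s>0$, $1\le p<\infty$ and $R>0$, and assume that it is not the case that both $p=1$ and $s$ is an integer $\ge2$. There exists a finite constant $K=K_{s,p,R,N}$ such that $$\|f\|_{L^p(\mathbb{R}^N)}^{1-1/N}\,|f|_{W^{s,p}}^{1/N}\le K\,\mathscr{E}_{s,p}(f)$$ for each $f\in W^{s,p}(\mathbb{R}^N)$ supported in $B(0,R)$.
   Context: $N\ge 2$ is an integer; $B(0,R)$ is the Euclidean ball of radius $R$ centered at $0$ in $\mathbb{R}^N$. For $f:\mathbb{R}^N\to\mathbb{R}$ measurable and $h\in\mathbb{R}^N$, $\Delta_h f(x)=f(x+h)-f(x)$ and $\Delta_h^{m+1}=\Delta_h\circ\Delta_h^m$. $\lfloor s\rfloor$ is the integer part of $s$, $\mathscr{H}^{N-1}$ is the $(N-1)$-dimensional Hausdorff measure, $\sigma_N=\mathscr{H}^{N-1}(\mathbb{S}^{N-1})$. If $s$ is not an integer, $\dot W^{s,p}(\mathbb{R}^N)$ is the space of $f\in L^1_{\mathrm{loc}}(\mathbb{R}^N)$ with $|f|_{W^{s,p}}<\infty$, where $|f|_{W^{s,p}}^p=\int_{\mathbb{R}^N}\frac{\|\Delta_h^{\lfloor s\rfloor+1}f\|_{L^p}^p}{|h|^{sp+N}}\,dh$. If $s\ge1$ is an integer, $\dot W^{s,p}(\mathbb{R}^N)$ is the space of $f\in W^{s,1}_{\mathrm{loc}}(\mathbb{R}^N)$ with $|f|_{W^{s,p}}<\infty$, where $|f|_{W^{s,p}}^p=\int_{\mathbb{R}^N}\|D^s_xf\|^p\,dx$;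 here $D_x^sf$ is the $s$-linear form given by the $s$-th derivative of $f$ at $x$ and $\|\eta\|=\sup_{|x_1|\le1,\dots,|x_s|\le1}|\eta(x_1,\dots,x_s)|$. Moreover $W^{s,p}(\mathbb{R}^N)=L^p(\mathbb{R}^N)\cap\dot W^{s,p}(\mathbb{R}^N)$. Affine energy. For $\xi\in\mathbb{S}^{N-1}$ put $I_f(\xi)=\int_0^\infty t^{-sp-1}\|\Delta^{\lfloor s\rfloor+1}_{t\xi}f\|_{L^p}^p\,dt$ if $s$ is not an integer, and $I_f(\xi)=\int_{\mathbb{R}^N}|\partial^s_\xi f(x)|^p\,dx$ if $s\ge1$ is an integer, where $\partial_\xi^sf(x)=D^s_xf(\xi,\dots,\xi)$. Then $$\mathscr{E}_{s,p}(f)=\sigma_N^{(N+sp)/(Np)}\Big(\int_{\mathbb{S}^{N-1}}I_f(\xi)^{-N/(sp)}\,d\mathscr{H}^{N-1}(\xi)\Big)^{-s/N},$$ with the conventions that a negative power of $0$ is $\infty$ and a negative power of $\infty$ is $0$. *)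

theory Defs
  imports "HOL-Analysis.Analysis"
begin

text \<open>
  Functions are representatives \<open>f :: 'a \<Rightarrow> real\<close> on a Euclidean space of dimension \<open>DIM('a)\<close>;
  norms, seminorms and energies take values in \<^typ>\<open>ennreal\<close>, so that they are meaningful
  (possibly infinite) for every measurable function.
\<close>

subsection \<open>Real powers of extended nonnegative reals\<close>

text \<open>A negative power of \<open>0\<close> is \<open>\<infinity>\<close>, a negative power of \<open>\<infinity>\<close> is \<open>0\<close>.\<close>

definition epowr :: "ennreal \<Rightarrow> real \<Rightarrow> ennreal" where
  "epowr x a =
     (if a = 0 then 1
      else if a > 0 then (if x = \<infinity> then \<infinity> else ennreal (enn2real x powr a))
      else (if x = 0 then \<infinity> else if x = \<infinity> then 0 else ennreal (enn2real x powr a)))"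

subsection \<open>Hausdorff measure\<close>

text \<open>
  The boundedness condition is needed because \<^const>\<open>diameter\<close> is a junk value on unbounded sets.
  The normalisation is the one for which the \<open>d\<close>-dimensional measure agrees with Lebesgue
  measure on \<open>d\<close>-dimensional Euclidean space.
\<close>

definition hausdorff_pre :: "nat \<Rightarrow> real \<Rightarrow> 'a::metric_space set \<Rightarrow> ennreal" where
  "hausdorff_pre d \<delta> A =
     (INF C \<in> {C :: nat \<Rightarrow> 'a set. A \<subseteq> (\<Union>i. C i) \<and> (\<forall>i. bounded (C i) \<and> diameter (C i) \<le> \<delta>)}.
        \<Sum>i. if C i = {} then 0 else ennreal (unit_ball_vol (real d) * (diameter (C i) / 2) ^ d))"

definition hausdorff_outer :: "nat \<Rightarrow> 'a::metric_space set \<Rightarrow> ennreal" where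
  "hausdorff_outer d A = (SUP \<delta> \<in> {0<..}. hausdorff_pre d \<delta> A)"

definition hausdorff_measure :: "nat \<Rightarrow> 'a::metric_space measure" where
  "hausdorff_measure d = measure_of UNIV (sets borel) (hausdorff_outer d)"

subsection \<open>Lebesgue norms, local integrability, differences\<close>

definition Lp_integral :: "real \<Rightarrow> ('a::euclidean_space \<Rightarrow> real) \<Rightarrow> ennreal" where
  "Lp_integral p f = (\<integral>\<^sup>+ x. ennreal (\<bar>f x\<bar> powr p) \<partial>lebesgue)"

definition Lp_norm :: "real \<Rightarrow> ('a::euclidean_space \<Rightarrow> real) \<Rightarrow> ennreal" where
  "Lp_norm p f = epowr (Lp_integral p f) (1 / p)"

definition Lp_space :: "real \<Rightarrow> ('a::euclidean_space \<Rightarrow> real) set" where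
  "Lp_space p = {f \<in> borel_measurable lebesgue. Lp_norm p f < \<infinity>}"

definition L1_loc :: "('a::euclidean_space \<Rightarrow> real) set" where
  "L1_loc = {f \<in> borel_measurable lebesgue. \<forall>K. compact K \<longrightarrow> set_integrable lebesgue K f}"

definition fdiff :: "'a::euclidean_space \<Rightarrow> ('a \<Rightarrow> real) \<Rightarrow> 'a \<Rightarrow> real" where
  "fdiff h f = (\<lambda>x. f (x + h) - f x)"

subsection \<open>Weak derivatives\<close>

fun iter_partial :: "'a::euclidean_space list \<Rightarrow> ('a \<Rightarrow> real) \<Rightarrow> 'a \<Rightarrow> real" where
  "iter_partial [] \<phi> = \<phi>"
| "iter_partial (b # bs) \<phi> = (\<lambda>x. frechet_derivative (iter_partial bs \<phi>) (at x) b)"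

text \<open>
  Compactly supported \<open>C\<^sup>\<infinity>\<close> functions: total differentiability of all iterated partial derivatives
  also gives their continuity.
\<close>

definition test_fun :: "('a::euclidean_space \<Rightarrow> real) \<Rightarrow> bool" where
  "test_fun \<phi> \<longleftrightarrow>
     (\<forall>bs x. set bs \<subseteq> Basis \<longrightarrow> iter_partial bs \<phi> differentiable (at x)) \<and>
     compact (closure {x. \<phi> x \<noteq> 0})"

text \<open>
  A list \<open>bs\<close> of basis vectors stands for the multi-index derivative along its entries.
\<close>

definition is_weak_partial ::
    "'a::euclidean_space list \<Rightarrow> ('a \<Rightarrow> real) \<Rightarrow> ('a \<Rightarrow> real) \<Rightarrow> bool" where
  "is_weak_partial bs f g \<longleftrightarrow>
     g \<in> L1_loc \<and>
     (\<forall>\<phi>. test_fun \<phi> \<longrightarrow>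
        (\<integral>x. f x * iter_partial bs \<phi> x \<partial>lebesgue) =
        (-1) ^ length bs * (\<integral>x. g x * \<phi> x \<partial>lebesgue))"

definition Wk1_loc :: "nat \<Rightarrow> ('a::euclidean_space \<Rightarrow> real) set" where
  "Wk1_loc k =
     {f \<in> L1_loc. \<forall>bs. set bs \<subseteq> Basis \<and> length bs \<le> k \<longrightarrow> (\<exists>g. is_weak_partial bs f g)}"

text \<open>
  Weak derivatives are unique almost everywhere, so the choice below does not affect any integral.
\<close>

definition weak_partial :: "'a::euclidean_space list \<Rightarrow> ('a \<Rightarrow> real) \<Rightarrow> 'a \<Rightarrow> real" where
  "weak_partial bs f = (SOME g. is_weak_partial bs f g)"

text \<open>
  The \<open>k\<close>-th derivative of \<open>f\<close> at \<open>x\<close>, a \<open>k\<close>-linear form; its arguments \<open>v\<^sub>1, \<dots>, v\<^sub>k\<close> are given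
  as a list \<open>vs\<close> of length \<open>k\<close>.
\<close>

definition weak_D :: "nat \<Rightarrow> ('a::euclidean_space \<Rightarrow> real) \<Rightarrow> 'a \<Rightarrow> 'a list \<Rightarrow> real" where
  "weak_D k f x vs =
     (\<Sum>bs \<in> {bs. set bs \<subseteq> Basis \<and> length bs = k}.
        weak_partial bs f x * (\<Prod>i<k. (vs ! i) \<bullet> (bs ! i)))"

definition form_norm :: "nat \<Rightarrow> ('a::real_normed_vector list \<Rightarrow> real) \<Rightarrow> real" where
  "form_norm k \<eta> = (SUP vs \<in> {vs. length vs = k \<and> (\<forall>v \<in> set vs. norm v \<le> 1)}. \<bar>\<eta> vs\<bar>)"

subsection \<open>Sobolev spaces\<close>

text \<open>The \<open>p\<close>-th power of the seminorm of order \<open>s\<close>.\<close>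

definition sobolev_energy :: "real \<Rightarrow> real \<Rightarrow> ('a::euclidean_space \<Rightarrow> real) \<Rightarrow> ennreal" where
  "sobolev_energy s p f =
     (if s \<in> \<int>
      then \<integral>\<^sup>+ x. ennreal (form_norm (nat \<lfloor>s\<rfloor>) (weak_D (nat \<lfloor>s\<rfloor>) f x) powr p) \<partial>lebesgue
      else \<integral>\<^sup>+ h. Lp_integral p ((fdiff h ^^ (nat \<lfloor>s\<rfloor> + 1)) f) /
                 ennreal (norm h powr (s * p + DIM('a))) \<partial>lebesgue)"

definition sobolev_seminorm :: "real \<Rightarrow> real \<Rightarrow> ('a::euclidean_space \<Rightarrow> real) \<Rightarrow> ennreal" where
  "sobolev_seminorm s p f = epowr (sobolev_energy s p f) (1 / p)"

definition hom_sobolev_space :: "real \<Rightarrow> real \<Rightarrow> ('a::euclidean_space \<Rightarrow> real) set" where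
  "hom_sobolev_space s p =
     {f \<in> (if s \<in> \<int> then Wk1_loc (nat \<lfloor>s\<rfloor>) else L1_loc). sobolev_seminorm s p f < \<infinity>}"

definition sobolev_space :: "real \<Rightarrow> real \<Rightarrow> ('a::euclidean_space \<Rightarrow> real) set" where
  "sobolev_space s p = Lp_space p \<inter> hom_sobolev_space s p"

subsection \<open>Affine energy\<close>

definition directional_energy ::
    "real \<Rightarrow> real \<Rightarrow> ('a::euclidean_space \<Rightarrow> real) \<Rightarrow> 'a \<Rightarrow> ennreal" where
  "directional_energy s p f \<xi> =
     (if s \<in> \<int>
      then \<integral>\<^sup>+ x. ennreal (\<bar>weak_D (nat \<lfloor>s\<rfloor>) f x (replicate (nat \<lfloor>s\<rfloor>) \<xi>)\<bar> powr p) \<partial>lebesgue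
      else \<integral>\<^sup>+ t \<in> {0<..}. ennreal (t powr (- s * p - 1)) *
             Lp_integral p ((fdiff (t *\<^sub>R \<xi>) ^^ (nat \<lfloor>s\<rfloor> + 1)) f) \<partial>lebesgue)"

definition affine_energy :: "real \<Rightarrow> real \<Rightarrow> ('a::euclidean_space \<Rightarrow> real) \<Rightarrow> ennreal" where
  "affine_energy s p f =
     (let N = real DIM('a);
          H = hausdorff_measure (DIM('a) - 1) :: 'a measure
      in epowr (emeasure H (sphere 0 1)) ((N + s * p) / (N * p)) *
         epowr (\<integral>\<^sup>+ \<xi> \<in> sphere 0 1. epowr (directional_energy s p f \<xi>) (- (N / (s * p))) \<partial>H)
           (- (s / N)))"

end

theory Submission
  imports Defs
begin

text \<open>
  Write \<open>N\<close> for the dimension, \<open>\<alpha> = s p\<close>, and let \<open>D \<xi>\<close> be the directional energy, extended from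
  the sphere to the whole space as a function that is homogeneous of degree \<open>\<alpha>\<close>. Put
  \<open>L = \<parallel>f\<parallel>\<^sup>p\<close> for the Lp norm and \<open>Q\<close> for the \<open>p\<close>-th power of the Sobolev seminorm. Unwinding the
  powers, the claim is the upper bound
  \<open>\<integral> D\<^bsup>-N/\<alpha>\<^esup> \<le> B L\<^bsup>-(N-1)/\<alpha>\<^esup> Q\<^bsup>-1/\<alpha>\<^esup>\<close> for the integral over the sphere, with \<open>B\<close> independent
  of \<open>f\<close>.

  Two facts give it. First, \<open>D \<ge> c L\<close> on the sphere: a function supported in a ball of radius \<open>R\<close> and
  its translates by positive multiples of a vector of length at least \<open>2 R\<close> have disjoint supports, so that
  finite differences with such a step are at least as large as the function itself. Second, there is
  the weak-type estimate \<open>H {\<xi>. D \<xi> \<le> l} \<le> A (l / Q)\<^bsup>1/\<alpha>\<^esup>\<close>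
  (\<open>sublevel_weak_type\<close>). Splitting the sphere into the dyadic shells
  \<open>2\<^sup>j c L \<le> D \<le> 2\<^bsup>j+1\<^esup> c L\<close> and summing, one gets a geometric series of ratio
  \<open>2\<^bsup>-(N-1)/\<alpha>\<^esup> < 1\<close> (\<open>sphere_integral_le\<close>).

  The weak-type estimate is a Remez inequality. Let \<open>E\<close> be a sublevel set on the sphere and \<open>K\<close> the
  cone over it in the unit ball, of volume \<open>v\<close>; up to a constant, \<open>v\<close> dominates the Hausdorff measure
  of \<open>E\<close>. By Fubini, in every direction \<open>e\<close> some line meets \<open>K\<close> in a set of length at least a
  multiple of \<open>v\<close>, hence in \<open>n + 1\<close> points whose mutual distances are at least a multiple of \<open>v\<close>. At
  these points \<open>D \<le> l\<close>, and it suffices that \<open>D\<close> can be interpolated along lines: \<open>D e\<close> is at most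
  \<open>C \<eta>\<^bsup>-\<alpha>\<^esup> l\<close> if \<open>D \<le> l\<close> at \<open>n + 1\<close> points of separation \<open>\<eta>\<close> on a line of direction \<open>e\<close>
  (\<open>line_interpolation\<close>). This bounds \<open>D\<close> on the whole sphere by a multiple of \<open>v\<^bsup>-\<alpha>\<^esup> l\<close>, and
  \<open>Q\<close> is at most a multiple of the supremum of \<open>D\<close>.

  The interpolation property has a different source in the two cases.
  If \<open>s\<close> is not an integer, two points suffice, because \<open>D\<close> is subadditive up to a constant
  (\<open>diff_energy_subadditive\<close>). Indeed, the \<open>2 m\<close>-th power of \<open>\<Delta>\<^bsub>u+v\<^esub> = \<Delta>\<^bsub>u\<^esub> T\<^bsub>v\<^esub> + \<Delta>\<^bsub>v\<^esub>\<close>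
  is a sum of terms that contain at least \<open>m\<close> factors \<open>\<Delta>\<^bsub>u\<^esub>\<close> or at least \<open>m\<close> factors \<open>\<Delta>\<^bsub>v\<^esub>\<close>, and Marchaud's
  inequality allows one to replace differences of order \<open>m > s\<close> by differences of order \<open>2 m\<close>.
  If \<open>s = k\<close> is an integer, \<open>D \<xi>\<close> is the integral over \<open>x\<close> of the \<open>p\<close>-th power of the modulus of a form of
  degree \<open>k\<close> in \<open>\<xi>\<close>; the restriction of the form to a line of direction \<open>e\<close> is a polynomial of degree at most \<open>k\<close> whose
  leading coefficient is the value at \<open>e\<close>, and Lagrange interpolation at \<open>k + 1\<close> points expresses that
  coefficient by values. The points do not depend on \<open>x\<close>, so that the bound survives integration.
  Polarization then recovers all partial derivatives from the directional ones.
\<close>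

section \<open>Hausdorff measure as a metric outer measure\<close>

text \<open>
  The classical argument of Caratheodory. The part of a set \<open>X\<close> at distance at least \<open>1/(n+1)\<close> from \<open>F\<close>
  is separated from \<open>X \<inter> F\<close>, so additivity holds for it, and it remains to pass to the limit. The
  rings of points whose distance lies between \<open>1/(n+2)\<close> and \<open>1/(n+1)\<close> have summable measure, since rings with
  indices of the same parity are separated from each other.
\<close>

lemma metric_outer_measure_closed_lambda:
  fixes \<mu> :: "'a::metric_space set \<Rightarrow> ennreal"
  assumes pos: "\<mu> {} = 0" and mono: "\<And>A B. A \<subseteq> B \<Longrightarrow> \<mu> A \<le> \<mu> B"
    and csub: "\<And>A. \<mu> (\<Union>i::nat. A i) \<le> (\<Sum>i. \<mu> (A i))"
    and sep: "\<And>A B \<eta>. \<eta> > 0 \<Longrightarrow> (\<And>a b. a \<in> A \<Longrightarrow> b \<in> B \<Longrightarrow> dist a b \<ge> \<eta>) \<Longrightarrow> \<mu> A + \<mu> B \<le> \<mu> (A \<union> B)"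
    and clF: "closed F"
  shows "F \<in> lambda_system UNIV (Pow UNIV) \<mu>"
proof -
  interpret sigma_algebra UNIV "Pow (UNIV::'a set)" by (rule sigma_algebra_Pow)
  have sub2: "\<mu> (A \<union> B) \<le> \<mu> A + \<mu> B" for A B
  proof -
    have "\<mu> (A \<union> B) = \<mu> (\<Union>i. binaryset A B i)" by (simp add: UN_binaryset_eq)
    also have "\<dots> \<le> (\<Sum>i. \<mu> (binaryset A B i))" by (rule csub)
    also have "\<dots> = \<mu> A + \<mu> B" by (rule suminf_binaryset_eq[of \<mu>, OF pos])
    finally show ?thesis .
  qed
  have main: "\<mu> (X \<inter> F) + \<mu> (X - F) \<le> \<mu> X" for X
  proof (cases "F = {} \<or> \<mu> X = \<infinity>")
    case True
    then show ?thesis using pos by auto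
  next
    case False
    then have ne: "F \<noteq> {}" and fin: "\<mu> X \<noteq> \<infinity>" by auto
    define A where "A n = {x \<in> X. infdist x F \<ge> 1 / real (Suc n)}" for n
    define R where "R n = A (Suc n) - A n" for n
    have A_sub: "A n \<subseteq> X - F" for n
      using clF ne by (auto simp: A_def in_closed_iff_infdist_zero)
    have sepA: "\<mu> (X \<inter> F) + \<mu> (A n) \<le> \<mu> X" for n
    proof -
      have "\<mu> (X \<inter> F) + \<mu> (A n) \<le> \<mu> (X \<inter> F \<union> A n)"
      proof (rule sep[of "1 / real (Suc n)"])
        fix a b assume "a \<in> X \<inter> F" "b \<in> A n"
        then have "infdist b F \<le> dist b a" by (intro infdist_le) auto
        then show "1 / real (Suc n) \<le> dist a b"
          using \<open>b \<in> A n\<close> by (auto simp: A_def dist_commute)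
      qed simp
      also have "\<dots> \<le> \<mu> X" using A_sub[of n] by (intro mono) auto
      finally show ?thesis .
    qed
    have Rsub: "R n \<subseteq> X" for n using A_sub by (auto simp: R_def)
    have Rlow: "infdist x F \<ge> 1 / real (Suc (Suc n))" "infdist x F < 1 / real (Suc n)" if "x \<in> R n" for x n
      using that by (auto simp: R_def A_def)
    \<comment> \<open>Rings whose indices differ by at least 2 are separated, so their measures add up to at most that of \<open>X\<close>.\<close>
    have ring: "(\<Sum>k<m. \<mu> (R (2*k+j))) \<le> \<mu> (\<Union>k<m. R (2*k+j))" for m j
    proof (induction m)
      case 0 then show ?case by simp
    next
      case (Suc m)
      have "(\<Sum>k<Suc m. \<mu> (R (2*k+j))) \<le> \<mu> (\<Union>k<m. R (2*k+j)) + \<mu> (R (2*m+j))"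
        using Suc by (simp add: add_right_mono)
      also have "\<dots> \<le> \<mu> ((\<Union>k<m. R (2*k+j)) \<union> R (2*m+j))"
      proof (rule sep)
        define \<eta> where "\<eta> = 1 / real (2*m+j) - 1 / real (Suc (2*m+j))"
        show "(if m = 0 then 1 else \<eta>) > 0" by (simp add: \<eta>_def divide_strict_left_mono)
        fix a b assume a: "a \<in> (\<Union>k<m. R (2*k+j))" and b: "b \<in> R (2*m+j)"
        then obtain k where k: "k < m" "a \<in> R (2*k+j)" by auto
        have "1 / real (2*m+j) \<le> 1 / real (Suc (Suc (2*k+j)))"
          using k by (intro divide_left_mono) auto
        then have 1: "1 / real (2*m+j) \<le> infdist a F" using Rlow(1)[OF k(2)] by linarith
        have 2: "infdist b F < 1 / real (Suc (2*m+j))" using Rlow(2)[OF b] by simp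
        have "infdist a F \<le> infdist b F + dist a b" by (rule infdist_triangle)
        then show "(if m = 0 then 1 else \<eta>) \<le> dist a b" using 1 2 k by (simp add: \<eta>_def)
      qed
      finally show ?case by (simp add: lessThan_Suc Un_commute)
    qed
    have ringX: "(\<Sum>k<m. \<mu> (R (2*k+j))) \<le> \<mu> X" for m j
      by (rule order_trans[OF ring]) (use Rsub in \<open>auto intro!: mono\<close>)
    have "(\<Sum>k<m. \<mu> (R k)) \<le> \<mu> X + \<mu> X" for m
    proof -
      have "(\<Sum>k<m. \<mu> (R k)) \<le> (\<Sum>k<2*m. \<mu> (R k))" by (intro sum_mono2) auto
      also have "\<dots> = (\<Sum>k<m. \<mu> (R (2*k+0))) + (\<Sum>k<m. \<mu> (R (2*k+1)))"
        by (induction m) (auto simp: add_ac)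
      also have "\<dots> \<le> \<mu> X + \<mu> X" by (intro add_mono ringX)
      finally show ?thesis .
    qed
    then have sumR: "(\<Sum>k. \<mu> (R k)) \<le> \<mu> X + \<mu> X"
      by (intro suminf_le_const) auto
    have sumRfin: "(\<Sum>k. \<mu> (R k)) < \<infinity>"
      using fin sumR by (metis ennreal_add_less_top infinity_ennreal_def order_le_less_trans top.not_eq_extremum)
    \<comment> \<open>The sets \<open>A m\<close> increase; a point outside \<open>A n\<close> lies in the ring just before the first one that contains it.\<close>
    have decomp: "X - F \<subseteq> A n \<union> (\<Union>k. R (k + n))" for n
    proof
      fix x assume x: "x \<in> X - F"
      then have "infdist x F > 0"
        using clF ne infdist_nonneg[of x F] by (auto simp: in_closed_iff_infdist_zero order_less_le)
      then obtain m where m: "1 / real (Suc m) < infdist x F"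
        using reals_Archimedean by (metis inverse_eq_divide)
      define P where "P m \<longleftrightarrow> x \<in> A m" for m
      have ex: "\<exists>m. P m" using m x by (auto simp: P_def A_def intro: less_imp_le exI[of _ m])
      define l where "l = (LEAST m. P m)"
      have l: "P l" using ex by (auto simp: l_def intro: LeastI_ex)
      have l': "\<not> P k" if "k < l" for k using that not_less_Least by (auto simp: l_def)
      show "x \<in> A n \<union> (\<Union>k. R (k + n))"
      proof (cases "l \<le> n")
        case True
        have "1 / real (Suc n) \<le> 1 / real (Suc l)" using True by (intro divide_left_mono) auto
        then have "x \<in> A n" using l by (auto simp: P_def A_def)
        then show ?thesis by auto
      next
        case False
        then obtain k where k: "l = Suc (k + n)" by (metis add.commute less_imp_Suc_add not_le)
        then have "x \<in> R (k + n)" using l l'[of "k+n"] by (auto simp: P_def R_def)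
        then show ?thesis by auto
      qed
    qed
    have "\<mu> (X \<inter> F) + \<mu> (X - F) \<le> \<mu> X + (\<Sum>k. \<mu> (R (k + n)))" for n
    proof -
      have "\<mu> (X - F) \<le> \<mu> (A n) + (\<Sum>k. \<mu> (R (k + n)))"
        using mono[OF decomp[of n]] sub2[of "A n" "\<Union>k. R (k + n)"] csub[of "\<lambda>k. R (k + n)"]
        by (meson add_left_mono order_trans)
      then have "\<mu> (X \<inter> F) + \<mu> (X - F) \<le> (\<mu> (X \<inter> F) + \<mu> (A n)) + (\<Sum>k. \<mu> (R (k + n)))"
        by (simp add: add_left_mono add.assoc)
      also have "\<dots> \<le> \<mu> X + (\<Sum>k. \<mu> (R (k + n)))" by (intro add_right_mono sepA)
      finally show ?thesis .
    qed
    moreover have "(\<lambda>n. \<mu> X + (\<Sum>k. \<mu> (R (k + n)))) \<longlonglongrightarrow> \<mu> X + 0"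
    proof (intro tendsto_add tendsto_const)
      define r where "r k = enn2real (\<mu> (R k))" for k
      have Rfin: "\<mu> (R k) < \<infinity>" for k
        using ennreal_suminf_lessD[OF sumRfin[unfolded infinity_ennreal_def]] by simp
      then have r: "\<mu> (R k) = ennreal (r k)" for k
        by (simp add: r_def)
      have r0: "r k \<ge> 0" for k by (simp add: r_def)
      have summ: "summable r"
        using sumRfin r0 by (intro summable_suminf_not_top) (auto simp: r)
      have "(\<Sum>k. \<mu> (R (k + n))) = ennreal (\<Sum>k. r (k + n))" for n
        unfolding r using summ r0 by (intro suminf_ennreal2) (auto simp: summable_iff_shift)
      moreover have "(\<lambda>n. ennreal (\<Sum>k. r (k + n))) \<longlonglongrightarrow> ennreal 0"
        by (intro tendsto_ennrealI suminf_exist_split2 summ)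
      ultimately show "(\<lambda>n. \<Sum>k. \<mu> (R (k + n))) \<longlonglongrightarrow> 0" by simp
    qed
    ultimately show ?thesis
      by (intro tendsto_lowerbound[of "\<lambda>n. \<mu> X + (\<Sum>k. \<mu> (R (k + n)))" _ sequentially]) auto
  qed
  show ?thesis
    unfolding lambda_system_eq
  proof safe
    fix X :: "'a set"
    have "\<mu> X \<le> \<mu> (X \<inter> F) + \<mu> (X - F)" using sub2[of "X \<inter> F" "X - F"] by (simp add: Int_Diff_Un)
    with main[of X] show "\<mu> (X \<inter> F) + \<mu> (X - F) = \<mu> X" by (rule antisym)
  qed auto
qed

text \<open>
  Without this criterion the measure built from the outer measure by \<^const>\<open>measure_of\<close>
  could be the zero measure, which is the default when countable additivity fails.
\<close>

lemma metric_outer_measure_space_borel: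
  fixes \<mu> :: "'a::metric_space set \<Rightarrow> ennreal"
  assumes pos: "\<mu> {} = 0" and mono: "\<And>A B. A \<subseteq> B \<Longrightarrow> \<mu> A \<le> \<mu> B"
    and csub: "\<And>A. \<mu> (\<Union>i::nat. A i) \<le> (\<Sum>i. \<mu> (A i))"
    and sep: "\<And>A B \<eta>. \<eta> > 0 \<Longrightarrow> (\<And>a b. a \<in> A \<Longrightarrow> b \<in> B \<Longrightarrow> dist a b \<ge> \<eta>) \<Longrightarrow> \<mu> A + \<mu> B \<le> \<mu> (A \<union> B)"
  shows "measure_space UNIV (sets borel) \<mu>"
proof -
  interpret sigma_algebra UNIV "Pow (UNIV::'a set)" by (rule sigma_algebra_Pow)
  have ms: "measure_space UNIV (lambda_system UNIV (Pow UNIV) \<mu>) \<mu>"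
    by (rule caratheodory_lemma) (use pos mono csub in
      \<open>auto simp: outer_measure_space_def positive_def increasing_def countably_subadditive_def\<close>)
  then have sa: "sigma_algebra UNIV (lambda_system UNIV (Pow UNIV) \<mu>)" by (simp add: measure_space_def)
  have "sets borel = sigma_sets UNIV (Collect (closed::'a set \<Rightarrow> bool))"
    by (subst borel_eq_closed) (simp add: )
  also have "\<dots> \<subseteq> lambda_system UNIV (Pow UNIV) \<mu>"
    using metric_outer_measure_closed_lambda[OF pos mono csub sep]
    by (intro sigma_algebra.sigma_sets_subset[OF sa]) auto
  finally show ?thesis
    using measure_down[OF ms] sets.sigma_algebra_axioms[of "borel::'a measure"] by simp
qed

abbreviation diam_cost :: "nat \<Rightarrow> 'a::metric_space set \<Rightarrow> ennreal" where
  "diam_cost d S \<equiv> (if S = {} then 0 else ennreal (unit_ball_vol (real d) * (diameter S / 2) ^ d))"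

lemma hausdorff_pre_le:
  assumes "A \<subseteq> (\<Union>i. C i)" "\<And>i. bounded (C i)" "\<And>i. diameter (C i) \<le> \<delta>"
  shows "hausdorff_pre d \<delta> A \<le> (\<Sum>i. diam_cost d (C i))"
  unfolding hausdorff_pre_def using assms by (intro INF_lower) auto

lemma hausdorff_pre_ge:
  assumes "\<And>C. A \<subseteq> (\<Union>i. C i) \<Longrightarrow> (\<And>i::nat. bounded (C i)) \<Longrightarrow> (\<And>i. diameter (C i) \<le> \<delta>) \<Longrightarrow>
     c \<le> (\<Sum>i. diam_cost d (C i))"
  shows "c \<le> hausdorff_pre d \<delta> A"
  unfolding hausdorff_pre_def using assms by (intro INF_greatest) auto

lemma hausdorff_pre_mono:
  "A \<subseteq> B \<Longrightarrow> hausdorff_pre d \<delta> A \<le> hausdorff_pre d \<delta> B"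
  by (rule hausdorff_pre_ge) (rule hausdorff_pre_le, auto)

lemma hausdorff_pre_antimono:
  "\<delta> \<le> \<delta>' \<Longrightarrow> hausdorff_pre d \<delta>' A \<le> hausdorff_pre d \<delta> A"
  by (rule hausdorff_pre_ge) (rule hausdorff_pre_le, auto intro: order_trans)

lemma hausdorff_pre_empty: "\<delta> \<ge> 0 \<Longrightarrow> hausdorff_pre d \<delta> {} = 0"
  using hausdorff_pre_le[of "{}" "\<lambda>_. {}" \<delta> d] by simp

lemma hausdorff_pre_UN:
  assumes "\<delta> > 0"
  shows "hausdorff_pre d \<delta> (\<Union>n::nat. A n) \<le> (\<Sum>n. hausdorff_pre d \<delta> (A n))"
proof (rule ennreal_le_epsilon)
  fix e :: real assume e: "e > 0" and fin: "(\<Sum>n. hausdorff_pre d \<delta> (A n)) < top"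
  have "\<exists>C. A n \<subseteq> (\<Union>i. C i) \<and> (\<forall>i::nat. bounded (C i) \<and> diameter (C i) \<le> \<delta>) \<and>
          (\<Sum>i. diam_cost d (C i)) \<le> hausdorff_pre d \<delta> (A n) + ennreal (e * (1/2)^Suc n)" for n
  proof -
    have "hausdorff_pre d \<delta> (A n) < top" using ennreal_suminf_lessD[OF fin] .
    then have "hausdorff_pre d \<delta> (A n) < hausdorff_pre d \<delta> (A n) + ennreal (e * (1/2)^Suc n)"
      using e by (simp add: ennreal_zero_less_divide)
    then obtain C where "C \<in> {C :: nat \<Rightarrow> 'a set. A n \<subseteq> (\<Union>i. C i) \<and> (\<forall>i. bounded (C i) \<and> diameter (C i) \<le> \<delta>)}"
      "(\<Sum>i. diam_cost d (C i)) < hausdorff_pre d \<delta> (A n) + ennreal (e * (1/2)^Suc n)"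
      unfolding hausdorff_pre_def[of d \<delta> "A n"] INF_less_iff by blast
    then show ?thesis by (intro exI[of _ C]) (auto intro: less_imp_le)
  qed
  then have "\<exists>C. \<forall>n. A n \<subseteq> (\<Union>i. C n i) \<and> (\<forall>i::nat. bounded (C n i) \<and> diameter (C n i) \<le> \<delta>) \<and>
          (\<Sum>i. diam_cost d (C n i)) \<le> hausdorff_pre d \<delta> (A n) + ennreal (e * (1/2)^Suc n)"
    by (intro choice allI)
  then obtain C where C: "\<And>n. A n \<subseteq> (\<Union>i. C n i)" "\<And>n i::nat. bounded (C n i)" "\<And>n i. diameter (C n i) \<le> \<delta>"
     "\<And>n. (\<Sum>i. diam_cost d (C n i)) \<le> hausdorff_pre d \<delta> (A n) + ennreal (e * (1/2)^Suc n)" by blast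
  \<comment> \<open>All the covers together are indexed by pairs and hence by natural numbers.\<close>
  define D where "D = (\<lambda>(n,i). C n i)"
  have "hausdorff_pre d \<delta> (\<Union>n. A n) \<le> (\<Sum>i. diam_cost d (D (prod_decode i)))"
  proof (rule hausdorff_pre_le)
    show "\<Union> (range A) \<subseteq> (\<Union>i. D (prod_decode i))"
    proof
      fix x assume "x \<in> \<Union> (range A)"
      then obtain n i where "x \<in> C n i" using C(1) by blast
      then have "x \<in> D (prod_decode (prod_encode (n,i)))" by (simp add: D_def)
      then show "x \<in> (\<Union>i. D (prod_decode i))" by blast
    qed
  qed (simp_all add: D_def C(2,3) split: prod.split)
  also have "\<dots> = (\<Sum>n. \<Sum>i. diam_cost d (D (n,i)))"
    using suminf_ennreal_2dimen[of "\<lambda>n. \<Sum>i. diam_cost d (D (n,i))" "\<lambda>x. diam_cost d (D x)"]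
    by (simp add: o_def)
  also have "\<dots> \<le> (\<Sum>n. hausdorff_pre d \<delta> (A n) + ennreal (e * (1/2)^Suc n))"
    unfolding D_def prod.case by (intro suminf_le C) auto
  also have "\<dots> = (\<Sum>n. hausdorff_pre d \<delta> (A n)) + (\<Sum>n. ennreal (e * (1/2)^Suc n))"
    by (rule suminf_add[symmetric]) auto
  also have "(\<Sum>n. ennreal (e * (1/2)^Suc n)) = ennreal e"
    using e power_half_series by (intro suminf_ennreal_eq) (auto dest: sums_mult[of _ _ e])
  finally show "hausdorff_pre d \<delta> (\<Union>n. A n) \<le> (\<Sum>n. hausdorff_pre d \<delta> (A n)) + ennreal e" .
qed

lemma hausdorff_outer_le: "(\<And>\<delta>. \<delta> > 0 \<Longrightarrow> hausdorff_pre d \<delta> A \<le> c) \<Longrightarrow> hausdorff_outer d A \<le> c"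
  unfolding hausdorff_outer_def by (intro SUP_least) auto

lemma hausdorff_outer_ge: "\<delta> > 0 \<Longrightarrow> hausdorff_pre d \<delta> A \<le> hausdorff_outer d A"
  unfolding hausdorff_outer_def by (intro SUP_upper) auto

lemma hausdorff_outer_mono: "A \<subseteq> B \<Longrightarrow> hausdorff_outer d A \<le> hausdorff_outer d B"
  unfolding hausdorff_outer_def by (intro SUP_mono') (rule hausdorff_pre_mono)

lemma hausdorff_outer_empty: "hausdorff_outer d {} = 0"
  by (auto simp: hausdorff_outer_def hausdorff_pre_empty)

lemma hausdorff_outer_UN: "hausdorff_outer d (\<Union>n::nat. A n) \<le> (\<Sum>n. hausdorff_outer d (A n))"
proof (rule hausdorff_outer_le)
  fix \<delta> :: real assume \<delta>: "\<delta> > 0"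
  have "hausdorff_pre d \<delta> (\<Union>i. A i) \<le> (\<Sum>i. hausdorff_pre d \<delta> (A i))"
    by (rule hausdorff_pre_UN) fact
  also have "\<dots> \<le> (\<Sum>i. hausdorff_outer d (A i))"
    using \<delta> by (intro suminf_le hausdorff_outer_ge) auto
  finally show "hausdorff_pre d \<delta> (\<Union>i. A i) \<le> (\<Sum>i. hausdorff_outer d (A i))" .
qed

text \<open>
  A covering set of diameter less than the distance of \<open>A\<close> and \<open>B\<close> cannot meet both, so that a fine
  cover of the union splits into a cover of \<open>A\<close> and a cover of \<open>B\<close>.
\<close>

lemma hausdorff_outer_separated:
  assumes "\<eta> > 0" and dist: "\<And>a b. a \<in> A \<Longrightarrow> b \<in> B \<Longrightarrow> dist a b \<ge> \<eta>"
  shows "hausdorff_outer d A + hausdorff_outer d B \<le> hausdorff_outer d (A \<union> B)"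
proof -
  have *: "hausdorff_pre d \<delta> A + hausdorff_pre d \<delta> B \<le> hausdorff_outer d (A \<union> B)" if \<delta>: "\<delta> > 0" "\<delta> < \<eta>" for \<delta>
  proof -
    have "hausdorff_pre d \<delta> A + hausdorff_pre d \<delta> B \<le> hausdorff_pre d \<delta> (A \<union> B)"
    proof (rule hausdorff_pre_ge)
      fix C :: "nat \<Rightarrow> 'a set"
      assume C: "A \<union> B \<subseteq> (\<Union>i. C i)" "\<And>i. bounded (C i)" "\<And>i. diameter (C i) \<le> \<delta>"
      define CA where "CA i = (if C i \<inter> A = {} then {} else C i)" for i
      define CB where "CB i = (if C i \<inter> B = {} then {} else C i)" for i
      have "hausdorff_pre d \<delta> A \<le> (\<Sum>i. diam_cost d (CA i))"
        using C \<delta> by (intro hausdorff_pre_le) (auto simp: CA_def, blast)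
      moreover have "hausdorff_pre d \<delta> B \<le> (\<Sum>i. diam_cost d (CB i))"
        using C \<delta> by (intro hausdorff_pre_le) (auto simp: CB_def, blast)
      moreover have "diam_cost d (CA i) + diam_cost d (CB i) \<le> diam_cost d (C i)" for i
      proof (cases "C i \<inter> A = {} \<or> C i \<inter> B = {}")
        case True then show ?thesis by (auto simp: CA_def CB_def)
      next
        case False
        then obtain a b where "a \<in> C i" "a \<in> A" "b \<in> C i" "b \<in> B" by auto
        then have "\<eta> \<le> diameter (C i)"
          using dist diameter_bounded_bound[OF C(2)[of i]] by (meson order_trans)
        then show ?thesis using C(3)[of i] \<delta> by simp
      qed
      ultimately have "hausdorff_pre d \<delta> A + hausdorff_pre d \<delta> B \<le> (\<Sum>i. diam_cost d (CA i)) + (\<Sum>i. diam_cost d (CB i))"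
        by (intro add_mono)
      also have "\<dots> = (\<Sum>i. diam_cost d (CA i) + diam_cost d (CB i))" by (rule suminf_add) auto
      also have "\<dots> \<le> (\<Sum>i. diam_cost d (C i))"
        using \<open>\<And>i. diam_cost d (CA i) + diam_cost d (CB i) \<le> diam_cost d (C i)\<close> by (intro suminf_le) auto
      finally show "hausdorff_pre d \<delta> A + hausdorff_pre d \<delta> B \<le> (\<Sum>i. diam_cost d (C i))" .
    qed
    also have "\<dots> \<le> hausdorff_outer d (A \<union> B)" by (rule hausdorff_outer_ge) fact
    finally show ?thesis .
  qed
  have "hausdorff_pre d \<delta>1 A + hausdorff_pre d \<delta>2 B \<le> hausdorff_outer d (A \<union> B)" if "\<delta>1 > 0" "\<delta>2 > 0" for \<delta>1 \<delta>2
  proof -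
    define \<delta> where "\<delta> = min (min \<delta>1 \<delta>2) (\<eta>/2)"
    have "hausdorff_pre d \<delta>1 A + hausdorff_pre d \<delta>2 B \<le> hausdorff_pre d \<delta> A + hausdorff_pre d \<delta> B"
      by (intro add_mono hausdorff_pre_antimono) (auto simp: \<delta>_def)
    also have "\<dots> \<le> hausdorff_outer d (A \<union> B)" using that \<open>\<eta> > 0\<close> by (intro *) (auto simp: \<delta>_def)
    finally show ?thesis .
  qed
  then have "hausdorff_pre d \<delta>1 A + hausdorff_outer d B \<le> hausdorff_outer d (A \<union> B)" if "\<delta>1 > 0" for \<delta>1
    unfolding hausdorff_outer_def[of d B] using that
    by (subst ennreal_SUP_add_right) (auto intro!: SUP_least)
  then show ?thesis
    unfolding hausdorff_outer_def[of d A]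
    by (subst add.commute, subst ennreal_SUP_add_right) (auto intro!: SUP_least simp: add.commute)
qed

lemma emeasure_hausdorff_measure:
  assumes "A \<in> sets borel"
  shows "emeasure (hausdorff_measure d) A = hausdorff_outer d A"
proof -
  have "measure_space UNIV (sets borel) (hausdorff_outer d :: 'a set \<Rightarrow> ennreal)"
    by (rule metric_outer_measure_space_borel[OF hausdorff_outer_empty hausdorff_outer_mono hausdorff_outer_UN hausdorff_outer_separated])
  then show ?thesis
    unfolding hausdorff_measure_def using assms 
    by (intro emeasure_measure_of_sigma) (auto simp: measure_space_def)
qed

lemma sets_hausdorff_measure [simp, measurable_cong]: "sets (hausdorff_measure d) = sets borel"
  by (simp add: hausdorff_measure_def sets.sets_measure_of_eq[of borel, simplified])

lemma space_hausdorff_measure [simp]: "space (hausdorff_measure d) = UNIV"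
  by (simp add: hausdorff_measure_def)

section \<open>Hausdorff measure on the sphere and volumes of cones\<close>

text \<open>
  Its Lebesgue measure serves as a substitute for surface measure. Comparing the two up to constants
  is enough and avoids polar coordinates.
\<close>

definition unit_cone :: "'a::euclidean_space set \<Rightarrow> 'a set" where
  "unit_cone A = {x. x \<noteq> 0 \<and> norm x \<le> 1 \<and> x /\<^sub>R norm x \<in> A}"

lemma cone_UN: "unit_cone (\<Union>i\<in>I. F i) = (\<Union>i\<in>I. unit_cone (F i))"
  and cone_mono: "A \<subseteq> B \<Longrightarrow> unit_cone A \<subseteq> unit_cone B"
  and cone_sphere: "unit_cone (sphere 0 1) = cball 0 1 - {0}"
  by (auto simp: unit_cone_def)

lemma cone_borel [measurable]: "A \<in> sets borel \<Longrightarrow> unit_cone A \<in> sets (borel :: 'a::euclidean_space measure)"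
  unfolding unit_cone_def by (simp add: pred_def[symmetric])

text \<open>
  The tube of radius \<open>\<rho>\<close> around the segment from \<open>a \<xi>\<close> to \<open>b \<xi>\<close> is measured by averaging over
  balls with centre on the segment; no rotation into a coordinate direction is needed.
\<close>

lemma tube_Tonelli:
  fixes \<xi> :: "'a::euclidean_space" and \<rho> a b :: real
  assumes "norm \<xi> = 1" "\<rho> \<ge> 0" "a \<le> b"
  shows "(\<integral>\<^sup>+x. emeasure lborel {t\<in>{a..b}. norm (x - t *\<^sub>R \<xi>) \<le> \<rho>} \<partial>lborel) =
    ennreal ((b - a) * (unit_ball_vol DIM('a) * \<rho> ^ DIM('a)))"
proof -
  define T where "T = {(x,t). t \<in> {a..b} \<and> norm (x - t *\<^sub>R \<xi>) \<le> \<rho>}"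
  have "closed T" unfolding T_def case_prod_beta
    by (intro closed_Collect_conj closed_Collect_le) (auto intro!: continuous_intros closed_Collect_conj closed_Collect_le)
  then have T [measurable]: "T \<in> sets (lborel \<Otimes>\<^sub>M lborel)"
    by (metis borel_closed lborel_prod sets_lborel)
  have "(\<integral>\<^sup>+x. emeasure lborel {t\<in>{a..b}. norm (x - t *\<^sub>R \<xi>) \<le> \<rho>} \<partial>lborel) = emeasure (lborel \<Otimes>\<^sub>M lborel) T"
    using lborel.emeasure_pair_measure_alt[OF T] by (simp add: T_def vimage_def)
  also have "\<dots> = (\<integral>\<^sup>+t. emeasure lborel ((\<lambda>x. (x, t)) -` T) \<partial>lborel)"
    by (rule lborel_pair.emeasure_pair_measure_alt2[OF T])
  also have "\<dots> = (\<integral>\<^sup>+t. ennreal (unit_ball_vol DIM('a) * \<rho> ^ DIM('a)) * indicator {a..b} t \<partial>lborel)"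
  proof (rule nn_integral_cong)
    fix t :: real
    have "(\<lambda>x. (x, t)) -` T = (if t \<in> {a..b} then cball (t *\<^sub>R \<xi>) \<rho> else {})"
      by (auto simp: T_def dist_norm norm_minus_commute)
    then show "emeasure lborel ((\<lambda>x. (x, t)) -` T) = ennreal (unit_ball_vol DIM('a) * \<rho> ^ DIM('a)) * indicator {a..b} t"
      using assms by (simp add: emeasure_cball)
  qed
  also have "\<dots> = ennreal (unit_ball_vol DIM('a) * \<rho> ^ DIM('a)) * ennreal (b - a)"
    using assms by (simp add: nn_integral_cmult_indicator)
  finally show ?thesis using assms by (simp add: ennreal_mult[symmetric] mult.commute)
qed

text \<open>
  Every point of the cone over a cap of radius \<open>d\<close> is within \<open>2 d\<close> of \<open>t \<xi>\<close> for a set of parameters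
  \<open>t\<close> of length at least \<open>d\<close>. Hence the volume times \<open>d\<close> is at most the Tonelli integral of the tube
  of radius \<open>2 d\<close>.
\<close>

lemma cone_cap_upper:
  fixes \<xi> :: "'a::euclidean_space"
  assumes \<xi>: "norm \<xi> = 1" and d: "0 < d" "d \<le> 1"
  shows "emeasure lborel (unit_cone (sphere 0 1 \<inter> cball \<xi> d)) \<le> ennreal (3 * unit_ball_vol DIM('a) * 2 ^ DIM('a) * d ^ (DIM('a) - 1))"
proof -
  let ?C = "unit_cone (sphere 0 1 \<inter> cball \<xi> d)"
  have [measurable]: "?C \<in> sets borel" by (intro cone_borel) auto
  have N: "d ^ DIM('a) = d * d ^ (DIM('a) - 1)"
    by (metis DIM_positive Suc_pred' power_Suc)
  have "ennreal d * emeasure lborel ?C = (\<integral>\<^sup>+x. ennreal d * indicator ?C x \<partial>lborel)"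
    by (simp add: nn_integral_cmult_indicator)
  also have "\<dots> \<le> (\<integral>\<^sup>+x. emeasure lborel {t\<in>{-1..2}. norm (x - t *\<^sub>R \<xi>) \<le> 2 * d} \<partial>lborel)"
  proof (rule nn_integral_mono)
    fix x :: 'a
    show "ennreal d * indicator ?C x \<le> emeasure lborel {t\<in>{-1..2}. norm (x - t *\<^sub>R \<xi>) \<le> 2 * d}"
    proof (cases "x \<in> ?C")
      case True
      then have x: "x \<noteq> 0" "norm x \<le> 1" "dist \<xi> (x /\<^sub>R norm x) \<le> d" by (auto simp: unit_cone_def)
      have 1: "norm (x - norm x *\<^sub>R \<xi>) \<le> d"
      proof -
        have "norm (x - norm x *\<^sub>R \<xi>) = norm x * dist \<xi> (x /\<^sub>R norm x)"
        proof -
          have "x - norm x *\<^sub>R \<xi> = norm x *\<^sub>R (x /\<^sub>R norm x - \<xi>)" using x by (simp add: scaleR_diff_right)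
          then show ?thesis by (simp add: dist_norm norm_minus_commute)
        qed
        also have "\<dots> \<le> 1 * d" using x d by (intro mult_mono) auto
        finally show ?thesis by simp
      qed
      have "{norm x .. norm x + d} \<subseteq> {t\<in>{-1..2}. norm (x - t *\<^sub>R \<xi>) \<le> 2 * d}"
      proof safe
        fix t assume t: "t \<in> {norm x..norm x + d}"
        show "t \<in> {-1..2}" using t x d norm_ge_zero[of x] unfolding atLeastAtMost_iff by linarith
        have "norm (x - t *\<^sub>R \<xi>) \<le> norm (x - norm x *\<^sub>R \<xi>) + norm (norm x *\<^sub>R \<xi> - t *\<^sub>R \<xi>)"
          using norm_triangle_ineq[of "x - norm x *\<^sub>R \<xi>" "norm x *\<^sub>R \<xi> - t *\<^sub>R \<xi>"] by simp
        also have "norm (norm x *\<^sub>R \<xi> - t *\<^sub>R \<xi>) = \<bar>norm x - t\<bar>"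
          using \<xi> by (metis mult.right_neutral norm_scaleR scaleR_left_diff_distrib)
        finally show "norm (x - t *\<^sub>R \<xi>) \<le> 2 * d" using 1 t by auto
      qed
      moreover have "{t\<in>{-1..2}. norm (x - t *\<^sub>R \<xi>) \<le> 2 * d} \<in> sets lborel" by measurable
      ultimately have "emeasure lborel {norm x .. norm x + d} \<le> emeasure lborel {t\<in>{-1..2}. norm (x - t *\<^sub>R \<xi>) \<le> 2 * d}"
        by (intro emeasure_mono) auto
      then show ?thesis using d by (simp add: indicator_def split: if_splits)
    qed simp
  qed
  also have "\<dots> = ennreal (3 * (unit_ball_vol DIM('a) * (2 * d) ^ DIM('a)))"
    using tube_Tonelli[OF \<xi>, of "2 * d" "-1" 2] d by simp
  also have "\<dots> = ennreal d * ennreal (3 * unit_ball_vol DIM('a) * 2 ^ DIM('a) * d ^ (DIM('a) - 1))"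
    using d N by (simp add: ennreal_mult[symmetric] power_mult_distrib algebra_simps)
  finally show ?thesis using d by (simp add: ennreal_mult_le_mult_iff)
qed

text \<open>
  The cone contains the tube of radius \<open>r/8\<close> around the segment from \<open>\<xi>/2\<close> to \<open>7\<xi>/8\<close>, and each point
  of this tube lies within \<open>r/8\<close> of \<open>t \<xi>\<close> only for \<open>t\<close> in an interval of length \<open>r/4\<close>.
\<close>

lemma cone_cap_lower:
  fixes \<xi> :: "'a::euclidean_space"
  assumes \<xi>: "norm \<xi> = 1" and r: "0 < r" "r \<le> 1"
  shows "ennreal (3/8 * unit_ball_vol DIM('a) * (r/8) ^ (DIM('a) - 1)) \<le> 2 * emeasure lborel (unit_cone (sphere 0 1 \<inter> cball \<xi> r))"
proof -
  define \<rho> where "\<rho> = r / 8"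
  have \<rho>: "0 < \<rho>" "\<rho> \<le> 1/8" using r by (auto simp: \<rho>_def)
  let ?C = "unit_cone (sphere 0 1 \<inter> cball \<xi> r)"
  have [measurable]: "?C \<in> sets borel" by (intro cone_borel) auto
  have N: "\<rho> ^ DIM('a) = \<rho> * \<rho> ^ (DIM('a) - 1)"
    by (metis DIM_positive Suc_pred' power_Suc)
  have "ennreal \<rho> * ennreal (3/8 * unit_ball_vol DIM('a) * \<rho> ^ (DIM('a) - 1)) = ennreal ((7/8 - 1/2) * (unit_ball_vol DIM('a) * \<rho> ^ DIM('a)))"
    using \<rho> N by (simp add: ennreal_mult[symmetric] algebra_simps)
  also have "\<dots> = (\<integral>\<^sup>+x. emeasure lborel {t\<in>{1/2..7/8}. norm (x - t *\<^sub>R \<xi>) \<le> \<rho>} \<partial>lborel)"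
    using tube_Tonelli[OF \<xi>, of \<rho> "1/2" "7/8"] \<rho> by simp
  also have "\<dots> \<le> (\<integral>\<^sup>+x. ennreal (2 * \<rho>) * indicator ?C x \<partial>lborel)"
  proof (rule nn_integral_mono)
    fix x :: 'a
    let ?S = "{t\<in>{1/2..7/8}. norm (x - t *\<^sub>R \<xi>) \<le> \<rho>}"
    show "emeasure lborel ?S \<le> ennreal (2 * \<rho>) * indicator ?C x"
    proof (cases "?S = {}")
      case False
      then obtain t where t: "1/2 \<le> t" "t \<le> 7/8" "norm (x - t *\<^sub>R \<xi>) \<le> \<rho>" by auto
      have nt: "\<bar>norm x - t\<bar> \<le> \<rho>"
        using norm_triangle_ineq3[of x "t *\<^sub>R \<xi>"] \<xi> t by simp
      have x0: "norm x \<ge> 3/8" "norm x \<le> 1" using nt t \<rho> by auto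
      then have xn: "x \<noteq> 0" by auto
      have "norm (x - norm x *\<^sub>R \<xi>) \<le> norm (x - t *\<^sub>R \<xi>) + norm (t *\<^sub>R \<xi> - norm x *\<^sub>R \<xi>)"
        using norm_triangle_ineq[of "x - t *\<^sub>R \<xi>" "t *\<^sub>R \<xi> - norm x *\<^sub>R \<xi>"] by simp
      also have "norm (t *\<^sub>R \<xi> - norm x *\<^sub>R \<xi>) = \<bar>t - norm x\<bar>"
        using \<xi> by (metis mult.right_neutral norm_scaleR scaleR_left_diff_distrib)
      finally have a: "norm (x - norm x *\<^sub>R \<xi>) \<le> 2 * \<rho>" using nt t by auto
      have "dist \<xi> (x /\<^sub>R norm x) = norm (x - norm x *\<^sub>R \<xi>) / norm x"
      proof -
        have "x - norm x *\<^sub>R \<xi> = norm x *\<^sub>R (x /\<^sub>R norm x - \<xi>)" using xn by (simp add: scaleR_diff_right)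
        then show ?thesis using xn by (simp add: dist_norm norm_minus_commute)
      qed
      also have "\<dots> \<le> (2 * \<rho>) / (3/8)" using a x0 \<rho> by (intro frac_le) auto
      also have "\<dots> \<le> r" using r by (simp add: \<rho>_def)
      finally have xC: "x \<in> ?C" using xn x0 by (auto simp: unit_cone_def)
      have "?S \<subseteq> {x \<bullet> \<xi> - \<rho> .. x \<bullet> \<xi> + \<rho>}"
      proof safe
        fix u assume "norm (x - u *\<^sub>R \<xi>) \<le> \<rho>"
        moreover have "\<bar>(x - u *\<^sub>R \<xi>) \<bullet> \<xi>\<bar> \<le> norm (x - u *\<^sub>R \<xi>)"
          using Cauchy_Schwarz_ineq2[of "x - u *\<^sub>R \<xi>" \<xi>] \<xi> by simp
        moreover have "(x - u *\<^sub>R \<xi>) \<bullet> \<xi> = x \<bullet> \<xi> - u"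
          using \<xi> by (simp add: inner_diff_left norm_eq_1)
        ultimately show "u \<in> {x \<bullet> \<xi> - \<rho> .. x \<bullet> \<xi> + \<rho>}" by auto
      qed
      then have "emeasure lborel ?S \<le> emeasure lborel {x \<bullet> \<xi> - \<rho> .. x \<bullet> \<xi> + \<rho>}"
        by (intro emeasure_mono) auto
      then show ?thesis using \<rho> xC by simp
    next
      case True then show ?thesis by (simp only: emeasure_empty) simp
    qed
  qed
  also have "\<dots> = ennreal (2 * \<rho>) * emeasure lborel ?C"
    by (rule nn_integral_cmult_indicator) simp
  also have "\<dots> = ennreal \<rho> * (2 * emeasure lborel ?C)"
    using \<rho> by (simp add: ennreal_mult mult_ac)
  finally show ?thesis using \<rho> by (simp add: ennreal_mult_le_mult_iff \<rho>_def)
qed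


text \<open>
  Mass distribution principle: a set of small diameter \<open>d\<close> is contained in a cap of radius \<open>d\<close>, whose
  cone has volume at most a multiple of \<open>d\<^bsup>N-1\<^esup>\<close>, while the cones over a cover must fill the ball.
\<close>

lemma hausdorff_sphere_pos:
  assumes "DIM('a::euclidean_space) \<ge> 2"
  shows "emeasure (hausdorff_measure (DIM('a) - 1)) (sphere (0::'a) 1) > 0"
proof -
  let ?n = "DIM('a) - 1" and ?S = "sphere (0::'a) 1"
  define K where "K = 3 * unit_ball_vol (real DIM('a)) * 2 ^ DIM('a)"
  define w where "w = unit_ball_vol (real ?n) / 2 ^ ?n"
  have K: "K > 0" and w: "w > 0" by (auto simp: K_def w_def)
  have cap: "emeasure lborel (unit_cone (?S \<inter> cball \<xi> d)) \<le> ennreal (K * d ^ ?n)"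
    if \<xi>: "norm \<xi> = 1" and d: "0 \<le> d" "d \<le> 1/2" for \<xi> :: 'a and d
  proof (rule ennreal_le_epsilon)
    \<comment> \<open>The upper bound for caps assumes a positive radius; a limit covers covering sets of diameter 0.\<close>
    fix e :: real assume e: "e > 0"
    have "((\<lambda>h. K * (d + h) ^ ?n) \<longlongrightarrow> K * (d + 0) ^ ?n) (at_right 0)"
      by (intro tendsto_intros)
    then have "eventually (\<lambda>h. K * (d + h) ^ ?n < K * d ^ ?n + e) (at_right 0)"
      using e by (intro order_tendstoD(2)) auto
    moreover have "eventually (\<lambda>h::real. h \<in> {0<..<1/2}) (at_right 0)"
      by (rule eventually_at_right_real) simp
    ultimately have "eventually (\<lambda>h. K * (d + h) ^ ?n < K * d ^ ?n + e \<and> h \<in> {0<..<1/2}) (at_right 0)"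
      by (rule eventually_conj)
    from eventually_happens'[OF trivial_limit_at_right_real this]
    obtain h where h: "K * (d + h) ^ ?n < K * d ^ ?n + e" "0 < h" "h < 1/2"
      by auto
    have "emeasure lborel (unit_cone (?S \<inter> cball \<xi> d)) \<le> emeasure lborel (unit_cone (?S \<inter> cball \<xi> (d + h)))"
      using h by (intro emeasure_mono cone_mono) (auto intro!: cone_borel)
    also have "\<dots> \<le> ennreal (K * (d + h) ^ ?n)"
      unfolding K_def using \<xi> d h by (intro cone_cap_upper) auto
    also have "\<dots> \<le> ennreal (K * d ^ ?n + e)" using h by (intro ennreal_leI) auto
    also have "\<dots> = ennreal (K * d ^ ?n) + ennreal e" using K d e by simp
    finally show "emeasure lborel (unit_cone (?S \<inter> cball \<xi> d)) \<le> ennreal (K * d ^ ?n) + ennreal e" .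
  qed
  have "ennreal (w / K) * emeasure lborel (unit_cone ?S) \<le> hausdorff_pre ?n (1/2) ?S"
  proof (rule hausdorff_pre_ge)
    fix C :: "nat \<Rightarrow> 'a set"
    assume C: "?S \<subseteq> (\<Union>i. C i)" "\<And>i. bounded (C i)" "\<And>i. diameter (C i) \<le> 1/2"
    \<comment> \<open>Enlarge each covering set to a cap centred at one of its points on the sphere.\<close>
    define B where "B i = (if C i \<inter> ?S = {} then {} else ?S \<inter> cball (SOME x. x \<in> C i \<inter> ?S) (diameter (C i)))" for i
    have sub: "C i \<inter> ?S \<subseteq> B i" and le: "ennreal (w / K) * emeasure lborel (unit_cone (B i)) \<le> diam_cost ?n (C i)" for i
    proof -
      show "C i \<inter> ?S \<subseteq> B i"
      proof (cases "C i \<inter> ?S = {}")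
        case False
        then have "(SOME x. x \<in> C i \<inter> ?S) \<in> C i \<inter> ?S" by (meson someI_ex ex_in_conv)
        then show ?thesis using C(2)[of i] False by (auto simp: B_def intro!: diameter_bounded_bound)
      qed auto
      show "ennreal (w / K) * emeasure lborel (unit_cone (B i)) \<le> diam_cost ?n (C i)"
      proof (cases "C i \<inter> ?S = {}")
        case True
        then show ?thesis by (simp add: B_def unit_cone_def)
      next
        case False
        then have \<xi>: "(SOME x. x \<in> C i \<inter> ?S) \<in> C i \<inter> ?S" by (meson someI_ex ex_in_conv)
        have "ennreal (w / K) * emeasure lborel (unit_cone (B i)) \<le> ennreal (w / K) * ennreal (K * diameter (C i) ^ ?n)"
        proof -
          have Bi: "B i = ?S \<inter> cball (SOME x. x \<in> C i \<inter> ?S) (diameter (C i))"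
            using False unfolding B_def by (rule if_not_P)
          have "norm (SOME x. x \<in> C i \<inter> ?S) = 1" using \<xi> by (simp only: Int_iff mem_sphere_0)
          then show ?thesis
            unfolding Bi by (intro mult_left_mono cap diameter_ge_0 C) auto
        qed
        also have "\<dots> = diam_cost ?n (C i)"
          using False K w diameter_ge_0[OF C(2)[of i]] by (auto simp: ennreal_mult[symmetric] w_def field_simps power_divide)
        finally show ?thesis .
      qed
    qed
    have "unit_cone ?S \<subseteq> (\<Union>i. unit_cone (B i))"
      unfolding cone_UN[symmetric] using C(1) sub by (intro cone_mono) blast
    moreover have Bm: "unit_cone (B i) \<in> sets lborel" for i by (auto simp: B_def intro!: cone_borel)
    ultimately have "emeasure lborel (unit_cone ?S) \<le> (\<Sum>i. emeasure lborel (unit_cone (B i)))"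
      by (intro order_trans[OF emeasure_mono emeasure_subadditive_countably]) auto
    then have "ennreal (w / K) * emeasure lborel (unit_cone ?S) \<le> ennreal (w / K) * (\<Sum>i. emeasure lborel (unit_cone (B i)))"
      by (rule mult_left_mono) simp
    also have "\<dots> = (\<Sum>i. ennreal (w / K) * emeasure lborel (unit_cone (B i)))" by simp
    also have "\<dots> \<le> (\<Sum>i. diam_cost ?n (C i))" by (intro suminf_le le) auto
    finally show "ennreal (w / K) * emeasure lborel (unit_cone ?S) \<le> (\<Sum>i. diam_cost ?n (C i))" .
  qed
  also have "\<dots> \<le> hausdorff_outer ?n ?S" by (rule hausdorff_outer_ge) simp
  also have "\<dots> = emeasure (hausdorff_measure ?n) ?S" by (rule emeasure_hausdorff_measure[symmetric]) simp
  finally have 1: "ennreal (w / K) * emeasure lborel (unit_cone ?S) \<le> emeasure (hausdorff_measure ?n) ?S" .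
  have "emeasure lborel (unit_cone ?S) = emeasure lborel (cball 0 1 :: 'a set)"
    unfolding cone_sphere by (rule emeasure_Diff_null_set) (auto simp: null_sets_def)
  also have "\<dots> > 0" by (simp add: emeasure_cball)
  finally have "ennreal (w / K) * emeasure lborel (unit_cone ?S) > 0"
    using K w by (simp add: ennreal_zero_less_mult_iff)
  with 1 show ?thesis by order
qed

text \<open>
  By outer regularity of the cone measure one may replace \<open>E\<close> by an open set \<open>G\<close> that contains it.
  Vitali's covering lemma chooses disjoint caps inside \<open>G\<close> whose fivefold enlargements cover \<open>E\<close>; the
  cost of the enlarged caps is at most a multiple of the cone volume of the disjoint ones.
\<close>

lemma hausdorff_le_cone:
  shows "\<exists>c>0. \<forall>E. E \<in> sets borel \<longrightarrow> E \<subseteq> sphere (0::'a::euclidean_space) 1 \<longrightarrow>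
     emeasure (hausdorff_measure (DIM('a) - 1)) E \<le> ennreal c * emeasure lborel (unit_cone E)"
proof -
  let ?n = "DIM('a) - 1" and ?S = "sphere (0::'a) 1"
  define k where "k = 3/16 * unit_ball_vol (real DIM('a)) / 8 ^ ?n"
  define w where "w = unit_ball_vol (real ?n) * 5 ^ ?n"
  have k: "k > 0" and w: "w > 0" by (auto simp: k_def w_def)
  have cap: "ennreal (k * r ^ ?n) \<le> emeasure lborel (unit_cone (?S \<inter> cball \<xi> r))"
    if "norm \<xi> = 1" "0 < r" "r \<le> 1" for \<xi> :: 'a and r
  proof -
    have "2 * ennreal (k * r ^ ?n) = ennreal (3/8 * unit_ball_vol DIM('a) * (r/8) ^ ?n)"
      using that k by (simp add: k_def ennreal_mult'[symmetric] power_divide flip: ennreal_numeral)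
    also have "\<dots> \<le> 2 * emeasure lborel (unit_cone (?S \<inter> cball \<xi> r))"
      using that by (rule cone_cap_lower)
    finally show ?thesis by (subst (asm) ennreal_mult_le_mult_iff) auto
  qed
  define \<mu> where "\<mu> = distr (restrict_space lborel (cball (0::'a) 1 - {0})) borel (\<lambda>x. x /\<^sub>R norm x)"
  have \<mu>: "emeasure \<mu> A = emeasure lborel (unit_cone A)" if "A \<in> sets borel" for A
  proof -
    have "(\<lambda>x. x /\<^sub>R norm x) \<in> borel_measurable (restrict_space lborel (cball (0::'a) 1 - {0}))"
      by (intro measurable_restrict_space1) measurable
    then have "emeasure \<mu> A = emeasure (restrict_space lborel (cball (0::'a) 1 - {0}))
       ((\<lambda>x. x /\<^sub>R norm x) -` A \<inter> space (restrict_space lborel (cball (0::'a) 1 - {0})))"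
      unfolding \<mu>_def using that by (rule emeasure_distr)
    also have "(\<lambda>x. x /\<^sub>R norm x) -` A \<inter> space (restrict_space lborel (cball (0::'a) 1 - {0})) = unit_cone A"
      by (auto simp: space_restrict_space unit_cone_def)
    also have "emeasure (restrict_space lborel (cball (0::'a) 1 - {0})) (unit_cone A) = emeasure lborel (unit_cone A)"
      by (rule emeasure_restrict_space) (auto simp: unit_cone_def)
    finally show ?thesis .
  qed
  have s\<mu>: "sets \<mu> = sets borel" by (simp add: \<mu>_def)
  have fin: "emeasure \<mu> (space \<mu>) \<noteq> \<infinity>"
  proof -
    have "emeasure \<mu> (space \<mu>) = emeasure lborel (unit_cone (UNIV :: 'a set))"
      using \<mu>[of UNIV] by (simp add: \<mu>_def)
    also have "\<dots> \<le> emeasure lborel (cball (0::'a) 1)" by (intro emeasure_mono) (auto simp: unit_cone_def)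
    also have "\<dots> < \<infinity>" by (simp add: emeasure_cball)
    finally show ?thesis by (rule less_imp_neq)
  qed
  have main: "hausdorff_pre ?n \<delta> E \<le> ennreal (w / k) * emeasure \<mu> G"
    if G: "open G" "E \<subseteq> G" and ES: "E \<subseteq> ?S" and \<delta>: "\<delta> > 0" for E G :: "'a set" and \<delta> :: real
  proof -
    have "\<exists>r. 0 < r \<and> r \<le> min 1 (\<delta>/10) \<and> cball x r \<subseteq> G" if "x \<in> E" for x
    proof -
      have "x \<in> G" using G(2) that by (rule subsetD)
      then obtain e where e: "e > 0" "cball x e \<subseteq> G" using G(1) unfolding open_contains_cball by blast
      define r where "r = min e (min 1 (\<delta>/10))"
      have "cball x r \<subseteq> cball x e" by (rule subset_cball) (simp add: r_def)
      then have "0 < r \<and> r \<le> min 1 (\<delta>/10) \<and> cball x r \<subseteq> G" using e \<delta> unfolding r_def by auto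
      then show ?thesis ..
    qed
    then have "\<forall>x\<in>E. \<exists>r. 0 < r \<and> r \<le> min 1 (\<delta>/10) \<and> cball x r \<subseteq> G" by blast
    from bchoice[OF this] obtain r
      where r: "\<And>x. x \<in> E \<Longrightarrow> 0 < r x" "\<And>x. x \<in> E \<Longrightarrow> r x \<le> min 1 (\<delta>/10)" "\<And>x. x \<in> E \<Longrightarrow> cball x (r x) \<subseteq> G"
      by blast
    obtain C where C: "countable C" "C \<subseteq> E"
      "pairwise (\<lambda>i j. disjnt (cball i (r i)) (cball j (r j))) C"
      "E \<subseteq> (\<Union>i\<in>C. cball i (5 * r i))"
    proof (rule Vitali_covering_lemma_cballs[where S=E and K=E and a="\<lambda>x. x" and r=r and B=1])
      show "E \<subseteq> (\<Union>i\<in>E. cball i (r i))"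
      proof
        fix x assume "x \<in> E"
        moreover have "x \<in> cball x (r x)" using r(1)[OF \<open>x \<in> E\<close>] by simp
        ultimately show "x \<in> (\<Union>i\<in>E. cball i (r i))" by (rule UN_I)
      qed
      show "0 < r i \<and> r i \<le> 1" if "i \<in> E" for i using r(1,2)[OF that] by simp
    qed
    \<comment> \<open>Number the countable family of caps; indices that are not used get the empty set, which costs nothing.\<close>
    define g where "g = to_nat_on C"
    have g: "inj_on g C" using C(1) unfolding g_def by (rule inj_on_to_nat_on)
    define h where "h = the_inv_into C g"
    have h: "h (g x) = x" if "x \<in> C" for x using that g by (simp add: h_def the_inv_into_f_f)
    define D where "D i = (if i \<in> g ` C then cball (h i) (5 * r (h i)) else {})" for i
    define B where "B i = (if i \<in> g ` C then ?S \<inter> cball (h i) (r (h i)) else {})" for i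
    have CE: "x \<in> E" if "x \<in> C" for x using C(2) that by auto
    have "hausdorff_pre ?n \<delta> E \<le> (\<Sum>i. diam_cost ?n (D i))"
    proof (rule hausdorff_pre_le)
      show "E \<subseteq> (\<Union>i. D i)"
      proof
        fix x assume "x \<in> E"
        then obtain i where "i \<in> C" "x \<in> cball i (5 * r i)" using C(4) by blast
        then have "x \<in> D (g i)" by (simp add: D_def h)
        then show "x \<in> (\<Union>i. D i)" by blast
      qed
      show "bounded (D i)" for i by (simp add: D_def)
      show "diameter (D i) \<le> \<delta>" for i
      proof (cases "i \<in> g ` C")
        case True
        then obtain x where x: "i = g x" "x \<in> C" by auto
        then show ?thesis using r(1,2)[OF CE[OF x(2)]] \<delta> by (simp add: D_def h diameter_cball)
      qed (use \<delta> in \<open>simp add: D_def\<close>)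
    qed
    also have "\<dots> \<le> (\<Sum>i. ennreal (w / k) * emeasure \<mu> (B i))"
    proof (intro suminf_le allI)
      fix i
      show "diam_cost ?n (D i) \<le> ennreal (w / k) * emeasure \<mu> (B i)"
      proof (cases "i \<in> g ` C")
        case True
        then obtain x where x: "i = g x" "x \<in> C" by auto
        note rx = r(1,2)[OF CE[OF x(2)]]
        have nx: "norm x = 1" using CE[OF x(2)] ES by auto
        have Bi: "B i = ?S \<inter> cball x (r x)" using x by (simp add: B_def h)
        have "diam_cost ?n (D i) = ennreal (unit_ball_vol (real ?n) * (5 * r x) ^ ?n)"
          using x rx by (simp add: D_def h diameter_cball)
        also have "\<dots> = ennreal (w / k) * ennreal (k * r x ^ ?n)"
          using k w rx by (simp add: ennreal_mult[symmetric] w_def power_mult_distrib)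
        also have "\<dots> \<le> ennreal (w / k) * emeasure \<mu> (B i)"
          using cap[OF nx, of "r x"] rx by (intro mult_left_mono) (simp_all add: Bi \<mu>)
        finally show ?thesis .
      qed (simp add: D_def)
    qed auto
    also have "\<dots> = ennreal (w / k) * (\<Sum>i. emeasure \<mu> (B i))" by simp
    also have "(\<Sum>i. emeasure \<mu> (B i)) = emeasure \<mu> (\<Union>i. B i)"
    proof (rule suminf_emeasure)
      show "range B \<subseteq> sets \<mu>" by (auto simp: B_def s\<mu>)
      show "disjoint_family B"
        unfolding disjoint_family_on_def
      proof (intro ballI impI)
        fix i j :: nat assume "i \<noteq> j"
        show "B i \<inter> B j = {}"
        proof (cases "i \<in> g ` C \<and> j \<in> g ` C")
          case True
          then obtain x y where xy: "i = g x" "x \<in> C" "j = g y" "y \<in> C" by auto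
          then have "x \<noteq> y" using \<open>i \<noteq> j\<close> by auto
          then have "disjnt (cball x (r x)) (cball y (r y))"
            using pairwiseD[OF C(3)] xy by blast
          moreover have "B i \<subseteq> cball x (r x)" "B j \<subseteq> cball y (r y)" using xy by (simp_all add: B_def h)
          ultimately show ?thesis unfolding disjnt_def by blast
        qed (auto simp: B_def)
      qed
    qed
    also have "emeasure \<mu> (\<Union>i. B i) \<le> emeasure \<mu> G"
    proof (rule emeasure_mono)
      show "(\<Union>i. B i) \<subseteq> G"
      proof
        fix z assume "z \<in> (\<Union>i. B i)"
        then obtain i where i: "z \<in> B i" by blast
        then obtain x where x: "i = g x" "x \<in> C" by (auto simp: B_def split: if_splits)
        then have "z \<in> cball x (r x)" using i by (simp add: B_def h)
        then show "z \<in> G" using r(3)[OF CE[OF x(2)]] by blast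
      qed
      show "G \<in> sets \<mu>" using G by (simp add: s\<mu>)
    qed
    finally show ?thesis by (simp add: mult_left_mono)
  qed
  have "emeasure (hausdorff_measure ?n) E \<le> ennreal (w / k) * emeasure lborel (unit_cone E)"
    if E: "E \<in> sets borel" "E \<subseteq> ?S" for E
  proof -
    have \<mu>E: "emeasure \<mu> E = (INF G\<in>{U. E \<subseteq> U \<and> open U}. emeasure \<mu> G)"
      by (rule outer_regular[OF s\<mu> fin E(1)])
    have "hausdorff_outer ?n E \<le> ennreal (w / k) * emeasure \<mu> E"
    proof (rule ennreal_le_epsilon)
      fix e :: real assume e: "e > 0"
      have "emeasure \<mu> E \<noteq> \<infinity>"
        using fin emeasure_space[of \<mu> E] by (auto simp: top_unique)
      then obtain G where G: "open G" "E \<subseteq> G" "emeasure \<mu> G < emeasure \<mu> E + ennreal (e * k / w)"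
      proof -
        have "e * k / w > 0" using e k w by simp
        from INF_approx_ennreal[OF this \<mu>E \<open>emeasure \<mu> E \<noteq> \<infinity>\<close>]
        obtain G where "G \<in> {U. E \<subseteq> U \<and> open U}" "emeasure \<mu> G < emeasure \<mu> E + ennreal (e * k / w)" by (rule bexE)
        then show ?thesis using that[of G] by simp
      qed
      have "hausdorff_outer ?n E \<le> ennreal (w / k) * emeasure \<mu> G"
        using main[OF G(1,2) E(2)] by (rule hausdorff_outer_le)
      also have "\<dots> \<le> ennreal (w / k) * (emeasure \<mu> E + ennreal (e * k / w))"
        using G(3) by (intro mult_left_mono) auto
      also have "\<dots> = ennreal (w / k) * emeasure \<mu> E + ennreal e"
        using e k w by (simp add: distrib_left ennreal_mult[symmetric])
      finally show "hausdorff_outer ?n E \<le> ennreal (w / k) * emeasure \<mu> E + ennreal e" .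
    qed
    then show ?thesis using E by (simp add: emeasure_hausdorff_measure \<mu>)
  qed
  then show ?thesis using k w by (intro exI[of _ "w / k"]) auto
qed

section \<open>Sublevel sets of homogeneous energies on the sphere\<close>

text \<open>
  Greedy choice: \<open>n\<close> intervals of length \<open>2 \<eta>\<close> around the points found so far cannot exhaust the set.
\<close>

lemma separated_points:
  fixes A :: "real set"
  assumes "A \<in> sets borel" "\<eta> \<ge> 0" "emeasure lborel A > ennreal (2 * real n * \<eta>)"
  shows "\<exists>\<tau>::nat \<Rightarrow> real. (\<forall>i\<le>n. \<tau> i \<in> A) \<and> (\<forall>i\<le>n. \<forall>j\<le>n. i \<noteq> j \<longrightarrow> \<eta> \<le> \<bar>\<tau> i - \<tau> j\<bar>)"
  using assms(3)
proof (induction n)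
  case 0
  then have "A \<noteq> {}" by auto
  then obtain x where "x \<in> A" by auto
  then show ?case by (intro exI[of _ "\<lambda>_. x"]) auto
next
  case (Suc n)
  have "ennreal (2 * real n * \<eta>) \<le> ennreal (2 * real (Suc n) * \<eta>)"
    using assms(2) by (intro ennreal_leI) (auto intro!: mult_right_mono)
  then obtain \<tau> where \<tau>: "\<forall>i\<le>n. \<tau> i \<in> A" "\<forall>i\<le>n. \<forall>j\<le>n. i \<noteq> j \<longrightarrow> \<eta> \<le> \<bar>\<tau> i - \<tau> j\<bar>"
    using Suc.IH Suc.prems by (meson order_le_less_trans)
  define U where "U = (\<Union>i\<le>n. {\<tau> i - \<eta> .. \<tau> i + \<eta>})"
  have "emeasure lborel U \<le> (\<Sum>i\<le>n. emeasure lborel {\<tau> i - \<eta> .. \<tau> i + \<eta>})"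
    unfolding U_def by (rule emeasure_subadditive_finite) auto
  also have "\<dots> = (\<Sum>i\<le>n. ennreal (2 * \<eta>))" using assms(2) by (intro sum.cong) auto
  also have "\<dots> = ennreal (2 * real (Suc n) * \<eta>)"
    using assms(2) by (simp add: ennreal_of_nat_eq_real_of_nat ennreal_mult[symmetric] algebra_simps flip: ennreal_plus)
  finally have "emeasure lborel U < emeasure lborel A" using Suc.prems by order
  moreover have "U \<in> sets lborel" unfolding U_def by auto
  ultimately have "\<not> A \<subseteq> U" using emeasure_mono[of A U lborel] by (auto simp: not_less[symmetric])
  then obtain x where x: "x \<in> A" "x \<notin> U" by auto
  have far: "\<eta> \<le> \<bar>x - \<tau> i\<bar>" "\<eta> \<le> \<bar>\<tau> i - x\<bar>" if "i \<le> n" for i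
  proof -
    have "x \<notin> {\<tau> i - \<eta> .. \<tau> i + \<eta>}" using x(2) that unfolding U_def by blast
    then show "\<eta> \<le> \<bar>x - \<tau> i\<bar>" "\<eta> \<le> \<bar>\<tau> i - x\<bar>" by auto
  qed
  show ?case
    using \<tau> far x(1) by (intro exI[of _ "\<tau>(Suc n := x)"]) (auto simp: le_Suc_eq)
qed

lemma emeasure_lborel_translate:
  fixes K :: "'a::euclidean_space set"
  assumes "K \<in> sets borel"
  shows "emeasure lborel {x. x + c \<in> K} = emeasure lborel K"
proof -
  have "emeasure lborel K = emeasure (distr lborel borel ((+) c)) K" by (simp add: lborel_distr_plus)
  also have "\<dots> = emeasure lborel ((+) c -` K \<inter> space lborel)" using assms by (intro emeasure_distr) auto
  also have "(+) c -` K \<inter> space lborel = {x. x + c \<in> K}" by (auto simp: add.commute)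
  finally show ?thesis by simp
qed

text \<open>
  The average over \<open>x\<close> in the ball of radius 2 of the length of \<open>K\<close> on the line through \<open>x\<close> is computed
  by Tonelli: for \<open>\<bar>\<tau>\<bar> \<le> 1\<close> the translate of \<open>K\<close> by \<open>-\<tau> e\<close> still lies in that ball.
\<close>

lemma exists_long_line:
  fixes K :: "'a::euclidean_space set"
  assumes K: "K \<in> sets borel" "K \<subseteq> cball 0 1" and e: "norm e = 1"
  shows "\<exists>x. emeasure lborel K \<le> ennreal (unit_ball_vol DIM('a) * 2 ^ DIM('a)) * emeasure lborel {\<tau>\<in>{-3..3}. x + \<tau> *\<^sub>R e \<in> K}"
proof (rule ccontr)
  define \<beta> where "\<beta> = unit_ball_vol DIM('a) * 2 ^ DIM('a)"
  have \<beta>: "\<beta> > 0" by (simp add: \<beta>_def)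
  define g where "g x = emeasure lborel {\<tau>\<in>{-3..3::real}. x + \<tau> *\<^sub>R e \<in> K}" for x
  assume "\<not> ?thesis"
  then have less: "ennreal \<beta> * g x < emeasure lborel K" for x by (auto simp: \<beta>_def g_def not_le)
  have Kpos: "emeasure lborel K > 0" using less[of 0] by (rule order.strict_trans1[OF zero_le])
  have "emeasure lborel K \<le> emeasure lborel (cball (0::'a) 1)" using K by (intro emeasure_mono) auto
  also have "\<dots> < \<infinity>" by (simp add: emeasure_cball)
  finally have Kfin: "emeasure lborel K < \<infinity>" .
  have [measurable]: "K \<in> sets borel" by fact
  have [measurable]: "cball (0::'a) 2 \<in> sets borel" "{-3..3::real} \<in> sets borel" by auto
  have mp: "(\<lambda>(x, \<tau>). indicator (cball 0 2) x * indicator {-3..3} \<tau> * indicator K (x + \<tau> *\<^sub>R e) :: ennreal)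
     \<in> borel_measurable (lborel \<Otimes>\<^sub>M lborel)" by measurable
  have "2 * emeasure lborel K = (\<integral>\<^sup>+\<tau>. emeasure lborel K * indicator {-1..1::real} \<tau> \<partial>lborel)"
    by (subst nn_integral_cmult_indicator) (auto simp: mult.commute)
  also have "\<dots> \<le> (\<integral>\<^sup>+\<tau>. \<integral>\<^sup>+x. indicator (cball 0 2) x * indicator {-3..3} \<tau> * indicator K (x + \<tau> *\<^sub>R e) \<partial>lborel \<partial>lborel)"
  proof (rule nn_integral_mono)
    fix \<tau> :: real
    show "emeasure lborel K * indicator {-1..1} \<tau> \<le>
       (\<integral>\<^sup>+x. indicator (cball 0 2) x * indicator {-3..3} \<tau> * indicator K (x + \<tau> *\<^sub>R e) \<partial>lborel)"
    proof (cases "\<tau> \<in> {-1..1}")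
      case True
      have "emeasure lborel K = emeasure lborel {x. x + \<tau> *\<^sub>R e \<in> K}" using K(1) by (rule emeasure_lborel_translate[symmetric])
      also have "\<dots> = (\<integral>\<^sup>+x. indicator {x. x + \<tau> *\<^sub>R e \<in> K} x \<partial>lborel)"
        by (rule nn_integral_indicator[symmetric]) measurable
      also have "\<dots> \<le> (\<integral>\<^sup>+x. indicator (cball 0 2) x * indicator {-3..3} \<tau> * indicator K (x + \<tau> *\<^sub>R e) \<partial>lborel)"
      proof (rule nn_integral_mono)
        fix x :: 'a
        show "indicator {x. x + \<tau> *\<^sub>R e \<in> K} x \<le> (indicator (cball 0 2) x * indicator {-3..3} \<tau> * indicator K (x + \<tau> *\<^sub>R e) :: ennreal)"
        proof (cases "x + \<tau> *\<^sub>R e \<in> K")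
          case in_K: True
          then have "norm (x + \<tau> *\<^sub>R e) \<le> 1" using K(2) by auto
          then have "norm x \<le> 2"
            using norm_triangle_ineq4[of "x + \<tau> *\<^sub>R e" "\<tau> *\<^sub>R e"] e True by auto
          then show ?thesis using in_K True by simp
        qed simp
      qed
      finally show ?thesis using True by simp
    qed simp
  qed
  also have "\<dots> = (\<integral>\<^sup>+x. \<integral>\<^sup>+\<tau>. indicator (cball 0 2) x * indicator {-3..3} \<tau> * indicator K (x + \<tau> *\<^sub>R e) \<partial>lborel \<partial>lborel)"
    using mp by (rule lborel_pair.Fubini')
  also have "\<dots> = (\<integral>\<^sup>+x. g x * indicator (cball 0 2) x \<partial>lborel)"
  proof (rule nn_integral_cong)
    fix x :: 'a
    have m: "{\<tau>\<in>{-3..3}. x + \<tau> *\<^sub>R e \<in> K} \<in> sets lborel" by measurable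
    have "(\<integral>\<^sup>+\<tau>. indicator (cball 0 2) x * indicator {-3..3} \<tau> * indicator K (x + \<tau> *\<^sub>R e) \<partial>lborel)
      = (\<integral>\<^sup>+\<tau>. indicator (cball 0 2) x * indicator {\<tau>\<in>{-3..3}. x + \<tau> *\<^sub>R e \<in> K} \<tau> \<partial>lborel)"
      by (intro nn_integral_cong) (auto simp: indicator_def)
    also have "\<dots> = indicator (cball 0 2) x * g x"
      unfolding g_def using m by (rule nn_integral_cmult_indicator)
    finally show "(\<integral>\<^sup>+\<tau>. indicator (cball 0 2) x * indicator {-3..3} \<tau> * indicator K (x + \<tau> *\<^sub>R e) \<partial>lborel) = g x * indicator (cball 0 2) x"
      by (simp add: mult.commute)
  qed
  finally have 1: "2 * emeasure lborel K \<le> (\<integral>\<^sup>+x. g x * indicator (cball 0 2) x \<partial>lborel)" .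
  have "ennreal \<beta> * (2 * emeasure lborel K) \<le> ennreal \<beta> * (\<integral>\<^sup>+x. g x * indicator (cball 0 2) x \<partial>lborel)"
    using 1 by (rule mult_left_mono) simp
  also have "\<dots> = (\<integral>\<^sup>+x. ennreal \<beta> * (g x * indicator (cball 0 2) x) \<partial>lborel)"
  proof (rule nn_integral_cmult[symmetric])
    have "Measurable.pred (lborel \<Otimes>\<^sub>M lborel) (\<lambda>(x,\<tau>::real). \<tau> \<in> {-3..3} \<and> x + \<tau> *\<^sub>R e \<in> K)" by measurable
    then have "g \<in> borel_measurable lborel"
      unfolding g_def by measurable
    then show "(\<lambda>x. g x * indicator (cball 0 2) x) \<in> borel_measurable lborel" by measurable
  qed
  also have "\<dots> \<le> (\<integral>\<^sup>+x. emeasure lborel K * indicator (cball (0::'a) 2) x \<partial>lborel)"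
    using less by (intro nn_integral_mono) (auto simp: indicator_def intro: less_imp_le)
  also have "\<dots> = emeasure lborel K * ennreal \<beta>"
    by (subst nn_integral_cmult_indicator) (auto simp: emeasure_cball \<beta>_def)
  finally have "ennreal \<beta> * (2 * emeasure lborel K) \<le> ennreal \<beta> * emeasure lborel K" by (simp add: mult.commute)
  then have "2 * emeasure lborel K \<le> emeasure lborel K" using \<beta> by (subst (asm) ennreal_mult_le_mult_iff) auto
  then show False using Kpos Kfin
    by (cases "emeasure lborel K") (auto simp: ennreal_mult'[symmetric] simp flip: ennreal_numeral)
qed

text \<open>
  The Remez-type step: a line in direction \<open>e\<close> on which the cone over \<open>E\<close> has large length supplies
  \<open>n + 1\<close> separated points with \<open>D \<le> l\<close>, which interpolate to \<open>e\<close>. By homogeneity the bound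
  \<open>D \<le> l\<close> on \<open>E\<close> persists on the cone, since its points have norm at most 1.
\<close>

lemma cone_sublevel_bound:
  fixes D :: "'a::euclidean_space \<Rightarrow> ennreal"
  assumes C: "C \<ge> 0" and \<alpha>: "\<alpha> > 0"
    and D [measurable]: "D \<in> borel_measurable borel"
    and hom: "\<And>c x. c > 0 \<Longrightarrow> D (c *\<^sub>R x) = ennreal (c powr \<alpha>) * D x"
    and interp: "\<And>e x \<tau> \<eta> l. norm e = 1 \<Longrightarrow> \<eta> > 0 \<Longrightarrow> (\<And>i. i \<le> n \<Longrightarrow> D (x + \<tau> i *\<^sub>R e) \<le> l) \<Longrightarrow>
        (\<And>i j. i \<le> n \<Longrightarrow> j \<le> n \<Longrightarrow> i \<noteq> j \<Longrightarrow> \<eta> \<le> \<bar>\<tau> i - \<tau> j\<bar>) \<Longrightarrow> D e \<le> ennreal (C * \<eta> powr (-\<alpha>)) * l"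
    and e: "norm e = 1" and E: "E = {\<xi>\<in>sphere 0 1. D \<xi> \<le> l}"
    and v: "v > 0" "emeasure lborel (unit_cone E) = ennreal v"
  shows "D e \<le> ennreal (C * (unit_ball_vol DIM('a) * 2 ^ DIM('a) * (2 * real n + 1)) powr \<alpha> * v powr (-\<alpha>)) * l"
proof -
  define \<beta> where "\<beta> = unit_ball_vol DIM('a) * 2 ^ DIM('a)"
  have \<beta>: "\<beta> > 0" by (simp add: \<beta>_def)
  have Em: "E \<in> sets borel" unfolding E by measurable
  define K where "K = unit_cone E"
  have K [measurable]: "K \<in> sets borel" unfolding K_def using Em by (rule cone_borel)
  have "K \<subseteq> cball 0 1" by (auto simp: K_def unit_cone_def)
  from exists_long_line[OF K this e]
  obtain x where x: "ennreal v \<le> ennreal \<beta> * emeasure lborel {\<tau>\<in>{-3..3}. x + \<tau> *\<^sub>R e \<in> K}"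
    unfolding \<beta>_def using v by (auto simp: K_def)
  define A where "A = {\<tau>\<in>{-3..3::real}. x + \<tau> *\<^sub>R e \<in> K}"
  \<comment> \<open>The line meets the cone in length at least \<open>v / \<beta>\<close>; greedy choice of \<open>n + 1\<close> points uses up only \<open>2 n \<eta>\<close>.\<close>
  define \<eta> where "\<eta> = v / (\<beta> * (2 * real n + 1))"
  have \<eta>: "\<eta> > 0" using v \<beta> by (simp add: \<eta>_def)
  have Am: "A \<in> sets borel" unfolding A_def by measurable
  have "emeasure lborel A > ennreal (2 * real n * \<eta>)"
  proof (rule ccontr)
    assume "\<not> ?thesis"
    then have "ennreal \<beta> * emeasure lborel A \<le> ennreal \<beta> * ennreal (2 * real n * \<eta>)"
      by (intro mult_left_mono) auto
    also have "\<dots> = ennreal (v * (2 * real n / (2 * real n + 1)))"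
      using \<beta> \<eta> v(1) by (subst ennreal_mult[symmetric]) (auto simp: \<eta>_def mult.commute)
    also have "\<dots> < ennreal v" using v by (intro ennreal_lessI) (auto simp: field_simps)
    finally show False using x by (simp add: A_def)
  qed
  from separated_points[OF Am _ this] \<eta>
  obtain \<tau> where \<tau>: "\<And>i. i \<le> n \<Longrightarrow> \<tau> i \<in> A" "\<And>i j. i \<le> n \<Longrightarrow> j \<le> n \<Longrightarrow> i \<noteq> j \<Longrightarrow> \<eta> \<le> \<bar>\<tau> i - \<tau> j\<bar>"
    by auto
  have "D (x + \<tau> i *\<^sub>R e) \<le> l" if "i \<le> n" for i
  proof -
    define k where "k = x + \<tau> i *\<^sub>R e"
    have "k \<in> K" using \<tau>(1)[OF that] by (auto simp: A_def k_def)
    then have k: "k \<noteq> 0" "norm k \<le> 1" "D (k /\<^sub>R norm k) \<le> l" by (auto simp: K_def unit_cone_def E)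
    have "D k = D (norm k *\<^sub>R (k /\<^sub>R norm k))" using k by simp
    also have "\<dots> = ennreal (norm k powr \<alpha>) * D (k /\<^sub>R norm k)" using k by (intro hom) auto
    also have "\<dots> \<le> 1 * l" using k \<alpha> by (intro mult_mono) (auto simp: powr_le1)
    finally show ?thesis by (simp add: k_def)
  qed
  from interp[OF e \<eta> this \<tau>(2)] have "D e \<le> ennreal (C * \<eta> powr (-\<alpha>)) * l" by simp
  also have "C * \<eta> powr (-\<alpha>) = C * (\<beta> * (2 * real n + 1)) powr \<alpha> * v powr (-\<alpha>)"
    using v \<beta> by (simp add: \<eta>_def powr_divide powr_minus field_simps)
  finally show ?thesis by (simp add: \<beta>_def)
qed

section \<open>From the weak-type bound to the affine inequality\<close>

lemma epowr_ennreal_pos: "0 < x \<Longrightarrow> epowr (ennreal x) a = ennreal (x powr a)"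
  by (auto simp: epowr_def)

lemma epowr_neg_antimono:
  assumes "x \<le> y" "a < 0"
  shows "epowr y a \<le> epowr x a"
proof (cases "x = 0 \<or> y = \<infinity>")
  case True
  then show ?thesis using assms by (auto simp: epowr_def)
next
  case False
  then obtain u w where uw: "x = ennreal u" "y = ennreal w" "u > 0" "w > 0"
    using assms(1) by (cases x; cases y) (auto simp: less_le top_unique)
  then have "w powr a \<le> u powr a" using assms by (intro powr_mono2') auto
  then show ?thesis using uw by (simp add: epowr_ennreal_pos ennreal_leI)
qed

lemma dyadic_scale:
  assumes "0 < m" "m \<le> (d::real)"
  shows "\<exists>j::nat. 2 ^ j * m \<le> d \<and> d \<le> 2 ^ Suc j * m"
proof -
  define P where "P j \<longleftrightarrow> d \<le> 2 ^ Suc j * m" for j :: nat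
  obtain k where "d / m < 2 ^ k" using real_arch_pow[of 2 "d/m"] by auto
  then have "d < 2 ^ k * m" using assms by (simp add: field_simps)
  also have "\<dots> \<le> 2 ^ Suc k * m" using assms by simp
  finally have "P k" by (simp add: P_def)
  define j where "j = (LEAST j. P j)"
  have j: "P j" unfolding j_def using \<open>P k\<close> by (rule LeastI)
  have "2 ^ j * m \<le> d"
  proof (cases j)
    case 0 then show ?thesis using assms by simp
  next
    case (Suc i)
    then have "\<not> P i" using not_less_Least[of i P] by (simp add: j_def)
    then show ?thesis by (simp add: P_def Suc)
  qed
  then show ?thesis using j by (auto simp: P_def)
qed

text \<open>
  On the shell where \<open>D\<close> is comparable to \<open>2\<^sup>j m\<close> the integrand is at most \<open>(2\<^sup>j m)\<^bsup>-N/\<alpha>\<^esup>\<close>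
  and the weak-type bound applies. The resulting series is geometric, and converges because \<open>N > 1\<close>.
  At the exponent \<open>1/\<alpha>\<close> of the weak-type bound itself the series would diverge logarithmically,
  which is why the lower bound \<open>m\<close> enters with the power \<open>-(N-1)/\<alpha>\<close>.
\<close>

lemma sphere_integral_le:
  fixes D :: "'a::euclidean_space \<Rightarrow> ennreal" and H :: "'a measure"
  assumes sH: "sets H = sets borel"
    and D [measurable]: "D \<in> borel_measurable borel"
    and pos: "\<alpha> > 0" "m > 0" "Q > 0" "A \<ge> 0" and N: "N > (1::real)"
    and lower: "\<And>\<xi>. norm \<xi> = 1 \<Longrightarrow> ennreal m \<le> D \<xi>"
    and weak: "\<And>l. l > 0 \<Longrightarrow> emeasure H {\<xi>\<in>sphere 0 1. D \<xi> \<le> ennreal l} \<le> ennreal (A * (l / Q) powr (1 / \<alpha>))"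
  shows "(\<integral>\<^sup>+\<xi>\<in>sphere 0 1. epowr (D \<xi>) (- (N / \<alpha>)) \<partial>H) \<le>
     ennreal (A * 2 powr (1 / \<alpha>) / (1 - 2 powr (- (N - 1) / \<alpha>)) * m powr (- (N - 1) / \<alpha>) * Q powr (- 1 / \<alpha>))"
proof -
  note [measurable_cong] = sH
  define E where "E j = {\<xi>\<in>sphere 0 1. D \<xi> \<le> ennreal (2 ^ Suc j * m)}" for j :: nat
  have [measurable]: "E j \<in> sets borel" for j unfolding E_def by measurable
  define c where "c j = ennreal ((2 ^ j * m) powr (- (N / \<alpha>)))" for j :: nat
  define \<rho> where "\<rho> = 2 powr (- (N - 1) / \<alpha>)"
  have \<rho>: "0 < \<rho>" "\<rho> < 1"
    using N pos by (auto simp: \<rho>_def powr_less_one divide_neg_pos)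
  define B where "B = A * 2 powr (1 / \<alpha>) * m powr (- (N - 1) / \<alpha>) * Q powr (- 1 / \<alpha>)"
  have B: "B \<ge> 0" using pos by (auto simp: B_def)
  have "(\<integral>\<^sup>+\<xi>\<in>sphere 0 1. epowr (D \<xi>) (- (N / \<alpha>)) \<partial>H) \<le> (\<integral>\<^sup>+\<xi>. (\<Sum>j. c j * indicator (E j) \<xi>) \<partial>H)"
  proof (rule nn_integral_mono)
    fix \<xi>
    show "epowr (D \<xi>) (- (N / \<alpha>)) * indicator (sphere 0 1) \<xi> \<le> (\<Sum>j. c j * indicator (E j) \<xi>)"
    proof (cases "\<xi> \<in> sphere 0 1 \<and> D \<xi> \<noteq> \<infinity>")
      case True
      then have 1: "norm \<xi> = 1" by auto
      obtain d where d: "D \<xi> = ennreal d" "d \<ge> 0" using True by (cases "D \<xi>") auto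
      have md: "m \<le> d" using lower[OF 1] d pos by (simp add: ennreal_le_iff)
      obtain j where j: "2 ^ j * m \<le> d" "d \<le> 2 ^ Suc j * m" using dyadic_scale[OF pos(2) md] by auto
      have "epowr (D \<xi>) (- (N / \<alpha>)) = ennreal (d powr (- (N / \<alpha>)))"
        unfolding d(1) using md pos by (intro epowr_ennreal_pos) auto
      also have "\<dots> \<le> c j"
        unfolding c_def using j pos N by (intro ennreal_leI powr_mono2') auto
      also have "\<dots> = c j * indicator (E j) \<xi>" using 1 d j by (simp add: E_def ennreal_leI)
      also have "\<dots> \<le> (\<Sum>j. c j * indicator (E j) \<xi>)"
      proof -
        define g where "g j = c j * indicator (E j) \<xi>" for j
        have "sum g {j} \<le> suminf g" by (rule sum_le_suminf) auto
        then have "g j \<le> suminf g" by simp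
        then show ?thesis unfolding g_def .
      qed
      finally show ?thesis using True by simp
    next
      case False
      moreover have "N / \<alpha> > 0" using pos N by simp
      ultimately show ?thesis by (auto simp: indicator_def epowr_def)
    qed
  qed
  also have "\<dots> = (\<Sum>j. \<integral>\<^sup>+\<xi>. c j * indicator (E j) \<xi> \<partial>H)"
    by (rule nn_integral_suminf) measurable
  also have "\<dots> = (\<Sum>j. c j * emeasure H (E j))"
    by (intro suminf_cong nn_integral_cmult_indicator) measurable
  also have "\<dots> \<le> (\<Sum>j. ennreal (B * \<rho> ^ j))"
  proof (intro suminf_le allI)
    fix j
    have "c j * emeasure H (E j) \<le> c j * ennreal (A * (2 ^ Suc j * m / Q) powr (1 / \<alpha>))"
      unfolding E_def using pos by (intro mult_left_mono weak) auto
    also have "\<dots> = ennreal (B * \<rho> ^ j)"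
    proof -
      have e: "(2::real) ^ k = 2 powr real k" for k by (simp add: powr_realpow)
      have "(2 ^ j * m) powr (- (N / \<alpha>)) * (A * (2 ^ Suc j * m / Q) powr (1 / \<alpha>)) = B * \<rho> ^ j"
      proof -
        have "(2 ^ j * m) powr (- (N / \<alpha>)) * (2 ^ Suc j * m / Q) powr (1 / \<alpha>) =
          2 powr (real j * (- (N / \<alpha>)) + (real j + 1) * (1 / \<alpha>)) * m powr (- (N / \<alpha>) + 1 / \<alpha>) * Q powr (- 1 / \<alpha>)"
        proof -
          have "(2 ^ j * m) powr (- (N / \<alpha>)) = 2 powr (real j * (- (N / \<alpha>))) * m powr (- (N / \<alpha>))"
            using pos by (simp only: powr_mult e powr_powr)
          moreover have "(2 ^ Suc j * m / Q) powr (1 / \<alpha>) = 2 powr ((real j + 1) * (1 / \<alpha>)) * m powr (1 / \<alpha>) * Q powr (- 1 / \<alpha>)"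
          proof -
            have "(2 ^ Suc j * m / Q) powr (1 / \<alpha>) = (2 ^ Suc j) powr (1 / \<alpha>) * m powr (1 / \<alpha>) / Q powr (1 / \<alpha>)"
              using pos by (simp only: powr_mult powr_divide)
            also have "(2 ^ Suc j) powr (1 / \<alpha>) = (2::real) powr ((real j + 1) * (1 / \<alpha>))"
              unfolding e powr_powr by (simp add: add.commute)
            finally show ?thesis by (simp add: powr_minus_divide)
          qed
          ultimately show ?thesis by (simp only: powr_add mult_ac)
        qed
        also have "real j * (- (N / \<alpha>)) + (real j + 1) * (1 / \<alpha>) = 1 / \<alpha> + (- (N - 1) / \<alpha>) * real j"
          using pos by (simp add: field_simps)
        also have "- (N / \<alpha>) + 1 / \<alpha> = - (N - 1) / \<alpha>" using pos by (simp add: field_simps)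
        finally have eq: "(2 ^ j * m) powr (- (N / \<alpha>)) * (2 ^ Suc j * m / Q) powr (1 / \<alpha>) =
           2 powr (1 / \<alpha> + (- (N - 1) / \<alpha>) * real j) * m powr (- (N - 1) / \<alpha>) * Q powr (- 1 / \<alpha>)" .
        have rj: "\<rho> ^ j = 2 powr ((- (N - 1) / \<alpha>) * real j)"
          using \<rho>(1) by (simp only: powr_realpow[symmetric]) (simp only: \<rho>_def powr_powr)
        have "(2 ^ j * m) powr (- (N / \<alpha>)) * (A * (2 ^ Suc j * m / Q) powr (1 / \<alpha>)) =
          A * ((2 ^ j * m) powr (- (N / \<alpha>)) * (2 ^ Suc j * m / Q) powr (1 / \<alpha>))" by (simp only: mult_ac)
        also have "\<dots> = B * \<rho> ^ j" unfolding eq B_def rj powr_add by (simp only: mult_ac)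
        finally show ?thesis .
      qed
      then show ?thesis using pos unfolding c_def by (subst ennreal_mult[symmetric]) auto
    qed
    finally show "c j * emeasure H (E j) \<le> ennreal (B * \<rho> ^ j)" .
  qed auto
  also have "\<dots> = ennreal (B * (1 / (1 - \<rho>)))"
    using \<rho> B by (intro suminf_ennreal_eq sums_mult geometric_sums) auto
  also have "B * (1 / (1 - \<rho>)) = A * 2 powr (1 / \<alpha>) / (1 - 2 powr (- (N - 1) / \<alpha>)) * m powr (- (N - 1) / \<alpha>) * Q powr (- 1 / \<alpha>)"
    by (simp add: B_def \<rho>_def)
  finally show ?thesis .
qed

text \<open>
  For \<open>n = 1\<close> and an even function this follows from homogeneity and subadditivity up to a constant; for the \<open>p\<close>-th power of a form
  of degree \<open>n\<close> it is Lagrange interpolation of the leading coefficient.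
\<close>

definition line_interpolation :: "real \<Rightarrow> real \<Rightarrow> nat \<Rightarrow> ('a::euclidean_space \<Rightarrow> ennreal) \<Rightarrow> bool" where
  "line_interpolation \<alpha> C n D \<longleftrightarrow>
    (\<forall>e x \<tau> \<eta> l. norm e = 1 \<longrightarrow> \<eta> > 0 \<longrightarrow> (\<forall>i\<le>n. D (x + \<tau> i *\<^sub>R e) \<le> l) \<longrightarrow>
      (\<forall>i\<le>n. \<forall>j\<le>n. i \<noteq> j \<longrightarrow> \<eta> \<le> \<bar>\<tau> i - \<tau> j\<bar>) \<longrightarrow> D e \<le> ennreal (C * \<eta> powr (-\<alpha>)) * l)"

text \<open>
  The constant depends only on the listed parameters and not on \<open>D\<close>, so that it is uniform in the
  function whose energy \<open>D\<close> is.
\<close>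

lemma sublevel_weak_type:
  fixes n :: nat
  assumes pos: "\<alpha> > 0" "C \<ge> 0" "C3 \<ge> 0"
  shows "\<exists>A\<ge>0. \<forall>D::'a::euclidean_space \<Rightarrow> ennreal. \<forall>Q l.
    D \<in> borel_measurable borel \<longrightarrow> (\<forall>c x. c > 0 \<longrightarrow> D (c *\<^sub>R x) = ennreal (c powr \<alpha>) * D x) \<longrightarrow>
    line_interpolation \<alpha> C n D \<longrightarrow>
    (\<forall>M. (\<forall>e. norm e = 1 \<longrightarrow> D e \<le> M) \<longrightarrow> ennreal Q \<le> ennreal C3 * M) \<longrightarrow> Q > 0 \<longrightarrow> l > 0 \<longrightarrow>
    emeasure (hausdorff_measure (DIM('a) - 1)) {\<xi>\<in>sphere 0 1. D \<xi> \<le> ennreal l} \<le> ennreal (A * (l / Q) powr (1 / \<alpha>))"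
proof -
  obtain h where h: "h > 0" "\<And>E. E \<in> sets borel \<Longrightarrow> E \<subseteq> sphere (0::'a) 1 \<Longrightarrow>
     emeasure (hausdorff_measure (DIM('a) - 1)) E \<le> ennreal h * emeasure lborel (unit_cone E)"
    using hausdorff_le_cone[where 'a='a] by blast
  define C' where "C' = C * (unit_ball_vol DIM('a) * 2 ^ DIM('a) * (2 * real n + 1)) powr \<alpha>"
  have C': "C' \<ge> 0" using pos by (simp add: C'_def)
  define A where "A = h * (C3 * C') powr (1 / \<alpha>)"
  show ?thesis
  proof (intro exI[of _ A] conjI allI impI)
    show "A \<ge> 0" using h by (simp add: A_def)
    fix D :: "'a \<Rightarrow> ennreal" and Q l :: real
    assume D [measurable]: "D \<in> borel_measurable borel"
      and hom: "\<forall>c x. c > 0 \<longrightarrow> D (c *\<^sub>R x) = ennreal (c powr \<alpha>) * D x"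
      and interp: "line_interpolation \<alpha> C n D"
      and sup: "\<forall>M. (\<forall>e. norm e = 1 \<longrightarrow> D e \<le> M) \<longrightarrow> ennreal Q \<le> ennreal C3 * M"
      and Q: "Q > 0" and l: "l > 0"
    define E where "E = {\<xi>\<in>sphere 0 1. D \<xi> \<le> ennreal l}"
    have E: "E \<in> sets borel" "E \<subseteq> sphere 0 1" unfolding E_def by (measurable, auto)
    have "emeasure lborel (unit_cone E) \<le> emeasure lborel (cball (0::'a) 1)"
      by (intro emeasure_mono) (auto simp: unit_cone_def)
    also have "\<dots> < \<infinity>" by (simp add: emeasure_cball)
    finally obtain v where v: "v \<ge> 0" "emeasure lborel (unit_cone E) = ennreal v"
      by (cases "emeasure lborel (unit_cone E)") auto
    have "v \<le> (C3 * C') powr (1 / \<alpha>) * (l / Q) powr (1 / \<alpha>)"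
    proof (cases "v = 0")
      case False
      then have v0: "v > 0" using v by simp
      have "D e \<le> ennreal (C' * v powr (-\<alpha>)) * ennreal l" if "norm e = 1" for e
        unfolding C'_def
        by (rule cone_sublevel_bound[OF pos(2,1) D hom[rule_format]
             interp[unfolded line_interpolation_def, rule_format] that E_def v0 v(2)])
      then have "ennreal Q \<le> ennreal C3 * (ennreal (C' * v powr (-\<alpha>)) * ennreal l)" using sup by blast
      also have "\<dots> = ennreal (C3 * (C' * v powr (-\<alpha>) * l))"
        using pos C' l by (simp add: ennreal_mult)
      finally have "Q \<le> C3 * (C' * v powr (-\<alpha>) * l)"
        using pos C' l by (subst (asm) ennreal_le_iff) auto
      then have "v powr \<alpha> \<le> C3 * C' * (l / Q)"
        using Q v0 by (simp add: powr_minus field_simps)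
      then have "(v powr \<alpha>) powr (1 / \<alpha>) \<le> (C3 * C' * (l / Q)) powr (1 / \<alpha>)"
        using pos by (intro powr_mono2) auto
      moreover have "(v powr \<alpha>) powr (1 / \<alpha>) = v" using pos v0 by (simp add: powr_powr)
      moreover have "(C3 * C' * (l / Q)) powr (1 / \<alpha>) = (C3 * C') powr (1 / \<alpha>) * (l / Q) powr (1 / \<alpha>)"
        using pos C' Q l by (intro powr_mult)
      ultimately show ?thesis by simp
    qed auto
    have "emeasure (hausdorff_measure (DIM('a) - 1)) E \<le> ennreal h * ennreal v"
      using h(2)[OF E] v by simp
    also have "\<dots> \<le> ennreal h * ennreal ((C3 * C') powr (1 / \<alpha>) * (l / Q) powr (1 / \<alpha>))"
      using \<open>v \<le> _\<close> by (intro mult_left_mono ennreal_leI) auto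
    also have "\<dots> = ennreal (A * (l / Q) powr (1 / \<alpha>))"
      using h by (subst ennreal_mult[symmetric]) (auto simp: A_def mult_ac)
    finally show "emeasure (hausdorff_measure (DIM('a) - 1)) {\<xi>\<in>sphere 0 1. D \<xi> \<le> ennreal l} \<le> ennreal (A * (l / Q) powr (1 / \<alpha>))"
      by (simp add: E_def)
  qed
qed

text \<open>
  What remains to be checked for a class of functions: homogeneity, interpolation along lines, a lower
  bound by the Lp norm, and control of the Sobolev energy by the supremum of \<open>D\<close> on the sphere, all
  with constants that are uniform over the class.
\<close>

theorem affine_inequality_criterion:
  fixes s p c0 C C3 :: real and n :: nat and F :: "('a::euclidean_space \<Rightarrow> real) \<Rightarrow> bool"
  assumes N: "DIM('a) \<ge> 2" and s: "s > 0" and p: "p \<ge> 1" and c0: "c0 > 0" and C: "C \<ge> 0" "C3 \<ge> 0"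
    and fin: "\<And>f. F f \<Longrightarrow> Lp_integral p f < \<infinity>" "\<And>f. F f \<Longrightarrow> sobolev_energy s p f < \<infinity>"
    and crit: "\<And>f. F f \<Longrightarrow> \<exists>D. D \<in> borel_measurable borel \<and> (\<forall>\<xi>. norm \<xi> = 1 \<longrightarrow> directional_energy s p f \<xi> = D \<xi>) \<and>
       (\<forall>c x. c > 0 \<longrightarrow> D (c *\<^sub>R x) = ennreal (c powr (s * p)) * D x) \<and>
       line_interpolation (s * p) C n D \<and>
       (\<forall>\<xi>. norm \<xi> = 1 \<longrightarrow> ennreal c0 * Lp_integral p f \<le> D \<xi>) \<and>
       (\<forall>M. (\<forall>e. norm e = 1 \<longrightarrow> D e \<le> M) \<longrightarrow> sobolev_energy s p f \<le> ennreal C3 * M)"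
  shows "\<exists>K::real. \<forall>f. F f \<longrightarrow>
           epowr (Lp_norm p f) (1 - 1 / real DIM('a)) *
             epowr (sobolev_seminorm s p f) (1 / real DIM('a))
           \<le> ennreal K * affine_energy s p f"
proof -
  let ?H = "hausdorff_measure (DIM('a) - 1) :: 'a measure"
  let ?\<alpha> = "s * p" and ?N = "real DIM('a)"
  have \<alpha>: "?\<alpha> > 0" using s p by simp
  have N1: "?N > 1" using N by simp
  obtain A where A: "A \<ge> 0" "\<forall>D::'a \<Rightarrow> ennreal. \<forall>Q l.
    D \<in> borel_measurable borel \<longrightarrow> (\<forall>c x. c > 0 \<longrightarrow> D (c *\<^sub>R x) = ennreal (c powr ?\<alpha>) * D x) \<longrightarrow>
    line_interpolation ?\<alpha> C n D \<longrightarrow>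
    (\<forall>M. (\<forall>e. norm e = 1 \<longrightarrow> D e \<le> M) \<longrightarrow> ennreal Q \<le> ennreal C3 * M) \<longrightarrow> Q > 0 \<longrightarrow> l > 0 \<longrightarrow>
    emeasure ?H {\<xi>\<in>sphere 0 1. D \<xi> \<le> ennreal l} \<le> ennreal (A * (l / Q) powr (1 / ?\<alpha>))"
    using sublevel_weak_type[OF \<alpha> C, where 'a='a] by blast
  define b where "b = (A + 1) * 2 powr (1 / ?\<alpha>) / (1 - 2 powr (- (?N - 1) / ?\<alpha>)) * c0 powr (- (?N - 1) / ?\<alpha>)"
  have "2 powr (- (?N - 1) / ?\<alpha>) < 1" using N1 \<alpha> by (simp add: powr_less_one divide_neg_pos)
  then have b: "b > 0" using A(1) c0 by (auto simp: b_def)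
  define \<gamma> where "\<gamma> = (?N + ?\<alpha>) / (?N * p)"
  have \<gamma>: "\<gamma> > 0" using N1 \<alpha> p by (simp add: \<gamma>_def)
  define \<sigma> where "\<sigma> = epowr (emeasure ?H (sphere 0 1)) \<gamma>"
  have "\<sigma> > 0"
  proof (cases "emeasure ?H (sphere 0 1)")
    case (real r)
    then have "r > 0" using hausdorff_sphere_pos[OF N] by simp
    then show ?thesis using real by (simp add: \<sigma>_def epowr_ennreal_pos)
  next
    case top
    then show ?thesis using \<gamma> by (simp add: \<sigma>_def epowr_def)
  qed
  \<comment> \<open>Only a positive lower bound for the normalising factor of the affine energy matters.\<close>
  then obtain \<sigma>0 where \<sigma>0: "\<sigma>0 > 0" "ennreal \<sigma>0 \<le> \<sigma>"
  proof (cases \<sigma>)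
    case (real r) then show ?thesis using that[of r] \<open>\<sigma> > 0\<close> by auto
  next
    case top then show ?thesis using that[of 1] by auto
  qed
  define K where "K = b powr (s / ?N) / \<sigma>0"
  show ?thesis
  proof (intro exI[of _ K] allI impI)
    fix f assume f: "F f"
    obtain L where L: "Lp_integral p f = ennreal L" "L \<ge> 0" using fin(1)[OF f] by (cases "Lp_integral p f") auto
    obtain Q where Q: "sobolev_energy s p f = ennreal Q" "Q \<ge> 0" using fin(2)[OF f] by (cases "sobolev_energy s p f") auto
    have a1: "1 - 1 / ?N > 0" "1 / ?N > 0" "1 / p > 0" using N1 p by auto
    let ?L = "epowr (Lp_norm p f) (1 - 1 / ?N) * epowr (sobolev_seminorm s p f) (1 / ?N)"
    show "?L \<le> ennreal K * affine_energy s p f"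
    proof (cases "L = 0 \<or> Q = 0")
      case True
      then have z: "?L = 0" using L Q a1 by (auto simp: Lp_norm_def sobolev_seminorm_def epowr_def)
      show ?thesis unfolding z by (rule zero_le)
    next
      case False
      then have L0: "L > 0" and Q0: "Q > 0" using L Q by auto
      have lhs: "?L = ennreal (L powr ((?N - 1) / (?N * p)) * Q powr (1 / (?N * p)))"
      proof -
        have "epowr (Lp_norm p f) (1 - 1 / ?N) = ennreal (L powr ((?N - 1) / (?N * p)))"
          using L0 N1 p by (simp add: Lp_norm_def L epowr_ennreal_pos powr_powr field_simps)
        moreover have "epowr (sobolev_seminorm s p f) (1 / ?N) = ennreal (Q powr (1 / (?N * p)))"
          using Q0 N1 p by (simp add: sobolev_seminorm_def Q epowr_ennreal_pos powr_powr field_simps)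
        ultimately show ?thesis by (simp add: ennreal_mult)
      qed
      obtain D where D: "D \<in> borel_measurable borel" "\<And>\<xi>. norm \<xi> = 1 \<Longrightarrow> directional_energy s p f \<xi> = D \<xi>"
       "\<forall>c x. c > 0 \<longrightarrow> D (c *\<^sub>R x) = ennreal (c powr (s * p)) * D x"
       "line_interpolation (s * p) C n D"
       "\<And>\<xi>. norm \<xi> = 1 \<Longrightarrow> ennreal c0 * Lp_integral p f \<le> D \<xi>"
       "\<forall>M. (\<forall>e. norm e = 1 \<longrightarrow> D e \<le> M) \<longrightarrow> ennreal Q \<le> ennreal C3 * M"
        using crit[OF f] unfolding Q(1) by blast
      define J where "J = (\<integral>\<^sup>+\<xi>\<in>sphere 0 1. epowr (directional_energy s p f \<xi>) (- (?N / ?\<alpha>)) \<partial>?H)"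
      have "J = (\<integral>\<^sup>+\<xi>\<in>sphere 0 1. epowr (D \<xi>) (- (?N / ?\<alpha>)) \<partial>?H)"
        unfolding J_def by (intro nn_integral_cong) (auto simp: D(2) indicator_def)
      also have "\<dots> \<le> ennreal ((A + 1) * 2 powr (1 / ?\<alpha>) / (1 - 2 powr (- (?N - 1) / ?\<alpha>)) * (c0 * L) powr (- (?N - 1) / ?\<alpha>) * Q powr (- 1 / ?\<alpha>))"
      proof (rule sphere_integral_le)
        show "sets ?H = sets borel" by simp
        show "ennreal (c0 * L) \<le> D \<xi>" if "norm \<xi> = 1" for \<xi>
          using D(5)[OF that] c0 L by (simp add: ennreal_mult)
        fix l :: real assume l: "l > 0"
        have "emeasure ?H {\<xi>\<in>sphere 0 1. D \<xi> \<le> ennreal l} \<le> ennreal (A * (l / Q) powr (1 / ?\<alpha>))"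
          using A(2) D(1,3,4,6) Q0 l by blast
        also have "\<dots> \<le> ennreal ((A + 1) * (l / Q) powr (1 / ?\<alpha>))"
          by (intro ennreal_leI mult_right_mono) auto
        finally show "emeasure ?H {\<xi>\<in>sphere 0 1. D \<xi> \<le> ennreal l} \<le> ennreal ((A + 1) * (l / Q) powr (1 / ?\<alpha>))" .
      qed (use D(1) \<alpha> c0 L0 Q0 A(1) N1 in auto)
      also have "\<dots> = ennreal (b * L powr (- (?N - 1) / ?\<alpha>) * Q powr (- 1 / ?\<alpha>))"
        using c0 L0 by (simp add: b_def powr_mult mult_ac)
      finally have J: "J \<le> ennreal (b * L powr (- (?N - 1) / ?\<alpha>) * Q powr (- 1 / ?\<alpha>))" .
      have "epowr (ennreal (b * L powr (- (?N - 1) / ?\<alpha>) * Q powr (- 1 / ?\<alpha>))) (- (s / ?N)) \<le> epowr J (- (s / ?N))"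
        using J s N1 by (intro epowr_neg_antimono) auto
      also have "epowr (ennreal (b * L powr (- (?N - 1) / ?\<alpha>) * Q powr (- 1 / ?\<alpha>))) (- (s / ?N)) =
        ennreal (b powr (- (s / ?N)) * L powr ((?N - 1) / (?N * p)) * Q powr (1 / (?N * p)))"
      proof -
        have "(- (?N - 1) / ?\<alpha>) * (- (s / ?N)) = (?N - 1) / (?N * p)" "(- 1 / ?\<alpha>) * (- (s / ?N)) = 1 / (?N * p)"
          using s p N1 by (simp_all add: field_simps)
        then show ?thesis
          using b L0 Q0 by (subst epowr_ennreal_pos) (auto simp: powr_mult powr_powr)
      qed
      finally have J2: "ennreal (b powr (- (s / ?N)) * L powr ((?N - 1) / (?N * p)) * Q powr (1 / (?N * p))) \<le> epowr J (- (s / ?N))" .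
      have "?L = ennreal K * (ennreal \<sigma>0 * ennreal (b powr (- (s / ?N)) * L powr ((?N - 1) / (?N * p)) * Q powr (1 / (?N * p))))"
      proof -
        define X where "X = L powr ((?N - 1) / (?N * p)) * Q powr (1 / (?N * p))"
        have X: "X \<ge> 0" by (simp add: X_def)
        have "K * (\<sigma>0 * (b powr (- (s / ?N)) * X)) = X"
          using \<sigma>0(1) b by (simp add: K_def powr_add[symmetric] mult.assoc[symmetric])
        then have "ennreal X = ennreal K * (ennreal \<sigma>0 * ennreal (b powr (- (s / ?N)) * X))"
          using X \<sigma>0(1) by (simp add: ennreal_mult[symmetric] K_def)
        then show ?thesis unfolding lhs X_def by (simp only: mult.assoc)
      qed
      also have "\<dots> \<le> ennreal K * (\<sigma> * epowr J (- (s / ?N)))"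
        by (intro mult_left_mono mult_mono \<sigma>0 J2) auto
      also have "\<dots> = ennreal K * affine_energy s p f"
        by (simp add: affine_energy_def Let_def \<sigma>_def \<gamma>_def J_def)
      finally show ?thesis .
    qed
  qed
qed

section \<open>Finite differences in Lp\<close>

text \<open>
  Convexity, with weights \<open>1 - \<theta>\<close> and \<open>\<theta>\<close>. For \<open>\<theta>\<close> near 0 the factor of \<open>\<bar>a\<bar>\<^sup>p\<close> is near 1; this replaces
  Minkowski's inequality where a constant must stay below 1.
\<close>

lemma powr_sum_le_weighted:
  fixes a b p \<theta> :: real
  assumes p: "p \<ge> 1" and \<theta>: "0 < \<theta>" "\<theta> < 1"
  shows "\<bar>a + b\<bar> powr p \<le> (1 - \<theta>) powr (1 - p) * \<bar>a\<bar> powr p + \<theta> powr (1 - p) * \<bar>b\<bar> powr p"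
proof -
  have ge1: "1 \<le> c powr (1 - p)" if "0 < c" "c < 1" for c :: real
  proof -
    have "c powr (p - 1) \<le> 1" using that p by (intro powr_le1) auto
    moreover have "c powr (1 - p) * c powr (p - 1) = 1" using that by (simp flip: powr_add)
    ultimately show ?thesis using mult_left_mono[of "c powr (p - 1)" 1 "c powr (1 - p)"] by simp
  qed
  have tri: "\<bar>a + b\<bar> powr p \<le> (\<bar>a\<bar> + \<bar>b\<bar>) powr p" using p by (intro powr_mono2) auto
  show ?thesis
  proof (cases "a = 0 \<or> b = 0")
    case True
    then show ?thesis
      using ge1[of \<theta>] ge1[of "1 - \<theta>"] \<theta> mult_right_mono[of 1 "\<theta> powr (1 - p)" "\<bar>b\<bar> powr p"]
        mult_right_mono[of 1 "(1 - \<theta>) powr (1 - p)" "\<bar>a\<bar> powr p"] by auto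
  next
    case False
    have eq: "c * (x / c) powr p = c powr (1 - p) * x powr p" if "c > 0" "x > 0" for c x :: real
      using that by (simp add: powr_divide powr_diff)
    have "((1 - \<theta>) *\<^sub>R (\<bar>a\<bar> / (1 - \<theta>)) + \<theta> *\<^sub>R (\<bar>b\<bar> / \<theta>)) powr p
       \<le> (1 - \<theta>) * (\<bar>a\<bar> / (1 - \<theta>)) powr p + \<theta> * (\<bar>b\<bar> / \<theta>) powr p"
      by (rule convex_onD[OF powr_convex[OF p]]) (use \<theta> False in auto)
    also have "(1 - \<theta>) *\<^sub>R (\<bar>a\<bar> / (1 - \<theta>)) + \<theta> *\<^sub>R (\<bar>b\<bar> / \<theta>) = \<bar>a\<bar> + \<bar>b\<bar>" using \<theta> by simp
    finally show ?thesis using tri eq[of "1 - \<theta>" "\<bar>a\<bar>"] eq[of \<theta> "\<bar>b\<bar>"] \<theta> False by simp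
  qed
qed

text \<open>
  The \<open>p\<close>-th power of the Lp norm as an integral over the Borel measure \<^const>\<open>lborel\<close>, on which
  Fubini's theorem and translations are available; Borel representatives give the link to
  \<^const>\<open>Lp_integral\<close>.
\<close>

definition Lpi :: "real \<Rightarrow> ('a::euclidean_space \<Rightarrow> real) \<Rightarrow> ennreal" where
  "Lpi p f = (\<integral>\<^sup>+x. ennreal (\<bar>f x\<bar> powr p) \<partial>lborel)"

lemma Lp_integral_eq_Lpi: "Lp_integral p f = Lpi p f"
  by (simp add: Lp_integral_def Lpi_def nn_integral_completion)

lemma Lpi_cong_AE: "AE x in lborel. f x = g x \<Longrightarrow> Lpi p f = Lpi p g"
  unfolding Lpi_def by (intro nn_integral_cong_AE) auto

lemma Lpi_mono: "(\<And>x. \<bar>f x\<bar> \<le> \<bar>g x\<bar>) \<Longrightarrow> p \<ge> 1 \<Longrightarrow> Lpi p f \<le> Lpi p g"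
  unfolding Lpi_def by (intro nn_integral_mono ennreal_leI powr_mono2) auto

lemma Lpi_weighted_add:
  assumes [measurable]: "f \<in> borel_measurable borel" "g \<in> borel_measurable borel"
    and "p \<ge> 1" "0 < \<theta>" "\<theta> < 1"
  shows "Lpi p (\<lambda>x. f x + g x) \<le> ennreal ((1 - \<theta>) powr (1 - p)) * Lpi p f + ennreal (\<theta> powr (1 - p)) * Lpi p g"
proof -
  have "Lpi p (\<lambda>x. f x + g x) \<le> (\<integral>\<^sup>+x. ennreal ((1 - \<theta>) powr (1 - p)) * ennreal (\<bar>f x\<bar> powr p) + ennreal (\<theta> powr (1 - p)) * ennreal (\<bar>g x\<bar> powr p) \<partial>lborel)"
    unfolding Lpi_def using assms(3-)
    by (intro nn_integral_mono) (auto simp: ennreal_mult[symmetric] ennreal_plus[symmetric] simp del: ennreal_plus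
        intro!: ennreal_leI powr_sum_le_weighted)
  also have "\<dots> = ennreal ((1 - \<theta>) powr (1 - p)) * Lpi p f + ennreal (\<theta> powr (1 - p)) * Lpi p g"
    unfolding Lpi_def by (subst nn_integral_add) (auto simp: nn_integral_cmult)
  finally show ?thesis .
qed

lemma Lpi_add:
  assumes [measurable]: "f \<in> borel_measurable borel" "g \<in> borel_measurable borel" and p: "p \<ge> 1"
  shows "Lpi p (\<lambda>x. f x + g x) \<le> ennreal (2 powr p) * (Lpi p f + Lpi p g)"
proof -
  have "Lpi p (\<lambda>x. f x + g x) \<le> ennreal ((1/2) powr (1 - p)) * Lpi p f + ennreal ((1/2) powr (1 - p)) * Lpi p g"
    using Lpi_weighted_add[OF assms, of "1/2"] by simp
  also have "(1/2) powr (1 - p) = 2 powr (p - 1)"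
    by (simp add: powr_divide powr_diff)
  also have "ennreal (2 powr (p - 1)) * Lpi p f + ennreal (2 powr (p - 1)) * Lpi p g = ennreal (2 powr (p - 1)) * (Lpi p f + Lpi p g)"
    by (simp add: distrib_left)
  also have "\<dots> \<le> ennreal (2 powr p) * (Lpi p f + Lpi p g)"
    by (intro mult_right_mono ennreal_leI powr_mono) auto
  finally show ?thesis .
qed

lemma Lpi_cmult:
  assumes [measurable]: "f \<in> borel_measurable borel"
  shows "Lpi p (\<lambda>x. c * f x) = ennreal (\<bar>c\<bar> powr p) * Lpi p f"
  unfolding Lpi_def by (subst nn_integral_cmult[symmetric]) (auto simp: abs_mult powr_mult ennreal_mult)

lemma nn_integral_lborel_shift:
  fixes g :: "'a::euclidean_space \<Rightarrow> ennreal"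
  assumes [measurable]: "g \<in> borel_measurable borel"
  shows "(\<integral>\<^sup>+x. g (x + h) \<partial>lborel) = (\<integral>\<^sup>+x. g x \<partial>lborel)"
proof -
  have "(\<integral>\<^sup>+x. g x \<partial>lborel) = (\<integral>\<^sup>+x. g x \<partial>distr lborel borel ((+) h))" by (simp add: lborel_distr_plus)
  also have "\<dots> = (\<integral>\<^sup>+x. g (h + x) \<partial>lborel)" by (subst nn_integral_distr) auto
  finally show ?thesis by (simp add: add.commute)
qed

lemma Lpi_shift:
  assumes [measurable]: "f \<in> borel_measurable borel"
  shows "Lpi p (\<lambda>x. f (x + h)) = Lpi p f"
  unfolding Lpi_def using nn_integral_lborel_shift[of "\<lambda>x. ennreal (\<bar>f x\<bar> powr p)" h] by simp

definition shift :: "'a::euclidean_space \<Rightarrow> ('a \<Rightarrow> real) \<Rightarrow> 'a \<Rightarrow> real" where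
  "shift h f = (\<lambda>x. f (x + h))"

lemma shift_measurable [measurable]:
  assumes [measurable]: "f \<in> borel_measurable borel"
  shows "shift h f \<in> borel_measurable borel"
  unfolding shift_def by measurable

lemma fdiff_measurable [measurable]:
  assumes [measurable]: "f \<in> borel_measurable borel"
  shows "fdiff h f \<in> borel_measurable borel"
  unfolding fdiff_def by measurable

lemma fdiff_pow_measurable [measurable]: "f \<in> borel_measurable borel \<Longrightarrow> (fdiff h ^^ m) f \<in> borel_measurable borel"
  by (induction m) auto

lemma fdiff_commute: "fdiff u (fdiff v f) = fdiff v (fdiff u f)"
  by (rule ext) (simp add: fdiff_def algebra_simps)

lemma fdiff_shift: "fdiff u (shift v f) = shift v (fdiff u f)"
  by (rule ext) (simp add: fdiff_def shift_def algebra_simps)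

lemma fdiff_pow_commute: "(fdiff u ^^ m) (fdiff v f) = fdiff v ((fdiff u ^^ m) f)"
  by (induction m) (simp_all add: fdiff_commute)

lemma fdiff_pow_shift: "(fdiff u ^^ m) (shift v f) = shift v ((fdiff u ^^ m) f)"
  by (induction m) (simp_all add: fdiff_shift)

lemma fdiff_pow_add: "(fdiff u ^^ m) (\<lambda>x. f x + g x) = (\<lambda>x. (fdiff u ^^ m) f x + (fdiff u ^^ m) g x)"
  by (induction m arbitrary: f g) (simp_all add: fdiff_def fun_eq_iff)

lemma Lpi_fdiff:
  assumes [measurable]: "f \<in> borel_measurable borel" and p: "p \<ge> 1"
  shows "Lpi p (fdiff h f) \<le> ennreal (2 * 2 powr p) * Lpi p f"
proof -
  have "Lpi p (fdiff h f) = Lpi p (\<lambda>x. shift h f x + (-1) * f x)" by (simp add: fdiff_def shift_def)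
  also have "\<dots> \<le> ennreal (2 powr p) * (Lpi p (shift h f) + Lpi p (\<lambda>x. (-1) * f x))"
    by (intro Lpi_add p) auto
  also have "\<dots> = ennreal (2 powr p) * (Lpi p f + Lpi p f)"
    using Lpi_cmult[of f p "-1"] Lpi_shift[of f p h] by (simp add: shift_def)
  also have "\<dots> = ennreal (2 * 2 powr p) * Lpi p f"
    by (simp add: mult_2[symmetric] ennreal_mult mult_ac)
  finally show ?thesis .
qed

lemma Lpi_fdiff_pow:
  assumes [measurable]: "f \<in> borel_measurable borel" and p: "p \<ge> 1"
  shows "Lpi p ((fdiff h ^^ m) f) \<le> ennreal ((2 * 2 powr p) ^ m) * Lpi p f"
proof (induction m)
  case (Suc m)
  have "Lpi p ((fdiff h ^^ Suc m) f) \<le> ennreal (2 * 2 powr p) * Lpi p ((fdiff h ^^ m) f)"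
    using p by (simp add: Lpi_fdiff)
  also have "\<dots> \<le> ennreal (2 * 2 powr p) * (ennreal ((2 * 2 powr p) ^ m) * Lpi p f)"
    by (intro mult_left_mono Suc) auto
  finally show ?case by (simp add: ennreal_mult mult.assoc)
qed simp

text \<open>
  Expanding the power of \<open>\<Delta>\<^bsub>u+v\<^esub> = \<Delta>\<^bsub>u\<^esub> T\<^bsub>v\<^esub> + \<Delta>\<^bsub>v\<^esub>\<close>, each term has \<open>i\<close> factors of the first
  kind or \<open>j\<close> of the second. The induction on \<open>i + j\<close> peels off one factor at a time and does not
  need the binomial expansion.
\<close>

lemma fdiff_add_pow_bound:
  fixes i j :: nat and p :: real
  assumes p: "p \<ge> 1"
  shows "\<exists>C\<ge>0. \<forall>u v. \<forall>f :: 'a::euclidean_space \<Rightarrow> real. f \<in> borel_measurable borel \<longrightarrow>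
     Lpi p ((fdiff (u + v) ^^ (i + j)) f) \<le> ennreal C * (Lpi p ((fdiff u ^^ i) f) + Lpi p ((fdiff v ^^ j) f))"
proof (induction "i + j" arbitrary: i j)
  case (0 i j)
  then show ?case by (intro exI[of _ 1]) auto
next
  case (Suc n i j)
  show ?case
  proof (cases "i = 0 \<or> j = 0")
    case True
    then show ?thesis
    proof (intro exI[of _ "(2 * 2 powr p) ^ (i + j)"] conjI allI impI)
      fix u v and f :: "'a \<Rightarrow> real" assume [measurable]: "f \<in> borel_measurable borel"
      have "Lpi p ((fdiff (u + v) ^^ (i + j)) f) \<le> ennreal ((2 * 2 powr p) ^ (i + j)) * Lpi p f"
        using p by (intro Lpi_fdiff_pow) auto
      also have "\<dots> \<le> ennreal ((2 * 2 powr p) ^ (i + j)) * (Lpi p ((fdiff u ^^ i) f) + Lpi p ((fdiff v ^^ j) f))"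
        using True by (intro mult_left_mono) auto
      finally show "Lpi p ((fdiff (u + v) ^^ (i + j)) f) \<le>
        ennreal ((2 * 2 powr p) ^ (i + j)) * (Lpi p ((fdiff u ^^ i) f) + Lpi p ((fdiff v ^^ j) f))" .
    qed auto
  next
    case False
    then obtain i' j' where ij: "i = Suc i'" "j = Suc j'" by (metis not0_implies_Suc)
    have n: "n = i' + j" "n = i + j'" using Suc.hyps(2) ij by auto
    obtain C1 where C1: "C1 \<ge> 0" "\<And>u v. \<And>f :: 'a \<Rightarrow> real. f \<in> borel_measurable borel \<Longrightarrow>
       Lpi p ((fdiff (u + v) ^^ n) f) \<le> ennreal C1 * (Lpi p ((fdiff u ^^ i') f) + Lpi p ((fdiff v ^^ j) f))"
      using Suc.hyps(1)[OF n(1)] n(1) by auto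
    obtain C2 where C2: "C2 \<ge> 0" "\<And>u v. \<And>f :: 'a \<Rightarrow> real. f \<in> borel_measurable borel \<Longrightarrow>
       Lpi p ((fdiff (u + v) ^^ n) f) \<le> ennreal C2 * (Lpi p ((fdiff u ^^ i) f) + Lpi p ((fdiff v ^^ j') f))"
      using Suc.hyps(1)[OF n(2)] n(2) by auto
    define b where "b = 2 * 2 powr p"
    have b: "b \<ge> 1" using p ge_one_powr_ge_zero[of 2 p] by (simp add: b_def)
    define C where "C = 2 powr p * (C1 + C2) * b"
    show ?thesis
    proof (intro exI[of _ C] conjI allI impI)
      show "C \<ge> 0" using C1 C2 b by (simp add: C_def)
      fix u v and f :: "'a \<Rightarrow> real" assume f [measurable]: "f \<in> borel_measurable borel"
      let ?U = "Lpi p ((fdiff u ^^ i) f)" and ?V = "Lpi p ((fdiff v ^^ j) f)"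
      have split: "fdiff (u + v) f = (\<lambda>x. fdiff u (shift v f) x + fdiff v f x)"
        by (rule ext) (simp add: fdiff_def shift_def algebra_simps)
      have "Lpi p ((fdiff (u + v) ^^ (i + j)) f) = Lpi p ((fdiff (u + v) ^^ n) (fdiff (u + v) f))"
        using Suc.hyps(2) by (metis comp_apply funpow_Suc_right)
      also have "\<dots> \<le> ennreal (2 powr p) * (Lpi p ((fdiff (u + v) ^^ n) (fdiff u (shift v f))) + Lpi p ((fdiff (u + v) ^^ n) (fdiff v f)))"
        unfolding split fdiff_pow_add by (intro Lpi_add p) auto
      also have "\<dots> \<le> ennreal (2 powr p) * (ennreal C1 * (?U + ennreal b * ?V) + ennreal C2 * (ennreal b * ?U + ?V))"
      proof (intro mult_left_mono add_mono)
        have 1: "(fdiff u ^^ i') (fdiff u (shift v f)) = shift v ((fdiff u ^^ i) f)"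
          by (simp add: ij fdiff_pow_shift fdiff_shift fdiff_pow_commute)
        have 2: "(fdiff v ^^ j) (fdiff u (shift v f)) = fdiff u (shift v ((fdiff v ^^ j) f))"
          by (simp only: fdiff_pow_shift fdiff_pow_commute)
        have "Lpi p ((fdiff (u + v) ^^ n) (fdiff u (shift v f))) \<le> ennreal C1 * (Lpi p (shift v ((fdiff u ^^ i) f)) + Lpi p (fdiff u (shift v ((fdiff v ^^ j) f))))"
          unfolding 1[symmetric] 2[symmetric] by (intro C1(2)) auto
        also have "\<dots> \<le> ennreal C1 * (?U + ennreal b * ?V)"
        proof (intro mult_left_mono add_mono)
          show "Lpi p (shift v ((fdiff u ^^ i) f)) \<le> ?U" by (simp add: shift_def Lpi_shift)
          have "Lpi p (fdiff u (shift v ((fdiff v ^^ j) f))) \<le> ennreal b * Lpi p (shift v ((fdiff v ^^ j) f))"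
            unfolding b_def using p by (intro Lpi_fdiff) auto
          then show "Lpi p (fdiff u (shift v ((fdiff v ^^ j) f))) \<le> ennreal b * ?V" by (simp add: shift_def Lpi_shift)
        qed auto
        finally show "Lpi p ((fdiff (u + v) ^^ n) (fdiff u (shift v f))) \<le> ennreal C1 * (?U + ennreal b * ?V)" .
        have 3: "(fdiff u ^^ i) (fdiff v f) = fdiff v ((fdiff u ^^ i) f)" by (rule fdiff_pow_commute)
        have 4: "(fdiff v ^^ j') (fdiff v f) = (fdiff v ^^ j) f" by (simp add: ij fdiff_pow_commute)
        have "Lpi p ((fdiff (u + v) ^^ n) (fdiff v f)) \<le> ennreal C2 * (Lpi p (fdiff v ((fdiff u ^^ i) f)) + ?V)"
          unfolding 3[symmetric] 4[symmetric] by (intro C2(2)) auto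
        also have "\<dots> \<le> ennreal C2 * (ennreal b * ?U + ?V)"
          unfolding b_def using p by (intro mult_left_mono add_mono Lpi_fdiff) auto
        finally show "Lpi p ((fdiff (u + v) ^^ n) (fdiff v f)) \<le> ennreal C2 * (ennreal b * ?U + ?V)" .
      qed auto
      also have "\<dots> \<le> ennreal (2 powr p) * (ennreal C1 * (ennreal b * ?U + ennreal b * ?V) + ennreal C2 * (ennreal b * ?U + ennreal b * ?V))"
      proof -
        have "X \<le> ennreal b * X" for X
          using mult_right_mono[of 1 "ennreal b" X] b by (simp add: ennreal_leI[of 1 b, simplified])
        then show ?thesis by (intro mult_left_mono add_mono) auto
      qed
      also have "\<dots> = ennreal C * (?U + ?V)"
        using C1(1) C2(1) b by (simp add: C_def ennreal_mult ennreal_plus distrib_left distrib_right mult_ac add_ac)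
      finally show "Lpi p ((fdiff (u + v) ^^ (i + j)) f) \<le> ennreal C * (?U + ?V)" .
    qed
  qed
qed

lemma fdiff_uminus_pow:
  assumes [measurable]: "f \<in> borel_measurable borel"
  shows "Lpi p ((fdiff (- h) ^^ m) f) = Lpi p ((fdiff h ^^ m) f)"
  using assms
proof (induction m arbitrary: f)
  case (Suc m)
  note [measurable] = Suc.prems
  let ?g = "(fdiff (- h) ^^ m) f"
  have "fdiff (- h) ?g = (\<lambda>x. (-1) * shift (- h) (fdiff h ?g) x)"
    by (rule ext) (simp add: fdiff_def shift_def)
  then have "Lpi p ((fdiff (- h) ^^ Suc m) f) = Lpi p (\<lambda>x. (-1) * shift (- h) (fdiff h ?g) x)" by simp
  also have "\<dots> = Lpi p (fdiff h ?g)"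
    using Lpi_cmult[of "shift (- h) (fdiff h ?g)" p "-1"] Lpi_shift[of "fdiff h ?g" p "-h"] by (simp add: shift_def)
  also have "\<dots> = Lpi p ((fdiff (- h) ^^ m) (fdiff h f))" by (simp add: fdiff_pow_commute)
  also have "\<dots> = Lpi p ((fdiff h ^^ m) (fdiff h f))" by (rule Suc.IH) simp
  finally show ?case by (simp add: fdiff_pow_commute)
qed simp

section \<open>Directional Besov energies\<close>

text \<open>
  With \<open>T\<close> the shift by \<open>h\<close>, this is \<open>(T\<^sup>2 - 1)\<^sup>m = (T + 1)\<^sup>m (T - 1)\<^sup>m\<close>.
\<close>

lemma fdiff_double_pow:
  fixes f :: "'a::euclidean_space \<Rightarrow> real"
  shows "(fdiff (2 *\<^sub>R h) ^^ m) f = ((\<lambda>g x. g (x + h) + g x) ^^ m) ((fdiff h ^^ m) f)"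
proof -
  let ?Y = "\<lambda>(g::'a \<Rightarrow> real) x. g (x + h) + g x"
  have comm: "fdiff h (?Y g) = ?Y (fdiff h g)" for g
    by (rule ext) (simp add: fdiff_def)
  have one: "fdiff (2 *\<^sub>R h) g = ?Y (fdiff h g)" for g :: "'a \<Rightarrow> real"
    by (rule ext) (simp add: fdiff_def scaleR_2 add.assoc)
  have commp: "fdiff h ((?Y ^^ m) g) = (?Y ^^ m) (fdiff h g)" for g m
  proof (induction m)
    case (Suc m)
    then show ?case using comm[of "(?Y ^^ m) g"] by simp
  qed simp
  show ?thesis
  proof (induction m)
    case (Suc m)
    have "(fdiff (2 *\<^sub>R h) ^^ Suc m) f = ?Y (fdiff h ((fdiff (2 *\<^sub>R h) ^^ m) f))"
      using one[of "(fdiff (2 *\<^sub>R h) ^^ m) f"] by simp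
    also have "\<dots> = ?Y ((?Y ^^ m) (fdiff h ((fdiff h ^^ m) f)))" unfolding Suc commp ..
    finally show ?case by simp
  qed simp
qed

lemma pair_sum_pow_measurable:
  fixes g :: "'a::euclidean_space \<Rightarrow> real"
  assumes "g \<in> borel_measurable borel"
  shows "((\<lambda>g x. g (x + h) + g x) ^^ m) g \<in> borel_measurable borel"
proof (induction m)
  case (Suc m)
  note [measurable] = Suc
  have "(\<lambda>x. ((\<lambda>g x. g (x + h) + g x) ^^ m) g (x + h) + ((\<lambda>g x. g (x + h) + g x) ^^ m) g x) \<in> borel_measurable borel"
    by measurable
  then show ?case by simp
qed (use assms in simp)

text \<open>
  Since \<open>T + 1 = 2 + \<Delta>\<close>, the difference \<open>(T + 1)\<^sup>m - 2\<^sup>m\<close> is divisible by \<open>\<Delta>\<close>.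
\<close>

lemma pair_sum_pow_remainder:
  assumes p: "p \<ge> 1"
  shows "\<exists>C\<ge>0. \<forall>h. \<forall>g :: 'a::euclidean_space \<Rightarrow> real. g \<in> borel_measurable borel \<longrightarrow>
    Lpi p (\<lambda>x. ((\<lambda>g x. g (x + h) + g x) ^^ m) g x - 2 ^ m * g x) \<le> ennreal C * Lpi p (fdiff h g)"
proof (induction m)
  case 0
  then show ?case by (intro exI[of _ 0]) (auto simp: Lpi_def)
next
  case (Suc m)
  then obtain C where C: "C \<ge> 0" "\<And>h. \<And>g :: 'a \<Rightarrow> real. g \<in> borel_measurable borel \<Longrightarrow>
    Lpi p (\<lambda>x. ((\<lambda>g x. g (x + h) + g x) ^^ m) g x - 2 ^ m * g x) \<le> ennreal C * Lpi p (fdiff h g)" by auto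
  define C' where "C' = 2 powr p * (2 powr p * (2 * C) + (2 ^ m) powr p)"
  show ?case
  proof (intro exI[of _ C'] conjI allI impI)
    show "C' \<ge> 0" using C by (simp add: C'_def)
    fix h and g :: "'a \<Rightarrow> real" assume g [measurable]: "g \<in> borel_measurable borel"
    define Yg where "Yg = ((\<lambda>g x. g (x + h) + g x) ^^ m) g"
    have [measurable]: "Yg \<in> borel_measurable borel" unfolding Yg_def by (rule pair_sum_pow_measurable) fact
    define r where "r x = Yg x - 2 ^ m * g x" for x
    have [measurable]: "r \<in> borel_measurable borel" unfolding r_def by measurable
    have r: "Lpi p r \<le> ennreal C * Lpi p (fdiff h g)" using C(2)[OF g] by (simp add: r_def[abs_def] Yg_def)
    have "Lpi p (\<lambda>x. ((\<lambda>g x. g (x + h) + g x) ^^ Suc m) g x - 2 ^ Suc m * g x) = Lpi p (\<lambda>x. (shift h r x + r x) + 2 ^ m * fdiff h g x)"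
      unfolding r_def shift_def fdiff_def Yg_def by (intro arg_cong[where f="Lpi p"] ext) (simp add: algebra_simps)
    also have "\<dots> \<le> ennreal (2 powr p) * (Lpi p (\<lambda>x. shift h r x + r x) + Lpi p (\<lambda>x. 2 ^ m * fdiff h g x))"
      by (intro Lpi_add p) auto
    also have "\<dots> \<le> ennreal (2 powr p) * (ennreal (2 powr p) * (Lpi p (shift h r) + Lpi p r) + Lpi p (\<lambda>x. 2 ^ m * fdiff h g x))"
      by (intro mult_left_mono add_right_mono Lpi_add p) auto
    also have "Lpi p (shift h r) = Lpi p r" by (simp add: shift_def Lpi_shift)
    also have "Lpi p (\<lambda>x. 2 ^ m * fdiff h g x) = ennreal ((2 ^ m) powr p) * Lpi p (fdiff h g)"
      by (subst Lpi_cmult) auto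
    also have "ennreal (2 powr p) * (ennreal (2 powr p) * (Lpi p r + Lpi p r) + ennreal ((2 ^ m) powr p) * Lpi p (fdiff h g))
      \<le> ennreal (2 powr p) * (ennreal (2 powr p) * (ennreal C * Lpi p (fdiff h g) + ennreal C * Lpi p (fdiff h g)) + ennreal ((2 ^ m) powr p) * Lpi p (fdiff h g))"
      by (intro mult_left_mono add_right_mono add_mono r) auto
    also have "ennreal C * Lpi p (fdiff h g) + ennreal C * Lpi p (fdiff h g) = ennreal (2 * C) * Lpi p (fdiff h g)"
      using C(1) by (simp add: mult_2[symmetric] ennreal_mult mult.assoc)
    also have "ennreal (2 powr p) * (ennreal (2 powr p) * (ennreal (2 * C) * Lpi p (fdiff h g)) + ennreal ((2 ^ m) powr p) * Lpi p (fdiff h g))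
       = ennreal C' * Lpi p (fdiff h g)"
      using C(1) by (simp add: C'_def ennreal_mult ennreal_plus distrib_left distrib_right mult_ac)
    finally show "Lpi p (\<lambda>x. ((\<lambda>g x. g (x + h) + g x) ^^ Suc m) g x - 2 ^ Suc m * g x) \<le> ennreal C' * Lpi p (fdiff h g)" .
  qed
qed

text \<open>
  Combine \<open>\<Delta>\<^bsub>2h\<^esub>\<^sup>m = (T + 1)\<^sup>m \<Delta>\<^bsub>h\<^esub>\<^sup>m\<close> with \<open>(T + 1)\<^sup>m = 2\<^sup>m +\<close> (terms containing
  \<open>\<Delta>\<^bsub>h\<^esub>\<close>). The small factor \<open>2\<^bsup>-mp\<^esup>\<close> in front of the doubled step is what makes absorption possible.
\<close>

lemma Marchaud_step:
  assumes p: "p \<ge> 1" and \<theta>: "0 < \<theta>" "\<theta> < 1"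
  shows "\<exists>C\<ge>0. \<forall>h. \<forall>f :: 'a::euclidean_space \<Rightarrow> real. f \<in> borel_measurable borel \<longrightarrow>
    Lpi p ((fdiff h ^^ m) f) \<le> ennreal (2 powr (- (real m * p)) * (1 - \<theta>) powr (1 - p)) * Lpi p ((fdiff (2 *\<^sub>R h) ^^ m) f)
      + ennreal C * Lpi p ((fdiff h ^^ Suc m) f)"
proof -
  obtain C where C: "C \<ge> 0" "\<And>h. \<And>g :: 'a \<Rightarrow> real. g \<in> borel_measurable borel \<Longrightarrow>
    Lpi p (\<lambda>x. ((\<lambda>g x. g (x + h) + g x) ^^ m) g x - 2 ^ m * g x) \<le> ennreal C * Lpi p (fdiff h g)"
    using pair_sum_pow_remainder[OF p, where m=m and 'a='a] by blast
  define a where "a = 2 powr (- (real m * p))"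
  have a: "\<bar>(1/2) ^ m :: real\<bar> powr p = a"
    by (simp add: a_def powr_realpow[symmetric] powr_powr powr_minus_divide power_one_over powr_divide)
  show ?thesis
  proof (intro exI[of _ "a * (\<theta> powr (1 - p) * C)"] conjI allI impI)
    show "a * (\<theta> powr (1 - p) * C) \<ge> 0" using C by (simp add: a_def)
    fix h and f :: "'a \<Rightarrow> real" assume f [measurable]: "f \<in> borel_measurable borel"
    define g where "g = (fdiff h ^^ m) f"
    have g [measurable]: "g \<in> borel_measurable borel" by (simp add: g_def)
    define Yg where "Yg = ((\<lambda>g x. g (x + h) + g x) ^^ m) g"
    have [measurable]: "Yg \<in> borel_measurable borel" unfolding Yg_def by (rule pair_sum_pow_measurable) fact
    have Yg: "(fdiff (2 *\<^sub>R h) ^^ m) f = Yg" unfolding Yg_def g_def by (rule fdiff_double_pow)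
    have [measurable]: "(\<lambda>x. Yg x - 2 ^ m * g x) \<in> borel_measurable borel" by measurable
    have "Lpi p g = Lpi p (\<lambda>x. (1/2) ^ m * (Yg x + (-1) * (Yg x - 2 ^ m * g x)))"
      by (intro arg_cong[where f="Lpi p"] ext) (simp add: power_one_over)
    also have "\<dots> = ennreal a * Lpi p (\<lambda>x. Yg x + (-1) * (Yg x - 2 ^ m * g x))"
      unfolding a[symmetric] by (rule Lpi_cmult) measurable
    also have "\<dots> \<le> ennreal a * (ennreal ((1 - \<theta>) powr (1 - p)) * Lpi p Yg + ennreal (\<theta> powr (1 - p)) * Lpi p (\<lambda>x. (-1) * (Yg x - 2 ^ m * g x)))"
      by (intro mult_left_mono Lpi_weighted_add p \<theta>) auto
    also have "Lpi p (\<lambda>x. (-1) * (Yg x - 2 ^ m * g x)) = Lpi p (\<lambda>x. Yg x - 2 ^ m * g x)"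
      by (subst Lpi_cmult) auto
    also have "ennreal a * (ennreal ((1 - \<theta>) powr (1 - p)) * Lpi p Yg + ennreal (\<theta> powr (1 - p)) * Lpi p (\<lambda>x. Yg x - 2 ^ m * g x))
      \<le> ennreal a * (ennreal ((1 - \<theta>) powr (1 - p)) * Lpi p Yg + ennreal (\<theta> powr (1 - p)) * (ennreal C * Lpi p (fdiff h g)))"
      using C(2)[OF g] by (intro mult_left_mono add_left_mono) (auto simp: Yg_def)
    also have "\<dots> = ennreal (a * (1 - \<theta>) powr (1 - p)) * Lpi p Yg + ennreal (a * (\<theta> powr (1 - p) * C)) * Lpi p (fdiff h g)"
      using C(1) by (simp add: a_def ennreal_mult distrib_left mult_ac)
    finally show "Lpi p ((fdiff h ^^ m) f) \<le> ennreal (2 powr (- (real m * p)) * (1 - \<theta>) powr (1 - p)) * Lpi p ((fdiff (2 *\<^sub>R h) ^^ m) f)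
      + ennreal (a * (\<theta> powr (1 - p) * C)) * Lpi p ((fdiff h ^^ Suc m) f)"
      by (simp add: Yg a_def g_def)
  qed
qed

lemma fdiff_pow_joint_measurable:
  fixes f :: "'a::euclidean_space \<Rightarrow> real"
  assumes [measurable]: "f \<in> borel_measurable borel"
  shows "(\<lambda>(h, x). (fdiff h ^^ m) f x) \<in> borel_measurable (borel \<Otimes>\<^sub>M borel)"
proof (induction m)
  case 0
  then show ?case by simp
next
  case (Suc m)
  define G where "G = (\<lambda>(h, x). (fdiff h ^^ m) f x)"
  have [measurable]: "G \<in> borel_measurable (borel \<Otimes>\<^sub>M borel)" using Suc by (simp add: G_def)
  have "(\<lambda>(h, x). (fdiff h ^^ Suc m) f x) = (\<lambda>(h, x). G (h, x + h) - G (h, x))"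
    by (auto simp: G_def fdiff_def)
  also have "\<dots> \<in> borel_measurable (borel \<Otimes>\<^sub>M borel)" by measurable
  finally show ?case .
qed

definition diff_modulus :: "nat \<Rightarrow> real \<Rightarrow> ('a::euclidean_space \<Rightarrow> real) \<Rightarrow> 'a \<Rightarrow> ennreal" where
  "diff_modulus m p f h = Lpi p ((fdiff h ^^ m) f)"

lemma diff_modulus_measurable [measurable]:
  assumes [measurable]: "f \<in> borel_measurable borel"
  shows "diff_modulus m p f \<in> borel_measurable borel"
proof -
  have [measurable]: "(\<lambda>(h, x). (fdiff h ^^ m) f x) \<in> borel_measurable (borel \<Otimes>\<^sub>M lborel)"
    using fdiff_pow_joint_measurable[OF assms] by simp
  have "(\<lambda>(h, x). ennreal (\<bar>(fdiff h ^^ m) f x\<bar> powr p)) \<in> borel_measurable (borel \<Otimes>\<^sub>M lborel)"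
    using fdiff_pow_joint_measurable[OF assms] by (simp add: split_beta' cong: measurable_cong_sets)
  then show ?thesis
    unfolding diff_modulus_def[abs_def] Lpi_def by (rule lborel.borel_measurable_nn_integral)
qed

text \<open>
  The homogeneous extension of the directional energy; on unit vectors, with \<open>\<alpha> = s p\<close> and
  \<open>m = \<lfloor>s\<rfloor> + 1\<close>, it is the directional energy itself.
\<close>

definition diff_energy :: "nat \<Rightarrow> real \<Rightarrow> real \<Rightarrow> ('a::euclidean_space \<Rightarrow> real) \<Rightarrow> 'a \<Rightarrow> ennreal" where
  "diff_energy m \<alpha> p f v = (\<integral>\<^sup>+t\<in>{0<..}. ennreal (t powr (- \<alpha> - 1)) * diff_modulus m p f (t *\<^sub>R v) \<partial>lborel)"

lemma diff_energy_measurable [measurable]: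
  assumes [measurable]: "f \<in> borel_measurable borel"
  shows "diff_energy m \<alpha> p f \<in> borel_measurable borel"
proof -
  have "(\<lambda>(v::'a, t). ennreal (t powr (- \<alpha> - 1)) * diff_modulus m p f (t *\<^sub>R v) * indicator {0<..} t) \<in> borel_measurable (borel \<Otimes>\<^sub>M lborel)"
    by measurable
  then show ?thesis
    unfolding diff_energy_def[abs_def] by (rule lborel.borel_measurable_nn_integral)
qed

lemma scaled_power_integral:
  fixes W :: "real \<Rightarrow> ennreal"
  assumes [measurable]: "W \<in> borel_measurable borel" and c: "c > 0"
  shows "(\<integral>\<^sup>+t\<in>{a<..}. ennreal (t powr (- \<alpha> - 1)) * W (c * t) \<partial>lborel) =
    ennreal (c powr \<alpha>) * (\<integral>\<^sup>+t\<in>{c * a<..}. ennreal (t powr (- \<alpha> - 1)) * W t \<partial>lborel)"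
proof -
  have "(\<integral>\<^sup>+t\<in>{c * a<..}. ennreal (t powr (- \<alpha> - 1)) * W t \<partial>lborel) =
     ennreal c * (\<integral>\<^sup>+t. ennreal ((c * t) powr (- \<alpha> - 1)) * W (c * t) * indicator {c * a<..} (c * t) \<partial>lborel)"
    using nn_integral_real_affine[of "\<lambda>t. ennreal (t powr (- \<alpha> - 1)) * W t * indicator {c * a<..} t" c 0] c by simp
  also have "(\<integral>\<^sup>+t. ennreal ((c * t) powr (- \<alpha> - 1)) * W (c * t) * indicator {c * a<..} (c * t) \<partial>lborel)
     = (\<integral>\<^sup>+t. ennreal (c powr (- \<alpha> - 1)) * (ennreal (t powr (- \<alpha> - 1)) * W (c * t) * indicator {a<..} t) \<partial>lborel)"
    using c by (intro nn_integral_cong) (auto simp: indicator_def powr_mult ennreal_mult mult_ac)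
  also have "\<dots> = ennreal (c powr (- \<alpha> - 1)) * (\<integral>\<^sup>+t\<in>{a<..}. ennreal (t powr (- \<alpha> - 1)) * W (c * t) \<partial>lborel)"
    by (rule nn_integral_cmult) measurable
  finally have "ennreal (c powr \<alpha>) * (\<integral>\<^sup>+t\<in>{c * a<..}. ennreal (t powr (- \<alpha> - 1)) * W t \<partial>lborel) =
     (ennreal (c powr \<alpha>) * (ennreal c * ennreal (c powr (- \<alpha> - 1)))) * (\<integral>\<^sup>+t\<in>{a<..}. ennreal (t powr (- \<alpha> - 1)) * W (c * t) \<partial>lborel)"
    by (simp add: mult.assoc)
  also have "ennreal (c powr \<alpha>) * (ennreal c * ennreal (c powr (- \<alpha> - 1))) = 1"
  proof -
    have "c powr \<alpha> * (c powr 1 * c powr (- \<alpha> - 1)) = 1" using c by (simp only: powr_add[symmetric]) simp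
    then show ?thesis using c by (simp add: ennreal_mult[symmetric])
  qed
  finally show ?thesis by simp
qed

lemma power_tail_integral:
  assumes "a > 0" "\<alpha> > 0"
  shows "(\<integral>\<^sup>+t\<in>{a<..}. ennreal (t powr (- \<alpha> - 1)) \<partial>lborel) = ennreal (a powr (- \<alpha>) / \<alpha>)"
proof -
  have "(\<integral>\<^sup>+t\<in>{a<..}. ennreal (t powr (- \<alpha> - 1)) \<partial>lborel) = (\<integral>\<^sup>+t\<in>{a..}. ennreal (t powr (- \<alpha> - 1)) \<partial>lborel)"
    by (intro nn_integral_cong_AE AE_I[where N="{a}"]) (auto simp: indicator_def split: if_splits)
  also have "\<dots> = ennreal (0 - (- (a powr (- \<alpha>) / \<alpha>)))"
  proof (rule nn_integral_FTC_atLeast)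
    fix x assume "a \<le> x"
    then have "x > 0" using assms by simp
    then have "((\<lambda>x. x powr (- \<alpha>)) has_real_derivative (- \<alpha>) * x powr (- \<alpha> - 1)) (at x)"
      by (rule has_real_derivative_powr)
    then have "((\<lambda>x. - (x powr (- \<alpha>) / \<alpha>)) has_real_derivative - ((- \<alpha>) * x powr (- \<alpha> - 1) / \<alpha>)) (at x)"
      by (intro DERIV_minus DERIV_cdivide)
    then show "((\<lambda>x. - (x powr (- \<alpha>) / \<alpha>)) has_real_derivative x powr (- \<alpha> - 1)) (at x)"
      using assms by simp
  next
    have "((\<lambda>x. x powr (- \<alpha>)) \<longlongrightarrow> 0) at_top"
      using assms by (intro tendsto_neg_powr filterlim_ident) auto
    then have "((\<lambda>x. - (x powr (- \<alpha>) / \<alpha>)) \<longlongrightarrow> - (0 / \<alpha>)) at_top"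
      using assms by (intro tendsto_intros) auto
    then show "((\<lambda>x. - (x powr (- \<alpha>) / \<alpha>)) \<longlongrightarrow> 0) at_top" by simp
  qed auto
  finally show ?thesis by simp
qed

text \<open>
  The truncated integrals are finite for functions in Lp, which the absorption argument below requires.
\<close>

lemma diff_energy_truncation:
  assumes [measurable]: "f \<in> borel_measurable borel"
  shows "diff_energy m \<alpha> p f v = (SUP k::nat. (\<integral>\<^sup>+t\<in>{1 / real (Suc k)<..}. ennreal (t powr (- \<alpha> - 1)) * diff_modulus m p f (t *\<^sub>R v) \<partial>lborel))"
proof -
  let ?g = "\<lambda>k t. ennreal (t powr (- \<alpha> - 1)) * diff_modulus m p f (t *\<^sub>R v) * indicator {1 / real (Suc k)<..} t"
  have "diff_energy m \<alpha> p f v = (\<integral>\<^sup>+t. (SUP k::nat. ?g k t) \<partial>lborel)"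
    unfolding diff_energy_def
  proof (rule nn_integral_cong)
    fix t :: real
    have ind: "indicator {0<..} t = (SUP k::nat. indicator {1 / real (Suc k)<..} t :: ennreal)"
    proof (cases "t > 0")
      case True
      then obtain k where "1 / real (Suc k) < t" using reals_Archimedean by (metis inverse_eq_divide)
      then have "1 \<le> (SUP k::nat. indicator {1 / real (Suc k)<..} t :: ennreal)" by (intro SUP_upper2[of k]) auto
      moreover have "(SUP k::nat. indicator {1 / real (Suc k)<..} t :: ennreal) \<le> 1" by (intro SUP_least) (auto simp: indicator_def)
      ultimately show ?thesis using True by (simp add: antisym)
    next
      case False
      then have "indicator {1 / real (Suc k)<..} t = (0::ennreal)" for k
      proof -
        have "0 < 1 / real (Suc k)" by simp
        then have "\<not> 1 / real (Suc k) < t" using False by linarith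
        then show ?thesis by (simp add: indicator_def)
      qed
      then show ?thesis using False by simp
    qed
    show "ennreal (t powr (- \<alpha> - 1)) * diff_modulus m p f (t *\<^sub>R v) * indicator {0<..} t = (SUP k::nat. ?g k t)"
      unfolding ind by (rule SUP_mult_left_ennreal)
  qed
  also have "\<dots> = (SUP k::nat. \<integral>\<^sup>+t. ?g k t \<partial>lborel)"
  proof (rule nn_integral_monotone_convergence_SUP)
    show "incseq ?g"
    proof (rule incseq_SucI, rule le_funI)
      fix k :: nat and t :: real
      have "1 / real (Suc (Suc k)) \<le> 1 / real (Suc k)" by (intro divide_left_mono) auto
      then show "?g k t \<le> ?g (Suc k) t" by (intro mult_left_mono) (auto simp: indicator_def)
    qed
  qed measurable
  finally show ?thesis .
qed

text \<open>
  Integrating the Marchaud step against \<open>t\<^bsup>-\<alpha>-1\<^esup>\<close>, the doubled step contributes \<open>2\<^sup>\<alpha>\<close> times the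
  integral itself, and \<open>2\<^bsup>\<alpha>-mp\<^esup> < 1\<close>, so that this term can be absorbed into the left-hand side.
\<close>

lemma diff_energy_Marchaud_step:
  assumes p: "p \<ge> 1" and \<alpha>: "0 < \<alpha>" "\<alpha> < real m * p"
  shows "\<exists>C\<ge>0. \<forall>f :: 'a::euclidean_space \<Rightarrow> real. \<forall>v. f \<in> borel_measurable borel \<longrightarrow> Lpi p f < \<infinity> \<longrightarrow>
    diff_energy m \<alpha> p f v \<le> ennreal C * diff_energy (Suc m) \<alpha> p f v"
proof -
  define \<delta> where "\<delta> = real m * p - \<alpha>"
  have \<delta>: "\<delta> > 0" using \<alpha> by (simp add: \<delta>_def)
  \<comment> \<open>At most half of the gap \<open>\<delta>\<close> between \<open>\<alpha>\<close> and \<open>m p\<close> is spent on the convexity factor; the rest keeps \<open>\<kappa> < 1\<close>.\<close>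
  define \<theta> where "\<theta> = 1 - 2 powr (- \<delta> / (2 * p))"
  have \<theta>: "0 < \<theta>" "\<theta> < 1"
    using \<delta> p by (auto simp: \<theta>_def powr_less_one divide_neg_pos)
  obtain C where C: "C \<ge> 0" "\<And>h. \<And>f :: 'a \<Rightarrow> real. f \<in> borel_measurable borel \<Longrightarrow>
    Lpi p ((fdiff h ^^ m) f) \<le> ennreal (2 powr (- (real m * p)) * (1 - \<theta>) powr (1 - p)) * Lpi p ((fdiff (2 *\<^sub>R h) ^^ m) f)
      + ennreal C * Lpi p ((fdiff h ^^ Suc m) f)"
    using Marchaud_step[OF p \<theta>, where m=m and 'a='a] by blast
  define c where "c = 2 powr (- (real m * p)) * (1 - \<theta>) powr (1 - p)"
  have c0: "c \<ge> 0" by (simp add: c_def)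
  define \<kappa> where "\<kappa> = c * 2 powr \<alpha>"
  have \<kappa>: "0 \<le> \<kappa>" "\<kappa> < 1"
  proof -
    have "\<kappa> = 2 powr (- \<delta> + (- \<delta> / (2 * p)) * (1 - p))"
    proof -
      have "\<kappa> = 2 powr (- (real m * p)) * 2 powr ((- \<delta> / (2 * p)) * (1 - p)) * 2 powr \<alpha>"
        by (simp add: \<kappa>_def c_def \<theta>_def powr_powr)
      also have "\<dots> = 2 powr (- (real m * p) + (- \<delta> / (2 * p)) * (1 - p) + \<alpha>)" by (simp only: powr_add)
      also have "- (real m * p) + (- \<delta> / (2 * p)) * (1 - p) + \<alpha> = - \<delta> + (- \<delta> / (2 * p)) * (1 - p)"
        unfolding \<delta>_def by linarith
      finally show ?thesis .
    qed
    moreover have "- \<delta> + (- \<delta> / (2 * p)) * (1 - p) = - \<delta> * ((1 / 2) + 1 / (2 * p))"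
      using p by (simp add: field_simps)
    moreover have "\<delta> * ((1 / 2) + 1 / (2 * p)) > 0" using \<delta> p by (intro mult_pos_pos) (auto intro: add_pos_pos)
    ultimately show "0 \<le> \<kappa>" "\<kappa> < 1" by (auto simp: powr_less_one)
  qed
  define C' where "C' = C / (1 - \<kappa>)"
  show ?thesis
  proof (intro exI[of _ C'] conjI allI impI)
    show "C' \<ge> 0" using C \<kappa> by (simp add: C'_def)
    fix f :: "'a \<Rightarrow> real" and v assume f [measurable]: "f \<in> borel_measurable borel" and fin: "Lpi p f < \<infinity>"
    let ?W = "diff_modulus m p f" and ?D = "diff_energy (Suc m) \<alpha> p f v"
    have "(\<integral>\<^sup>+t\<in>{a<..}. ennreal (t powr (- \<alpha> - 1)) * ?W (t *\<^sub>R v) \<partial>lborel) \<le> ennreal C' * ?D" if a: "a > 0" for a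
    proof -
      define I where "I = (\<integral>\<^sup>+t\<in>{a<..}. ennreal (t powr (- \<alpha> - 1)) * ?W (t *\<^sub>R v) \<partial>lborel)"
      have "I \<le> (\<integral>\<^sup>+t. (ennreal ((2 * 2 powr p) ^ m) * Lpi p f) * (ennreal (t powr (- \<alpha> - 1)) * indicator {a<..} t) \<partial>lborel)"
        unfolding I_def diff_modulus_def
      proof (rule nn_integral_mono)
        fix t
        have "ennreal (t powr (- \<alpha> - 1)) * indicator {a<..} t * Lpi p ((fdiff (t *\<^sub>R v) ^^ m) f)
          \<le> ennreal (t powr (- \<alpha> - 1)) * indicator {a<..} t * (ennreal ((2 * 2 powr p) ^ m) * Lpi p f)"
          using p by (intro mult_left_mono Lpi_fdiff_pow) auto
        then show "ennreal (t powr (- \<alpha> - 1)) * Lpi p ((fdiff (t *\<^sub>R v) ^^ m) f) * indicator {a<..} t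
          \<le> (ennreal ((2 * 2 powr p) ^ m) * Lpi p f) * (ennreal (t powr (- \<alpha> - 1)) * indicator {a<..} t)"
          by (simp add: mult_ac)
      qed
      also have "\<dots> = (ennreal ((2 * 2 powr p) ^ m) * Lpi p f) * ennreal (a powr (- \<alpha>) / \<alpha>)"
        unfolding power_tail_integral[OF a \<alpha>(1), symmetric] by (rule nn_integral_cmult) measurable
      also have "\<dots> < \<infinity>" using fin by (simp add: ennreal_mult_less_top)
      finally have Ifin: "I < \<infinity>" .
      have "(\<integral>\<^sup>+t\<in>{a<..}. ennreal (t powr (- \<alpha> - 1)) * ?W ((2 * t) *\<^sub>R v) \<partial>lborel) =
        ennreal (2 powr \<alpha>) * (\<integral>\<^sup>+t\<in>{2 * a<..}. ennreal (t powr (- \<alpha> - 1)) * ?W (t *\<^sub>R v) \<partial>lborel)"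
        by (rule scaled_power_integral[OF measurable_compose[OF _ diff_modulus_measurable[OF f]]]) auto
      also have "\<dots> \<le> ennreal (2 powr \<alpha>) * I"
        unfolding I_def using a by (intro mult_left_mono nn_integral_mono) (auto simp: indicator_def)
      finally have dbl: "(\<integral>\<^sup>+t\<in>{a<..}. ennreal (t powr (- \<alpha> - 1)) * ?W ((2 * t) *\<^sub>R v) \<partial>lborel) \<le> ennreal (2 powr \<alpha>) * I" .
      have "I \<le> (\<integral>\<^sup>+t. ennreal c * (ennreal (t powr (- \<alpha> - 1)) * ?W ((2 * t) *\<^sub>R v) * indicator {a<..} t)
          + ennreal C * (ennreal (t powr (- \<alpha> - 1)) * diff_modulus (Suc m) p f (t *\<^sub>R v) * indicator {0<..} t) \<partial>lborel)"
        unfolding I_def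
      proof (rule nn_integral_mono)
        fix t
        have "?W (t *\<^sub>R v) \<le> ennreal c * ?W ((2 * t) *\<^sub>R v) + ennreal C * diff_modulus (Suc m) p f (t *\<^sub>R v)"
          using C(2)[OF f, of "t *\<^sub>R v"] by (simp add: diff_modulus_def c_def)
        then have "ennreal (t powr (- \<alpha> - 1)) * ?W (t *\<^sub>R v) \<le> ennreal (t powr (- \<alpha> - 1)) * (ennreal c * ?W ((2 * t) *\<^sub>R v) + ennreal C * diff_modulus (Suc m) p f (t *\<^sub>R v))"
          by (intro mult_left_mono) auto
        then show "ennreal (t powr (- \<alpha> - 1)) * ?W (t *\<^sub>R v) * indicator {a<..} t \<le>
            ennreal c * (ennreal (t powr (- \<alpha> - 1)) * ?W ((2 * t) *\<^sub>R v) * indicator {a<..} t)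
          + ennreal C * (ennreal (t powr (- \<alpha> - 1)) * diff_modulus (Suc m) p f (t *\<^sub>R v) * indicator {0<..} t)"
          using a by (auto simp: indicator_def distrib_left mult_ac)
      qed
      also have "\<dots> = ennreal c * (\<integral>\<^sup>+t\<in>{a<..}. ennreal (t powr (- \<alpha> - 1)) * ?W ((2 * t) *\<^sub>R v) \<partial>lborel) + ennreal C * ?D"
        unfolding diff_energy_def by (subst nn_integral_add) (auto simp: nn_integral_cmult)
      also have "\<dots> \<le> ennreal c * (ennreal (2 powr \<alpha>) * I) + ennreal C * ?D"
        using dbl by (intro add_right_mono mult_left_mono) auto
      also have "\<dots> = ennreal \<kappa> * I + ennreal C * ?D" using c0 by (simp add: \<kappa>_def ennreal_mult mult.assoc)
      finally have abs: "I \<le> ennreal \<kappa> * I + ennreal C * ?D" .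
      have "I \<le> ennreal C' * ?D"
      proof (cases "?D = \<infinity>")
        case True
        then show ?thesis
        proof (cases "C = 0")
          case True
          then have "I \<le> ennreal \<kappa> * I" using abs by simp
          obtain i where i: "I = ennreal i" "i \<ge> 0" using Ifin by (cases I) auto
          have "i \<le> \<kappa> * i" using \<open>I \<le> ennreal \<kappa> * I\<close> i \<kappa> by (simp add: ennreal_mult[symmetric])
          then have "i = 0" using i \<kappa> mult_right_mono[of \<kappa> 1 i] by (smt (verit) mult_le_cancel_right1)
          then show ?thesis using i by simp
        next
          case False
          then have "C' > 0" using C \<kappa> by (simp add: C'_def)
          then show ?thesis using True by (simp add: ennreal_mult_top)
        qed
      next
        case False
        then obtain d where d: "?D = ennreal d" "d \<ge> 0" by (cases ?D) auto
        obtain i where i: "I = ennreal i" "i \<ge> 0" using Ifin by (cases I) auto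
        have "i \<le> \<kappa> * i + C * d"
          using abs i d \<kappa> C(1) by (simp add: ennreal_mult[symmetric] ennreal_plus[symmetric] del: ennreal_plus)
        then have "i \<le> C' * d" using \<kappa> by (simp add: C'_def field_simps)
        then show ?thesis using i d \<open>C' \<ge> 0\<close> by (simp add: ennreal_mult[symmetric])
      qed
      then show ?thesis by (simp add: I_def)
    qed
    then show "diff_energy m \<alpha> p f v \<le> ennreal C' * ?D"
      unfolding diff_energy_truncation[OF f, of m] by (intro SUP_least) auto
  qed
qed

lemma diff_energy_Marchaud:
  assumes p: "p \<ge> 1" and \<alpha>: "0 < \<alpha>" "\<alpha> < real m * p"
  shows "\<exists>C\<ge>0. \<forall>f :: 'a::euclidean_space \<Rightarrow> real. \<forall>v. f \<in> borel_measurable borel \<longrightarrow> Lpi p f < \<infinity> \<longrightarrow>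
    diff_energy m \<alpha> p f v \<le> ennreal C * diff_energy (m + k) \<alpha> p f v"
proof (induction k)
  case 0
  then show ?case by (intro exI[of _ 1]) auto
next
  case (Suc k)
  then obtain C1 where C1: "C1 \<ge> 0" "\<And>f :: 'a \<Rightarrow> real. \<And>v. f \<in> borel_measurable borel \<Longrightarrow> Lpi p f < \<infinity> \<Longrightarrow>
    diff_energy m \<alpha> p f v \<le> ennreal C1 * diff_energy (m + k) \<alpha> p f v" by auto
  have "real m * p \<le> real (m + k) * p" using p by (intro mult_right_mono) auto
  then have "\<alpha> < real (m + k) * p" using \<alpha> by linarith
  then obtain C2 where C2: "C2 \<ge> 0" "\<And>f :: 'a \<Rightarrow> real. \<And>v. f \<in> borel_measurable borel \<Longrightarrow> Lpi p f < \<infinity> \<Longrightarrow>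
    diff_energy (m + k) \<alpha> p f v \<le> ennreal C2 * diff_energy (Suc (m + k)) \<alpha> p f v"
    using diff_energy_Marchaud_step[OF p \<alpha>(1), where m="m + k" and 'a='a] by blast
  show ?case
  proof (intro exI[of _ "C1 * C2"] conjI allI impI)
    fix f :: "'a \<Rightarrow> real" and v assume f: "f \<in> borel_measurable borel" "Lpi p f < \<infinity>"
    have "diff_energy m \<alpha> p f v \<le> ennreal C1 * (ennreal C2 * diff_energy (Suc (m + k)) \<alpha> p f v)"
      using C1(2)[OF f] mult_left_mono[OF C2(2)[OF f]] by (meson order_trans zero_le)
    then show "diff_energy m \<alpha> p f v \<le> ennreal (C1 * C2) * diff_energy (m + Suc k) \<alpha> p f v"
      using C1 C2 by (simp add: ennreal_mult mult.assoc)
  qed (use C1 C2 in simp)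
qed

text \<open>
  Raise the order from \<open>m\<close> to \<open>2 m\<close> by Marchaud, split the difference along \<open>u + v\<close> into
  differences of order \<open>m\<close> along \<open>u\<close> and along \<open>v\<close>.
\<close>

lemma diff_energy_subadditive:
  assumes p: "p \<ge> 1" and \<alpha>: "0 < \<alpha>" "\<alpha> < real m * p"
  shows "\<exists>C\<ge>0. \<forall>f :: 'a::euclidean_space \<Rightarrow> real. \<forall>u v. f \<in> borel_measurable borel \<longrightarrow> Lpi p f < \<infinity> \<longrightarrow>
    diff_energy m \<alpha> p f (u + v) \<le> ennreal C * (diff_energy m \<alpha> p f u + diff_energy m \<alpha> p f v)"
proof -
  obtain C1 where C1: "C1 \<ge> 0" "\<And>f :: 'a \<Rightarrow> real. \<And>v. f \<in> borel_measurable borel \<Longrightarrow> Lpi p f < \<infinity> \<Longrightarrow>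
    diff_energy m \<alpha> p f v \<le> ennreal C1 * diff_energy (m + m) \<alpha> p f v"
    using diff_energy_Marchaud[OF p \<alpha>, where k=m and 'a='a] by blast
  obtain C2 where C2: "C2 \<ge> 0" "\<And>u v. \<And>f :: 'a \<Rightarrow> real. f \<in> borel_measurable borel \<Longrightarrow>
     Lpi p ((fdiff (u + v) ^^ (m + m)) f) \<le> ennreal C2 * (Lpi p ((fdiff u ^^ m) f) + Lpi p ((fdiff v ^^ m) f))"
    using fdiff_add_pow_bound[OF p, of m m, where 'a='a] by blast
  show ?thesis
  proof (intro exI[of _ "C1 * C2"] conjI allI impI)
    fix f :: "'a \<Rightarrow> real" and u v assume f [measurable]: "f \<in> borel_measurable borel" and fin: "Lpi p f < \<infinity>"
    have "diff_energy (m + m) \<alpha> p f (u + v) \<le>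
      (\<integral>\<^sup>+t. ennreal C2 * (ennreal (t powr (- \<alpha> - 1)) * diff_modulus m p f (t *\<^sub>R u) * indicator {0<..} t
        + ennreal (t powr (- \<alpha> - 1)) * diff_modulus m p f (t *\<^sub>R v) * indicator {0<..} t) \<partial>lborel)"
      unfolding diff_energy_def
    proof (rule nn_integral_mono)
      fix t
      have "ennreal (t powr (- \<alpha> - 1)) * diff_modulus (m + m) p f (t *\<^sub>R (u + v))
        \<le> ennreal (t powr (- \<alpha> - 1)) * (ennreal C2 * (diff_modulus m p f (t *\<^sub>R u) + diff_modulus m p f (t *\<^sub>R v)))"
        using C2(2)[OF f, of "t *\<^sub>R u" "t *\<^sub>R v"] by (intro mult_left_mono) (auto simp: diff_modulus_def scaleR_add_right)
      then show "ennreal (t powr (- \<alpha> - 1)) * diff_modulus (m + m) p f (t *\<^sub>R (u + v)) * indicator {0<..} t \<le>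
        ennreal C2 * (ennreal (t powr (- \<alpha> - 1)) * diff_modulus m p f (t *\<^sub>R u) * indicator {0<..} t
        + ennreal (t powr (- \<alpha> - 1)) * diff_modulus m p f (t *\<^sub>R v) * indicator {0<..} t)"
        by (auto simp: indicator_def distrib_left mult_ac)
    qed
    also have "\<dots> = ennreal C2 * (diff_energy m \<alpha> p f u + diff_energy m \<alpha> p f v)"
      unfolding diff_energy_def by (subst nn_integral_cmult) (auto simp: nn_integral_add)
    finally have "diff_energy m \<alpha> p f (u + v) \<le> ennreal C1 * (ennreal C2 * (diff_energy m \<alpha> p f u + diff_energy m \<alpha> p f v))"
      using C1(2)[OF f fin] mult_left_mono by (meson order_trans zero_le)
    then show "diff_energy m \<alpha> p f (u + v) \<le> ennreal (C1 * C2) * (diff_energy m \<alpha> p f u + diff_energy m \<alpha> p f v)"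
      using C1 C2 by (simp add: ennreal_mult mult.assoc)
  qed (use C1 C2 in simp)
qed

lemma diff_energy_scale:
  assumes [measurable]: "f \<in> borel_measurable borel" and "c > 0"
  shows "diff_energy m \<alpha> p f (c *\<^sub>R v) = ennreal (c powr \<alpha>) * diff_energy m \<alpha> p f v"
  using scaled_power_integral[where W="\<lambda>t. diff_modulus m p f (t *\<^sub>R v)" and c=c and a=0 and \<alpha>=\<alpha>] assms(2)
  by (simp add: diff_energy_def mult.commute)

lemma diff_energy_uminus:
  assumes "f \<in> borel_measurable borel"
  shows "diff_energy m \<alpha> p f (- v) = diff_energy m \<alpha> p f v"
  using fdiff_uminus_pow[OF assms] by (simp add: diff_energy_def diff_modulus_def)

text \<open>
  Two points \<open>\<eta>\<close> apart on a line in direction \<open>e\<close> differ by a multiple \<open>d e\<close> with \<open>\<bar>d\<bar> \<ge> \<eta>\<close>.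
\<close>

lemma diff_energy_line_interpolation:
  assumes f: "f \<in> borel_measurable borel" and \<alpha>: "\<alpha> > 0" and C: "C \<ge> 0"
    and sub: "\<And>u v. diff_energy m \<alpha> p f (u + v) \<le> ennreal C * (diff_energy m \<alpha> p f u + diff_energy m \<alpha> p f v)"
  shows "line_interpolation \<alpha> (2 * C) 1 (diff_energy m \<alpha> p f)"
  unfolding line_interpolation_def
proof (intro allI impI)
  let ?D = "diff_energy m \<alpha> p f"
  fix e x \<tau> \<eta> l
  assume e: "norm e = 1" and \<eta>: "(0::real) < \<eta>" and le: "\<forall>i\<le>1::nat. ?D (x + \<tau> i *\<^sub>R e) \<le> l"
    and sep: "\<forall>i\<le>1. \<forall>j\<le>1. i \<noteq> j \<longrightarrow> \<eta> \<le> \<bar>\<tau> i - \<tau> j\<bar>"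
  define d where "d = \<tau> 0 - \<tau> 1"
  have d: "\<eta> \<le> \<bar>d\<bar>" using sep by (auto simp: d_def)
  have abs: "?D (d *\<^sub>R e) = ?D (\<bar>d\<bar> *\<^sub>R e)"
    using diff_energy_uminus[OF f, of m \<alpha> p "d *\<^sub>R e"] by (cases "d \<ge> 0") auto
  have "ennreal (\<eta> powr \<alpha>) * ?D e \<le> ennreal (\<bar>d\<bar> powr \<alpha>) * ?D e"
    using d \<eta> \<alpha> by (intro mult_right_mono ennreal_leI powr_mono2) auto
  also have "\<dots> = ?D (d *\<^sub>R e)" unfolding abs using d \<eta> by (intro diff_energy_scale[symmetric] f) auto
  also have "d *\<^sub>R e = (x + \<tau> 0 *\<^sub>R e) + - (x + \<tau> 1 *\<^sub>R e)" by (simp add: d_def scaleR_diff_left)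
  also have "?D \<dots> \<le> ennreal C * (?D (x + \<tau> 0 *\<^sub>R e) + ?D (x + \<tau> 1 *\<^sub>R e))"
    using sub[of "x + \<tau> 0 *\<^sub>R e" "- (x + \<tau> 1 *\<^sub>R e)"] unfolding diff_energy_uminus[OF f] .
  also have "\<dots> \<le> ennreal C * (l + l)" using le by (intro mult_left_mono add_mono) auto
  also have "\<dots> = ennreal (2 * C) * l" using C by (simp add: mult_2[symmetric] ennreal_mult mult_ac)
  finally have "ennreal (\<eta> powr (- \<alpha>)) * (ennreal (\<eta> powr \<alpha>) * ?D e) \<le> ennreal (\<eta> powr (- \<alpha>)) * (ennreal (2 * C) * l)"
    by (rule mult_left_mono) simp
  moreover have "ennreal (\<eta> powr (- \<alpha>)) * (ennreal (\<eta> powr \<alpha>) * ?D e) = ?D e"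
    using \<eta> by (simp add: mult.assoc[symmetric] ennreal_mult[symmetric] powr_add[symmetric])
  ultimately show "?D e \<le> ennreal (2 * C * \<eta> powr (- \<alpha>)) * l"
    using C by (simp add: ennreal_mult mult_ac)
qed

section \<open>The fractional case\<close>

text \<open>
  For \<open>x\<close> in the ball all points \<open>x + j h\<close> with \<open>j \<ge> 1\<close> lie outside, so that only the term
  \<open>\<plusminus>f x\<close> of the difference survives.
\<close>

lemma fdiff_pow_disjoint_support:
  fixes f :: "'a::euclidean_space \<Rightarrow> real"
  assumes zero: "\<And>x. x \<notin> ball 0 R \<Longrightarrow> f x = 0" and h: "norm h \<ge> 2 * R" and x: "x \<in> ball 0 R"
  shows "\<bar>(fdiff h ^^ m) f x\<bar> = \<bar>f x\<bar>"
proof -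
  have "(\<forall>j\<ge>1. (fdiff h ^^ m) f (x + real j *\<^sub>R h) = 0) \<and> \<bar>(fdiff h ^^ m) f x\<bar> = \<bar>f x\<bar>"
  proof (induction m)
    case 0
    have "f (x + real j *\<^sub>R h) = 0" if j: "j \<ge> 1" for j :: nat
    proof (rule zero)
      have R: "R > 0" using x by (auto intro: le_less_trans[OF norm_ge_zero])
      have "1 * (2 * R) \<le> real j * norm h" using j h R by (intro mult_mono) auto
      then have "2 * R \<le> norm (real j *\<^sub>R h)" by simp
      moreover have "norm (real j *\<^sub>R h) \<le> norm (x + real j *\<^sub>R h) + norm x"
        using norm_triangle_ineq4[of "x + real j *\<^sub>R h" x] by simp
      ultimately show "x + real j *\<^sub>R h \<notin> ball 0 R" using x by auto
    qed
    then show ?case by simp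
  next
    case (Suc m)
    define g where "g = (fdiff h ^^ m) f"
    have g: "g (x + real j *\<^sub>R h) = 0" if "j \<ge> 1" for j using Suc that by (simp add: g_def)
    have "fdiff h g (x + real j *\<^sub>R h) = 0" if "j \<ge> 1" for j :: nat
    proof -
      have e: "x + real j *\<^sub>R h + h = x + real (Suc j) *\<^sub>R h" by (simp add: scaleR_add_left algebra_simps)
      show ?thesis unfolding fdiff_def e using g[OF that] g[of "Suc j"] by simp
    qed
    moreover have "\<bar>g x\<bar> = \<bar>f x\<bar>" using Suc by (simp add: g_def)
    then have "\<bar>fdiff h g x\<bar> = \<bar>f x\<bar>" using g[of 1] by (simp add: fdiff_def)
    ultimately show ?case by (simp add: g_def)
  qed
  then show ?thesis by simp
qed

lemma Lpi_le_diff_modulus: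
  fixes f :: "'a::euclidean_space \<Rightarrow> real"
  assumes zero: "\<And>x. x \<notin> ball 0 R \<Longrightarrow> f x = 0" and h: "norm h \<ge> 2 * R" and p: "p \<ge> 1"
  shows "Lpi p f \<le> diff_modulus m p f h"
  unfolding diff_modulus_def
proof (rule Lpi_mono[OF _ p])
  fix x show "\<bar>f x\<bar> \<le> \<bar>(fdiff h ^^ m) f x\<bar>"
    using fdiff_pow_disjoint_support[OF zero h, where x=x and m=m] zero[of x] by (cases "x \<in> ball 0 R") auto
qed

lemma Lpi_le_diff_energy:
  fixes f :: "'a::euclidean_space \<Rightarrow> real"
  assumes zero: "\<And>x. x \<notin> ball 0 R \<Longrightarrow> f x = 0" and \<xi>: "norm \<xi> = 1" and p: "p \<ge> 1" and R: "R > 0" and \<alpha>: "\<alpha> > 0"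
  shows "ennreal ((2 * R) powr (- \<alpha>) / \<alpha>) * Lpi p f \<le> diff_energy m \<alpha> p f \<xi>"
proof -
  have "ennreal ((2 * R) powr (- \<alpha>) / \<alpha>) * Lpi p f = (\<integral>\<^sup>+t. ennreal (t powr (- \<alpha> - 1)) * indicator {2 * R<..} t * Lpi p f \<partial>lborel)"
    using power_tail_integral[of "2 * R" \<alpha>] R \<alpha> by (subst nn_integral_multc) auto
  also have "\<dots> \<le> diff_energy m \<alpha> p f \<xi>"
    unfolding diff_energy_def
  proof (rule nn_integral_mono)
    fix t
    show "ennreal (t powr (- \<alpha> - 1)) * indicator {2 * R<..} t * Lpi p f \<le>
      ennreal (t powr (- \<alpha> - 1)) * diff_modulus m p f (t *\<^sub>R \<xi>) * indicator {0<..} t"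
    proof (cases "t > 2 * R")
      case True
      then have "Lpi p f \<le> diff_modulus m p f (t *\<^sub>R \<xi>)"
        using R \<xi> by (intro Lpi_le_diff_modulus[OF zero _ p]) auto
      then show ?thesis using True R by (auto intro: mult_left_mono)
    qed simp
  qed
  finally show ?thesis .
qed

lemma nn_integral_lborel_scale:
  fixes F :: "'a::euclidean_space \<Rightarrow> ennreal"
  assumes [measurable]: "F \<in> borel_measurable borel" and t: "t > 0"
  shows "(\<integral>\<^sup>+h. F h \<partial>lborel) = ennreal (t ^ DIM('a)) * (\<integral>\<^sup>+k. F (t *\<^sub>R k) \<partial>lborel)"
proof -
  have "(\<integral>\<^sup>+h. F h \<partial>lborel) = (\<integral>\<^sup>+h. F h \<partial>(density (distr lborel borel (\<lambda>x. 0 + t *\<^sub>R x)) (\<lambda>_. ennreal (\<bar>t\<bar>^DIM('a)))))"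
    using lborel_affine[of t "0::'a"] t by simp
  also have "\<dots> = (\<integral>\<^sup>+k. ennreal (t ^ DIM('a)) * F (t *\<^sub>R k) \<partial>lborel)"
    using t by (subst nn_integral_density) (auto simp: nn_integral_distr)
  finally show ?thesis by (simp add: nn_integral_cmult)
qed

text \<open>
  Integration in polar coordinates up to constants, without a surface measure: averaging over dilations
  \<open>t\<close> with respect to \<open>dt/t\<close> turns the integral over all \<open>h\<close> into an integral over the shell
  \<open>1 \<le> norm k \<le> 2\<close> of the integrals along rays.
\<close>

lemma radial_integral_le:
  fixes W :: "'a::euclidean_space \<Rightarrow> ennreal"
  assumes [measurable]: "W \<in> borel_measurable borel" and \<alpha>: "\<alpha> > 0"
    and M: "\<And>k. k \<noteq> 0 \<Longrightarrow> (\<integral>\<^sup>+t\<in>{0<..}. ennreal (t powr (- \<alpha> - 1)) * W (t *\<^sub>R k) \<partial>lborel) \<le> ennreal (norm k powr \<alpha>) * M"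
  shows "(\<integral>\<^sup>+h. W h * ennreal (norm h powr (- (\<alpha> + DIM('a)))) \<partial>lborel) \<le> ennreal (2 * (unit_ball_vol DIM('a) * 2 ^ DIM('a))) * M"
proof -
  let ?N = "DIM('a)"
  define F where "F h = W h * ennreal (norm h powr (- (\<alpha> + ?N)))" for h
  have [measurable]: "F \<in> borel_measurable borel" unfolding F_def by measurable
  \<comment> \<open>For fixed \<open>h\<close> the section of \<open>S\<close> has \<open>dt/t\<close>-measure \<open>ln 2\<close>; the bound below by \<open>1/2\<close> is all that is used.\<close>
  define S where "S = {(h::'a, t::real). 0 < t \<and> t \<le> norm h \<and> norm h \<le> 2 * t}"
  have [measurable]: "S \<in> sets (borel \<Otimes>\<^sub>M borel)"
  proof -
    have "S = {x \<in> space (borel \<Otimes>\<^sub>M borel). 0 < snd x \<and> snd x \<le> norm (fst x) \<and> norm (fst x) \<le> 2 * snd x}"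
      by (auto simp: S_def space_pair_measure)
    also have "\<dots> \<in> sets (borel \<Otimes>\<^sub>M borel)" by measurable
    finally show ?thesis .
  qed
  have "(\<integral>\<^sup>+h. F h \<partial>lborel) \<le> (\<integral>\<^sup>+h. 2 * (\<integral>\<^sup>+t. F h * (ennreal (1 / t) * indicator S (h, t)) \<partial>lborel) \<partial>lborel)"
  proof (rule nn_integral_mono_AE, rule AE_I[where N="{0}"])
    show "{h \<in> space lborel. \<not> F h \<le> 2 * (\<integral>\<^sup>+t. F h * (ennreal (1 / t) * indicator S (h, t)) \<partial>lborel)} \<subseteq> {0}"
    proof safe
      fix h :: 'a assume neg: "\<not> F h \<le> 2 * (\<integral>\<^sup>+t. F h * (ennreal (1 / t) * indicator S (h, t)) \<partial>lborel)"
      show "h = 0"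
      proof (rule ccontr)
        assume h: "h \<noteq> 0"
        define r where "r = norm h"
        have r: "r > 0" using h by (simp add: r_def)
        have "1 = 2 * (ennreal (1 / r) * ennreal (r - r / 2))"
        proof -
          have "1 / r * (r - r / 2) = 1 / 2" using r by (simp add: field_simps)
          then have "ennreal (1 / r) * ennreal (r - r / 2) = ennreal (1 / 2)"
            using r by (subst ennreal_mult[symmetric]) auto
          moreover have "ennreal 2 * ennreal (1 / 2) = ennreal 1" by (subst ennreal_mult[symmetric]) auto
          ultimately show ?thesis by simp
        qed
        also have "ennreal (1 / r) * ennreal (r - r / 2) = (\<integral>\<^sup>+t. ennreal (1 / r) * indicator {r/2..r} t \<partial>lborel)"
          using r by (subst nn_integral_cmult_indicator) auto
        also have "\<dots> \<le> (\<integral>\<^sup>+t. ennreal (1 / t) * indicator S (h, t) \<partial>lborel)"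
          using r by (intro nn_integral_mono) (auto simp: indicator_def S_def r_def[symmetric] intro!: ennreal_leI divide_left_mono)
        finally have "1 \<le> 2 * (\<integral>\<^sup>+t. ennreal (1 / t) * indicator S (h, t) \<partial>lborel)" by (simp add: mult_left_mono)
        then have "F h * 1 \<le> F h * (2 * (\<integral>\<^sup>+t. ennreal (1 / t) * indicator S (h, t) \<partial>lborel))" by (rule mult_left_mono) simp
        also have "\<dots> = 2 * (F h * (\<integral>\<^sup>+t. ennreal (1 / t) * indicator S (h, t) \<partial>lborel))" by (simp add: mult_ac)
        also have "\<dots> = 2 * (\<integral>\<^sup>+t. F h * (ennreal (1 / t) * indicator S (h, t)) \<partial>lborel)"
          by (subst nn_integral_cmult) auto
        finally show False using neg by simp
      qed
    qed
  qed auto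
  also have "\<dots> = 2 * (\<integral>\<^sup>+h. (\<integral>\<^sup>+t. F h * (ennreal (1 / t) * indicator S (h, t)) \<partial>lborel) \<partial>lborel)"
    by (rule nn_integral_cmult) measurable
  also have "(\<integral>\<^sup>+h. (\<integral>\<^sup>+t. F h * (ennreal (1 / t) * indicator S (h, t)) \<partial>lborel) \<partial>lborel) =
     (\<integral>\<^sup>+t. (\<integral>\<^sup>+h. F h * (ennreal (1 / t) * indicator S (h, t)) \<partial>lborel) \<partial>lborel)"
    by (rule lborel_pair.Fubini'[symmetric]) measurable
  also have "\<dots> = (\<integral>\<^sup>+t. (\<integral>\<^sup>+k. (ennreal (norm k powr (- (\<alpha> + ?N))) * indicator {k. 1 \<le> norm k \<and> norm k \<le> 2} k) * (ennreal (t powr (- \<alpha> - 1)) * W (t *\<^sub>R k) * indicator {0<..} t) \<partial>lborel) \<partial>lborel)"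
  proof (rule nn_integral_cong)
    fix t :: real
    show "(\<integral>\<^sup>+h. F h * (ennreal (1 / t) * indicator S (h, t)) \<partial>lborel) =
      (\<integral>\<^sup>+k. (ennreal (norm k powr (- (\<alpha> + ?N))) * indicator {k. 1 \<le> norm k \<and> norm k \<le> 2} k) * (ennreal (t powr (- \<alpha> - 1)) * W (t *\<^sub>R k) * indicator {0<..} t) \<partial>lborel)"
    proof (cases "t > 0")
      case t: True
      have [measurable]: "(\<lambda>h. indicator S (h, t) :: ennreal) \<in> borel_measurable borel" by measurable
      have "(\<integral>\<^sup>+h. F h * (ennreal (1 / t) * indicator S (h, t)) \<partial>lborel) =
        ennreal (t ^ ?N) * (\<integral>\<^sup>+k. F (t *\<^sub>R k) * (ennreal (1 / t) * indicator S (t *\<^sub>R k, t)) \<partial>lborel)"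
        by (rule nn_integral_lborel_scale) (use t in auto)
      also have "\<dots> = (\<integral>\<^sup>+k. ennreal (t ^ ?N) * (F (t *\<^sub>R k) * (ennreal (1 / t) * indicator S (t *\<^sub>R k, t))) \<partial>lborel)"
        by (rule nn_integral_cmult[symmetric]) measurable
      also have "\<dots> = (\<integral>\<^sup>+k. (ennreal (norm k powr (- (\<alpha> + ?N))) * indicator {k. 1 \<le> norm k \<and> norm k \<le> 2} k) * (ennreal (t powr (- \<alpha> - 1)) * W (t *\<^sub>R k) * indicator {0<..} t) \<partial>lborel)"
      proof (rule nn_integral_cong)
        fix k :: 'a
        have ind: "indicator S (t *\<^sub>R k, t) = (indicator {k. 1 \<le> norm k \<and> norm k \<le> 2} k :: ennreal)"
          using t by (auto simp: S_def indicator_def)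
        have "t ^ ?N * (t powr (- (\<alpha> + ?N)) * (1 / t)) = t powr real ?N * (t powr (- (\<alpha> + ?N)) * t powr (- 1))"
          using t by (simp add: powr_realpow powr_minus_divide)
        also have "\<dots> = t powr (- \<alpha> - 1)" by (simp only: powr_add[symmetric]) simp
        finally have tt: "t ^ ?N * (t powr (- (\<alpha> + ?N)) * (1 / t)) = t powr (- \<alpha> - 1)" .
        have "ennreal (t ^ ?N) * (F (t *\<^sub>R k) * (ennreal (1 / t) * indicator S (t *\<^sub>R k, t))) =
           ennreal (t ^ ?N * (t powr (- (\<alpha> + ?N)) * (1 / t))) * (W (t *\<^sub>R k) * ennreal (norm k powr (- (\<alpha> + ?N))) * indicator {k. 1 \<le> norm k \<and> norm k \<le> 2} k)"
        proof -
          define a b c where "a = t ^ ?N" and "b = t powr (- (\<alpha> + ?N))" and "c = 1 / t"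
          have abc: "a \<ge> 0" "b \<ge> 0" "c \<ge> 0" using t by (simp_all add: a_def b_def c_def)
          have "F (t *\<^sub>R k) = W (t *\<^sub>R k) * (ennreal b * ennreal (norm k powr (- (\<alpha> + ?N))))"
            using t abc by (simp add: F_def b_def powr_mult ennreal_mult del: minus_add_distrib)
          then show ?thesis
            unfolding ind a_def[symmetric] b_def[symmetric] c_def[symmetric] using abc
            by (simp add: ennreal_mult mult_ac)
        qed
        then show "ennreal (t ^ ?N) * (F (t *\<^sub>R k) * (ennreal (1 / t) * indicator S (t *\<^sub>R k, t))) =
          (ennreal (norm k powr (- (\<alpha> + ?N))) * indicator {k. 1 \<le> norm k \<and> norm k \<le> 2} k) * (ennreal (t powr (- \<alpha> - 1)) * W (t *\<^sub>R k) * indicator {0<..} t)"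
          unfolding tt using t by (simp add: mult_ac)
      qed
      finally show ?thesis .
    next
      case False
      then show ?thesis by (simp add: S_def)
    qed
  qed
  also have "\<dots> = (\<integral>\<^sup>+k. (\<integral>\<^sup>+t. (ennreal (norm k powr (- (\<alpha> + ?N))) * indicator {k. 1 \<le> norm k \<and> norm k \<le> 2} k) * (ennreal (t powr (- \<alpha> - 1)) * W (t *\<^sub>R k) * indicator {0<..} t) \<partial>lborel) \<partial>lborel)"
    by (rule lborel_pair.Fubini') measurable
  also have "\<dots> \<le> (\<integral>\<^sup>+k. M * indicator (cball (0::'a) 2) k \<partial>lborel)"
  proof (rule nn_integral_mono)
    fix k :: 'a
    show "(\<integral>\<^sup>+t. (ennreal (norm k powr (- (\<alpha> + ?N))) * indicator {k. 1 \<le> norm k \<and> norm k \<le> 2} k) * (ennreal (t powr (- \<alpha> - 1)) * W (t *\<^sub>R k) * indicator {0<..} t) \<partial>lborel) \<le> M * indicator (cball 0 2) k"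
    proof (cases "1 \<le> norm k \<and> norm k \<le> 2")
      case True
      then have k0: "k \<noteq> 0" by auto
      have "(\<integral>\<^sup>+t. (ennreal (norm k powr (- (\<alpha> + ?N))) * indicator {k. 1 \<le> norm k \<and> norm k \<le> 2} k) * (ennreal (t powr (- \<alpha> - 1)) * W (t *\<^sub>R k) * indicator {0<..} t) \<partial>lborel)
        = ennreal (norm k powr (- (\<alpha> + ?N))) * (\<integral>\<^sup>+t\<in>{0<..}. ennreal (t powr (- \<alpha> - 1)) * W (t *\<^sub>R k) \<partial>lborel)"
        using True by (subst nn_integral_cmult) auto
      also have "\<dots> \<le> ennreal (norm k powr (- (\<alpha> + ?N))) * (ennreal (norm k powr \<alpha>) * M)"
        by (intro mult_left_mono M k0) auto
      also have "\<dots> = ennreal (norm k powr (- real ?N)) * M"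
        using k0 by (simp add: mult.assoc[symmetric] ennreal_mult[symmetric] powr_add[symmetric])
      also have "\<dots> \<le> 1 * M"
      proof (rule mult_right_mono)
        have "norm k powr (- real ?N) \<le> 1 powr (- real ?N)" using True by (intro powr_mono2') auto
        then show "ennreal (norm k powr (- real ?N)) \<le> 1" by (simp add: ennreal_leI)
      qed simp
      finally show ?thesis using True by simp
    qed simp
  qed
  also have "\<dots> = M * ennreal (unit_ball_vol ?N * 2 ^ ?N)"
    by (subst nn_integral_cmult_indicator) (auto simp: emeasure_cball)
  finally have "(\<integral>\<^sup>+h. F h \<partial>lborel) \<le> 2 * (M * ennreal (unit_ball_vol ?N * 2 ^ ?N))" by (simp add: mult_left_mono)
  also have "\<dots> = ennreal (2 * (unit_ball_vol ?N * 2 ^ ?N)) * M" by (simp add: ennreal_mult mult_ac)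
  finally show ?thesis by (simp add: F_def)
qed

lemma AE_lborel_shift:
  assumes "AE x in lborel. P (x :: 'a::euclidean_space)"
  shows "AE x in lborel. P (x + h)"
proof -
  obtain N where N: "{x \<in> space lborel. \<not> P x} \<subseteq> N" "emeasure lborel N = 0" "N \<in> sets lborel"
    using assms by (rule AE_E)
  have [measurable]: "N \<in> sets borel" using N(3) by simp
  show ?thesis
  proof (rule AE_I[where N="{x. x + h \<in> N}"])
    show "{x \<in> space lborel. \<not> P (x + h)} \<subseteq> {x. x + h \<in> N}" using N(1) by auto
    show "emeasure lborel {x. x + h \<in> N} = 0" using N by (simp add: emeasure_lborel_translate)
    show "{x. x + h \<in> N} \<in> sets lborel" by measurable
  qed
qed

lemma fdiff_pow_cong_AE:
  assumes "AE x in lborel. f x = g x"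
  shows "AE x in lborel. (fdiff h ^^ m) f x = (fdiff h ^^ m) (g :: 'a::euclidean_space \<Rightarrow> real) x"
proof (induction m)
  case (Suc m)
  from AE_lborel_shift[OF Suc, of h] Suc show ?case
    by eventually_elim (simp add: fdiff_def)
qed (use assms in simp)

lemma borel_representative:
  fixes f :: "'a::euclidean_space \<Rightarrow> real"
  assumes f: "f \<in> borel_measurable lebesgue" and zero: "AE x in lebesgue. x \<notin> ball 0 R \<longrightarrow> f x = 0"
  obtains g where "g \<in> borel_measurable borel" "\<And>x. x \<notin> ball 0 R \<Longrightarrow> g x = 0" "AE x in lborel. f x = g x"
proof -
  from completion_ex_borel_measurable_real[OF f] obtain f' where f': "f' \<in> borel_measurable borel" "AE x in lborel. f x = f' x"
    by auto
  have zero': "AE x in lborel. x \<notin> ball 0 R \<longrightarrow> f x = 0" using zero by (simp add: AE_completion_iff)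
  define g where "g x = f' x * indicator (ball 0 R) x" for x
  show ?thesis
  proof (rule that[of g])
    show "g \<in> borel_measurable borel" unfolding g_def using f'(1) by (intro borel_measurable_times borel_measurable_indicator) auto
    show "g x = 0" if "x \<notin> ball 0 R" for x using that by (simp add: g_def)
    show "AE x in lborel. f x = g x" using f'(2) zero' by eventually_elim (auto simp: g_def)
  qed
qed

lemma sobolev_space_finite:
  assumes f: "f \<in> sobolev_space s p" and p: "p \<ge> 1"
  shows "Lp_integral p f < \<infinity>" "sobolev_energy s p f < \<infinity>"
proof -
  have "epowr (Lp_integral p f) (1 / p) < \<infinity>" "epowr (sobolev_energy s p f) (1 / p) < \<infinity>"
    using f by (auto simp: sobolev_space_def Lp_space_def Lp_norm_def hom_sobolev_space_def sobolev_seminorm_def)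
  moreover have "1 / p > 0" using p by simp
  ultimately show "Lp_integral p f < \<infinity>" "sobolev_energy s p f < \<infinity>"
    by (auto simp: epowr_def less_top split: if_splits)
qed

lemma fractional_affine_inequality:
  fixes s p R :: real
  assumes N: "DIM('a::euclidean_space) \<ge> 2" and s: "s > 0" "s \<notin> \<int>" and p: "1 \<le> p" and R: "R > 0"
  shows "\<exists>K::real. \<forall>f :: 'a \<Rightarrow> real.
           f \<in> sobolev_space s p \<and> (AE x in lebesgue. x \<notin> ball 0 R \<longrightarrow> f x = 0) \<longrightarrow>
           epowr (Lp_norm p f) (1 - 1 / real DIM('a)) *
             epowr (sobolev_seminorm s p f) (1 / real DIM('a))
           \<le> ennreal K * affine_energy s p f"
proof -
  define m where "m = nat \<lfloor>s\<rfloor> + 1"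
  define \<alpha> where "\<alpha> = s * p"
  have \<alpha>: "\<alpha> > 0" "\<alpha> < real m * p"
  proof -
    have "s < real m" using s by (simp add: m_def) linarith
    then show "\<alpha> < real m * p" using p by (simp add: \<alpha>_def)
    show "\<alpha> > 0" using s p by (simp add: \<alpha>_def)
  qed
  obtain C where C: "C \<ge> 0" "\<And>f :: 'a \<Rightarrow> real. \<And>u v. f \<in> borel_measurable borel \<Longrightarrow> Lpi p f < \<infinity> \<Longrightarrow>
    diff_energy m \<alpha> p f (u + v) \<le> ennreal C * (diff_energy m \<alpha> p f u + diff_energy m \<alpha> p f v)"
    using diff_energy_subadditive[OF p \<alpha>, where 'a='a] by blast
  define C3 where "C3 = 2 * (unit_ball_vol DIM('a) * 2 ^ DIM('a))"
  define c0 where "c0 = (2 * R) powr (- \<alpha>) / \<alpha>"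
  note fin = sobolev_space_finite[where s=s, OF _ p]
  show ?thesis
  proof (rule affine_inequality_criterion[OF N s(1) p])
    show "c0 > 0" using R \<alpha> by (simp add: c0_def)
    show "2 * C \<ge> 0" "C3 \<ge> 0" using C by (simp_all add: C3_def)
    fix f :: "'a \<Rightarrow> real"
    assume f: "f \<in> sobolev_space s p \<and> (AE x in lebesgue. x \<notin> ball 0 R \<longrightarrow> f x = 0)"
    show "Lp_integral p f < \<infinity>" "sobolev_energy s p f < \<infinity>" using f fin by auto
    have fm: "f \<in> borel_measurable lebesgue" using f by (simp add: sobolev_space_def Lp_space_def)
    obtain g where g: "g \<in> borel_measurable borel" "\<And>x. x \<notin> ball 0 R \<Longrightarrow> g x = 0" "AE x in lborel. f x = g x"
      using borel_representative[OF fm conjunct2[OF f]] by blast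
    have mod: "Lp_integral p ((fdiff h ^^ m) f) = diff_modulus m p g h" for h
      unfolding Lp_integral_eq_Lpi diff_modulus_def by (intro Lpi_cong_AE fdiff_pow_cong_AE g)
    have L: "Lp_integral p f = Lpi p g" unfolding Lp_integral_eq_Lpi by (intro Lpi_cong_AE g)
    have gfin: "Lpi p g < \<infinity>" using fin(1)[of f] f L by simp
    let ?D = "diff_energy m \<alpha> p g"
    have Q: "sobolev_energy s p f \<le> ennreal C3 * M" if M: "\<forall>e. norm e = 1 \<longrightarrow> ?D e \<le> M" for M
    proof -
      have "sobolev_energy s p f = (\<integral>\<^sup>+h. diff_modulus m p g h / ennreal (norm h powr (\<alpha> + DIM('a))) \<partial>lborel)"
        using s(2) unfolding sobolev_energy_def m_def[symmetric] mod \<alpha>_def[symmetric] by (simp add: nn_integral_completion)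
      also have "\<dots> = (\<integral>\<^sup>+h. diff_modulus m p g h * ennreal (norm h powr (- (\<alpha> + DIM('a)))) \<partial>lborel)"
      proof (rule nn_integral_cong_AE, rule AE_I[where N="{0}"])
        show "{h \<in> space lborel. diff_modulus m p g h / ennreal (norm h powr (\<alpha> + DIM('a))) \<noteq> diff_modulus m p g h * ennreal (norm h powr (- (\<alpha> + DIM('a))))} \<subseteq> {0}"
        proof safe
          fix h :: 'a assume neq: "diff_modulus m p g h / ennreal (norm h powr (\<alpha> + DIM('a))) \<noteq> diff_modulus m p g h * ennreal (norm h powr (- (\<alpha> + DIM('a))))"
          show "h = 0"
          proof (rule ccontr)
            assume "h \<noteq> 0"
            then have "inverse (ennreal (norm h powr (\<alpha> + DIM('a)))) = ennreal (norm h powr (- (\<alpha> + DIM('a))))"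
              by (subst inverse_ennreal) (auto simp only: powr_minus powr_gt_zero norm_eq_zero not_False_eq_True)
            then show False using neq by (simp add: divide_ennreal_def)
          qed
        qed
      qed auto
      also have "\<dots> \<le> ennreal C3 * M"
        unfolding C3_def
      proof (rule radial_integral_le)
        show "diff_modulus m p g \<in> borel_measurable borel" using g(1) by measurable
        fix k :: 'a assume k: "k \<noteq> 0"
        have "?D k = ?D (norm k *\<^sub>R (k /\<^sub>R norm k))" using k by simp
        also have "\<dots> = ennreal (norm k powr \<alpha>) * ?D (k /\<^sub>R norm k)" using k by (intro diff_energy_scale g) auto
        also have "\<dots> \<le> ennreal (norm k powr \<alpha>) * M" using k M by (intro mult_left_mono) auto
        finally show "(\<integral>\<^sup>+t\<in>{0<..}. ennreal (t powr (- \<alpha> - 1)) * diff_modulus m p g (t *\<^sub>R k) \<partial>lborel) \<le> ennreal (norm k powr \<alpha>) * M"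
          by (simp add: diff_energy_def)
      qed fact
      finally show ?thesis .
    qed
    show "\<exists>D. D \<in> borel_measurable borel \<and> (\<forall>\<xi>. norm \<xi> = 1 \<longrightarrow> directional_energy s p f \<xi> = D \<xi>) \<and>
       (\<forall>c x. c > 0 \<longrightarrow> D (c *\<^sub>R x) = ennreal (c powr (s * p)) * D x) \<and>
       line_interpolation (s * p) (2 * C) 1 D \<and>
       (\<forall>\<xi>. norm \<xi> = 1 \<longrightarrow> ennreal c0 * Lp_integral p f \<le> D \<xi>) \<and>
       (\<forall>M. (\<forall>e. norm e = 1 \<longrightarrow> D e \<le> M) \<longrightarrow> sobolev_energy s p f \<le> ennreal C3 * M)"
    proof (intro exI[of _ ?D] conjI allI impI)
      show "?D \<in> borel_measurable borel" using g(1) by (rule diff_energy_measurable)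
      show "directional_energy s p f \<xi> = ?D \<xi>" for \<xi>
        using s(2) unfolding directional_energy_def m_def[symmetric] mod diff_energy_def \<alpha>_def
        by (simp add: nn_integral_completion)
      show "?D (c *\<^sub>R x) = ennreal (c powr (s * p)) * ?D x" if "c > 0" for c x
        using diff_energy_scale[OF g(1) that] by (simp add: \<alpha>_def)
      show "line_interpolation (s * p) (2 * C) 1 ?D"
        unfolding \<alpha>_def[symmetric] by (rule diff_energy_line_interpolation[OF g(1) \<alpha>(1) C(1) C(2)[OF g(1) gfin]])
      show "ennreal c0 * Lp_integral p f \<le> ?D \<xi>" if "norm \<xi> = 1" for \<xi>
        unfolding L c0_def by (rule Lpi_le_diff_energy[OF g(2) that p R \<alpha>(1)])
      show "sobolev_energy s p f \<le> ennreal C3 * M" if "\<forall>e. norm e = 1 \<longrightarrow> ?D e \<le> M" for M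
        using that by (rule Q)
    qed
  qed
qed

section \<open>Smooth bump functions of product form\<close>

text \<open>
  For \<open>p = 1\<close> this is the standard smooth function that is flat at 0; the factor \<open>p (1/x)\<close> makes the
  family closed under differentiation.
\<close>

definition flat_exp :: "real poly \<Rightarrow> real \<Rightarrow> real" where
  "flat_exp p x = (if x > 0 then poly p (1 / x) * exp (- (1 / x)) else 0)"

lemma poly_times_exp_bounded: "\<exists>C\<ge>0. \<forall>y\<ge>0. \<bar>poly q y\<bar> * exp (- y) \<le> (C::real)"
proof (intro exI[of _ "\<Sum>i\<le>degree q. \<bar>coeff q i\<bar> * fact i"] conjI allI impI)
  fix y :: real assume y: "y \<ge> 0"
  have pw: "y ^ i * exp (- y) \<le> fact i" for i
  proof -
    have "(\<Sum>n\<in>{i}. y ^ n /\<^sub>R fact n) \<le> exp y"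
      unfolding exp_def using y summable_exp_generic[of y] by (intro sum_le_suminf) auto
    then show ?thesis by (simp add: exp_minus field_simps)
  qed
  have "\<bar>poly q y\<bar> * exp (- y) \<le> (\<Sum>i\<le>degree q. \<bar>coeff q i * y ^ i\<bar>) * exp (- y)"
    unfolding poly_altdef by (intro mult_right_mono sum_abs) auto
  also have "\<dots> = (\<Sum>i\<le>degree q. \<bar>coeff q i\<bar> * (y ^ i * exp (- y)))"
    using y by (simp add: sum_distrib_right abs_mult mult.assoc)
  also have "\<dots> \<le> (\<Sum>i\<le>degree q. \<bar>coeff q i\<bar> * fact i)"
    by (intro sum_mono mult_left_mono pw) auto
  finally show "\<bar>poly q y\<bar> * exp (- y) \<le> (\<Sum>i\<le>degree q. \<bar>coeff q i\<bar> * fact i)" .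
qed (auto intro!: sum_nonneg)

text \<open>
  At 0 the derivative vanishes because \<open>p (1/x) exp (-1/x)\<close> is bounded by a multiple of \<open>x\<^sup>2\<close>.
\<close>

lemma flat_exp_has_derivative:
  "(flat_exp p has_real_derivative flat_exp ([:0, 0, 1:] * (p - pderiv p)) x) (at x)"
proof -
  consider "x > 0" | "x < 0" | "x = 0" by linarith
  then show ?thesis
  proof cases
    case 1
    have "((\<lambda>x. poly p (1 / x) * exp (- (1 / x))) has_real_derivative
       poly p (1 / x) * (exp (- (1 / x)) * (1 / x ^ 2)) + poly (pderiv p) (1 / x) * (- 1 / x ^ 2) * exp (- (1 / x))) (at x)"
    proof (rule DERIV_cong, rule DERIV_mult)
      have inv: "((\<lambda>x. 1 / x) has_real_derivative (- 1 / x ^ 2)) (at x)"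
        using 1 by (auto intro!: derivative_eq_intros simp: power2_eq_square)
      show "((\<lambda>x. poly p (1 / x)) has_real_derivative poly (pderiv p) (1 / x) * (- 1 / x ^ 2)) (at x)"
        by (rule DERIV_chain2[OF poly_DERIV inv])
      have "((\<lambda>x. - (1 / x)) has_real_derivative - (- 1 / x ^ 2)) (at x)"
        by (rule DERIV_minus[OF inv])
      then show "((\<lambda>x. exp (- (1 / x))) has_real_derivative exp (- (1 / x)) * (1 / x ^ 2)) (at x)"
        by (auto intro: DERIV_chain2[OF DERIV_exp, THEN DERIV_cong])
    qed (simp add: algebra_simps)
    then have "((\<lambda>x. poly p (1 / x) * exp (- (1 / x))) has_real_derivative flat_exp ([:0, 0, 1:] * (p - pderiv p)) x) (at x)"
      by (rule DERIV_cong) (use 1 in \<open>simp add: flat_exp_def field_simps power2_eq_square\<close>)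
    then show ?thesis
      by (rule has_field_derivative_transform_within_open[of _ _ _ "{0<..}"]) (use 1 in \<open>auto simp: flat_exp_def\<close>)
  next
    case 2
    have "((\<lambda>x. 0) has_real_derivative flat_exp ([:0, 0, 1:] * (p - pderiv p)) x) (at x)"
      using 2 by (simp add: flat_exp_def)
    then show ?thesis
      by (rule has_field_derivative_transform_within_open[of _ _ _ "{..<0}"]) (use 2 in \<open>auto simp: flat_exp_def\<close>)
  next
    case 3
    obtain C where C: "C \<ge> 0" "\<And>y. y \<ge> 0 \<Longrightarrow> \<bar>poly ([:0, 0, 1:] * p) y\<bar> * exp (- y) \<le> C"
      using poly_times_exp_bounded by blast
    have bound: "\<bar>flat_exp p h / h\<bar> \<le> C * \<bar>h\<bar>" for h
    proof (cases "h > 0")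
      case True
      have "\<bar>flat_exp p h\<bar> = h\<^sup>2 * (\<bar>poly ([:0, 0, 1:] * p) (1 / h)\<bar> * exp (- (1 / h)))"
        using True by (simp add: flat_exp_def abs_mult power2_eq_square)
      also have "\<dots> \<le> h\<^sup>2 * C" using True by (intro mult_left_mono C) auto
      finally show ?thesis using True by (simp add: abs_divide divide_le_eq power2_eq_square mult_ac)
    next
      case False
      have "flat_exp p h = 0" using False by (simp add: flat_exp_def)
      moreover have "0 \<le> C * \<bar>h\<bar>" using C(1) by (rule mult_nonneg_nonneg) simp
      ultimately show ?thesis by simp
    qed
    have "((\<lambda>h. flat_exp p h / h) \<longlongrightarrow> 0) (at 0)"
    proof (rule Lim_null_comparison)
      show "\<forall>\<^sub>F h in at 0. norm (flat_exp p h / h) \<le> C * \<bar>h\<bar>" using bound by simp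
      have "((\<lambda>h. C * \<bar>h\<bar>) \<longlongrightarrow> C * \<bar>0\<bar>) (at (0::real))" by (intro tendsto_intros)
      then show "((\<lambda>h. C * \<bar>h\<bar>) \<longlongrightarrow> 0) (at (0::real))" by simp
    qed
    then show ?thesis using 3 by (simp add: has_field_derivative_iff flat_exp_def)
  qed
qed

text \<open>
  Just enough functions to build bumps. Each member has a derivative in the class, which makes all its
  iterated derivatives exist without a Leibniz formula of higher order.
\<close>

inductive_set smooth_functions :: "(real \<Rightarrow> real) set" where
  base: "(\<lambda>x. flat_exp p (c * x + d)) \<in> smooth_functions"
| add: "u \<in> smooth_functions \<Longrightarrow> v \<in> smooth_functions \<Longrightarrow> (\<lambda>x. u x + v x) \<in> smooth_functions"
| mult: "u \<in> smooth_functions \<Longrightarrow> v \<in> smooth_functions \<Longrightarrow> (\<lambda>x. u x * v x) \<in> smooth_functions"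

lemma smooth_functions_derivative:
  assumes "u \<in> smooth_functions"
  shows "\<exists>u'\<in>smooth_functions. \<forall>x. (u has_real_derivative u' x) (at x)"
  using assms
proof induction
  case (base p c d)
  let ?q = "smult c ([:0, 0, 1:] * (p - pderiv p))"
  have "((\<lambda>x. flat_exp p (c * x + d)) has_real_derivative flat_exp ([:0, 0, 1:] * (p - pderiv p)) (c * x + d) * c) (at x)" for x
    by (rule DERIV_chain2[OF flat_exp_has_derivative]) (auto intro!: derivative_eq_intros)
  moreover have "flat_exp ([:0, 0, 1:] * (p - pderiv p)) (c * x + d) * c = flat_exp ?q (c * x + d)" for x
    by (simp add: flat_exp_def)
  ultimately show ?case
    using smooth_functions.base[of ?q c d] by (intro bexI[of _ "\<lambda>x. flat_exp ?q (c * x + d)"]) auto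
next
  case (add u v)
  then obtain u' v' where "u' \<in> smooth_functions" "\<And>x. (u has_real_derivative u' x) (at x)"
    "v' \<in> smooth_functions" "\<And>x. (v has_real_derivative v' x) (at x)" by blast
  then show ?case
    by (intro bexI[of _ "\<lambda>x. u' x + v' x"]) (auto intro: smooth_functions.intros DERIV_add)
next
  case (mult u v)
  then obtain u' v' where *: "u' \<in> smooth_functions" "\<And>x. (u has_real_derivative u' x) (at x)"
    "v' \<in> smooth_functions" "\<And>x. (v has_real_derivative v' x) (at x)" by blast
  then show ?case
    using mult by (intro bexI[of _ "\<lambda>x. u' x * v x + v' x * u x"])
      (auto intro!: smooth_functions.add smooth_functions.mult DERIV_mult)
qed

lemma smooth_functions_deriv:
  assumes "u \<in> smooth_functions"
  shows "deriv u \<in> smooth_functions" "(u has_real_derivative deriv u x) (at x)"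
proof -
  obtain u' where u': "u' \<in> smooth_functions" "\<And>x. (u has_real_derivative u' x) (at x)"
    using smooth_functions_derivative[OF assms] by blast
  then have "deriv u = u'" by (intro ext DERIV_imp_deriv)
  then show "deriv u \<in> smooth_functions" "(u has_real_derivative deriv u x) (at x)" using u' by auto
qed

lemma smooth_functions_translate:
  assumes "u \<in> smooth_functions"
  shows "(\<lambda>x. u (x + a)) \<in> smooth_functions"
  using assms
proof induction
  case (base p c d)
  have "(\<lambda>x. flat_exp p (c * (x + a) + d)) = (\<lambda>x. flat_exp p (c * x + (c * a + d)))"
    by (simp add: algebra_simps)
  then show ?case using smooth_functions.base[of p c "c * a + d"] by simp
qed (auto intro: smooth_functions.intros)

lemma deriv_translate:
  assumes "u \<in> smooth_functions"
  shows "deriv (\<lambda>x. u (x + a)) = (\<lambda>x. deriv u (x + a))"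
proof
  fix x
  have "((\<lambda>x. u (x + a)) has_real_derivative deriv u (x + a) * 1) (at x)"
    by (rule DERIV_chain2[OF smooth_functions_deriv(2)[OF assms]]) (auto intro!: derivative_eq_intros)
  then show "deriv (\<lambda>x. u (x + a)) x = deriv u (x + a)" by (auto dest: DERIV_imp_deriv)
qed

text \<open>
  Products of functions of one coordinate each. A partial derivative changes only one factor, so that
  iterated partial derivatives are computed factor by factor and depend only on the multiset of
  directions.
\<close>

definition tensor :: "('a::euclidean_space \<Rightarrow> real \<Rightarrow> real) \<Rightarrow> 'a \<Rightarrow> real" where
  "tensor u x = (\<Prod>b\<in>Basis. u b (x \<bullet> b))"

definition bump_factors :: "real \<Rightarrow> ('a::euclidean_space \<Rightarrow> real \<Rightarrow> real) \<Rightarrow> bool" where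
  "bump_factors r u \<longleftrightarrow> (\<forall>b\<in>Basis. u b \<in> smooth_functions \<and> (\<forall>t. \<bar>t\<bar> > r \<longrightarrow> u b t = 0))"

lemma bump_factors_deriv:
  assumes "bump_factors r u" "b \<in> Basis"
  shows "bump_factors r (u(b := deriv (u b)))"
  unfolding bump_factors_def
proof (intro ballI conjI allI impI)
  fix c :: 'a and t assume c: "c \<in> Basis"
  show "(u(b := deriv (u b))) c \<in> smooth_functions"
    using assms c smooth_functions_deriv(1) by (auto simp: bump_factors_def)
  assume t: "\<bar>t\<bar> > r"
  show "(u(b := deriv (u b))) c t = 0"
  proof (cases "c = b")
    case True
    have "((\<lambda>x. 0) has_real_derivative 0) (at t)" by simp
    then have "(u b has_real_derivative 0) (at t)"
      by (rule has_field_derivative_transform_within_open[of _ _ _ "{t. \<bar>t\<bar> > r}"])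
        (use t assms in \<open>auto simp: bump_factors_def intro!: open_Collect_less continuous_intros\<close>)
    then show ?thesis using True by (auto dest: DERIV_imp_deriv)
  qed (use assms c t in \<open>auto simp: bump_factors_def\<close>)
qed

lemma tensor_has_derivative:
  assumes "bump_factors r u"
  shows "(tensor u has_derivative (\<lambda>v. \<Sum>b\<in>Basis. (v \<bullet> b) * tensor (u(b := deriv (u b))) x)) (at x)"
proof -
  have "((\<lambda>x. \<Prod>b\<in>Basis. u b (x \<bullet> b)) has_derivative
     (\<lambda>v. \<Sum>b\<in>Basis. (deriv (u b) (x \<bullet> b) * (v \<bullet> b)) * (\<Prod>c\<in>Basis - {b}. u c (x \<bullet> c)))) (at x)"
  proof (rule has_derivative_prod)
    fix b :: 'a assume "b \<in> Basis"
    then have "u b \<in> smooth_functions" using assms by (simp add: bump_factors_def)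
    then have "(u b has_derivative (\<lambda>h. deriv (u b) (x \<bullet> b) * h)) (at (x \<bullet> b))"
      using smooth_functions_deriv(2) by (simp add: has_field_derivative_def)
    then show "((\<lambda>x. u b (x \<bullet> b)) has_derivative (\<lambda>v. deriv (u b) (x \<bullet> b) * (v \<bullet> b))) (at x)"
      using has_derivative_compose[of "\<lambda>x. x \<bullet> b" "\<lambda>v. v \<bullet> b" x UNIV "u b"]
      by (simp add: has_derivative_inner_left[OF has_derivative_ident])
  qed
  moreover have "(deriv (u b) (x \<bullet> b) * (v \<bullet> b)) * (\<Prod>c\<in>Basis - {b}. u c (x \<bullet> c)) = (v \<bullet> b) * tensor (u(b := deriv (u b))) x"
    if "b \<in> Basis" for b v
  proof -
    have "tensor (u(b := deriv (u b))) x = deriv (u b) (x \<bullet> b) * (\<Prod>c\<in>Basis - {b}. (u(b := deriv (u b))) c (x \<bullet> c))"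
      unfolding tensor_def using that by (subst prod.remove[of _ b]) auto
    also have "(\<Prod>c\<in>Basis - {b}. (u(b := deriv (u b))) c (x \<bullet> c)) = (\<Prod>c\<in>Basis - {b}. u c (x \<bullet> c))"
      by (intro prod.cong) auto
    finally show ?thesis by (simp only: mult_ac)
  qed
  moreover have "tensor u = (\<lambda>x. \<Prod>b\<in>Basis. u b (x \<bullet> b))" by (rule ext) (simp add: tensor_def)
  ultimately show ?thesis by simp
qed

lemma tensor_partial:
  assumes "bump_factors r u" "b \<in> Basis"
  shows "(\<lambda>x. frechet_derivative (tensor u) (at x) b) = tensor (u(b := deriv (u b)))"
proof
  fix x
  have "frechet_derivative (tensor u) (at x) = (\<lambda>v. \<Sum>b\<in>Basis. (v \<bullet> b) * tensor (u(b := deriv (u b))) x)"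
    by (rule frechet_derivative_at[OF tensor_has_derivative[OF assms(1)], symmetric])
  then show "frechet_derivative (tensor u) (at x) b = tensor (u(b := deriv (u b))) x"
    using assms(2) by (simp add: inner_Basis if_distrib[of "\<lambda>t. t * _"] cong: if_cong)
qed

lemma iter_partial_tensor:
  assumes "bump_factors r u" "set bs \<subseteq> Basis"
  shows "iter_partial bs (tensor u) = tensor (\<lambda>b. (deriv ^^ count (mset bs) b) (u b))
     \<and> bump_factors r (\<lambda>b. (deriv ^^ count (mset bs) b) (u b))"
  using assms(2)
proof (induction bs)
  case Nil
  then show ?case using assms(1) by simp
next
  case (Cons b bs)
  define w where "w = (\<lambda>b. (deriv ^^ count (mset bs) b) (u b))"
  have IH: "iter_partial bs (tensor u) = tensor w" "bump_factors r w" using Cons by (auto simp: w_def)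
  have b: "b \<in> Basis" using Cons by simp
  have "(\<lambda>c. (deriv ^^ count (mset (b # bs)) c) (u c)) = w(b := deriv (w b))"
    by (auto simp: w_def fun_eq_iff)
  then show ?case
    using tensor_partial[OF IH(2) b] bump_factors_deriv[OF IH(2) b] by (simp add: IH(1))
qed

lemma tensor_continuous: "bump_factors r u \<Longrightarrow> continuous_on UNIV (tensor u)"
  using tensor_has_derivative by (auto intro!: continuous_at_imp_continuous_on has_derivative_continuous)

lemma tensor_measurable: "bump_factors r u \<Longrightarrow> tensor u \<in> borel_measurable borel"
  by (intro borel_measurable_continuous_onI tensor_continuous)

lemma tensor_support:
  assumes "bump_factors r u" "norm x > r * real DIM('a)"
  shows "tensor u (x :: 'a::euclidean_space) = 0"
proof -
  have "\<exists>b\<in>Basis. \<bar>x \<bullet> b\<bar> > r"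
  proof (rule ccontr)
    assume "\<not> ?thesis"
    then have "(\<Sum>b\<in>Basis. \<bar>x \<bullet> b\<bar>) \<le> (\<Sum>b\<in>(Basis::'a set). r)" by (intro sum_mono) (auto simp: not_less)
    then show False using assms(2) norm_le_l1[of x] by (simp add: mult.commute)
  qed
  then show ?thesis using assms(1) by (auto simp: tensor_def bump_factors_def intro!: prod_zero)
qed

lemma tensor_bounded:
  assumes "bump_factors r u"
  shows "\<exists>C\<ge>0. \<forall>x. \<bar>tensor u x\<bar> \<le> C"
proof -
  have "compact (tensor u ` cball 0 (r * real DIM('a)))"
    using assms by (intro compact_continuous_image continuous_on_subset[OF tensor_continuous]) auto
  then have "bounded (tensor u ` cball 0 (r * real DIM('a)))" by (rule compact_imp_bounded)
  then obtain C where "\<forall>y\<in>tensor u ` cball 0 (r * real DIM('a)). norm y \<le> C"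
    unfolding bounded_iff by blast
  then have C: "\<bar>tensor u x\<bar> \<le> C" if "x \<in> cball 0 (r * real DIM('a))" for x
    using that by (metis image_eqI real_norm_def)
  have "\<bar>tensor u x\<bar> \<le> max C 0" for x
    using C[of x] tensor_support[OF assms, of x] by (cases "norm x \<le> r * real DIM('a)") auto
  then show ?thesis by (intro exI[of _ "max C 0"]) auto
qed

lemma tensor_test_fun:
  assumes "bump_factors r u"
  shows "test_fun (tensor (u :: 'a::euclidean_space \<Rightarrow> _))"
  unfolding test_fun_def
proof (intro conjI allI impI)
  fix bs :: "'a list" and x :: 'a assume "set bs \<subseteq> Basis"
  from iter_partial_tensor[OF assms this]
  have eq: "iter_partial bs (tensor u) = tensor (\<lambda>b. (deriv ^^ count (mset bs) b) (u b))"
    and bf: "bump_factors r (\<lambda>b. (deriv ^^ count (mset bs) b) (u b))" by auto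
  show "iter_partial bs (tensor u) differentiable at x"
    unfolding eq using tensor_has_derivative[OF bf] by (rule differentiableI)
next
  have "{x. tensor u x \<noteq> 0} \<subseteq> cball 0 (r * real DIM('a))" using tensor_support[OF assms] by force
  then show "compact (closure {x. tensor u x \<noteq> 0})"
    by (meson bounded_cball bounded_subset compact_closure)
qed

lemma bump_factors_translate:
  assumes "bump_factors r u"
  shows "bump_factors (r + norm a) (\<lambda>b t. u b (t + a \<bullet> b))"
  unfolding bump_factors_def
proof (intro ballI conjI allI impI)
  fix b :: 'a and t assume b: "b \<in> Basis"
  show "(\<lambda>t. u b (t + a \<bullet> b)) \<in> smooth_functions"
    using assms b by (intro smooth_functions_translate) (auto simp: bump_factors_def)
  assume "\<bar>t\<bar> > r + norm a"
  then have "\<bar>t + a \<bullet> b\<bar> > r" using Basis_le_norm[OF b, of a] by linarith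
  then show "u b (t + a \<bullet> b) = 0" using assms b by (simp add: bump_factors_def)
qed

lemma tensor_translate: "tensor (\<lambda>b t. u b (t + a \<bullet> b)) x = tensor u (x + a)"
  by (simp add: tensor_def inner_add_left)

section \<open>The fundamental lemma of the calculus of variations\<close>

definition locally_integrable :: "('a::euclidean_space \<Rightarrow> real) \<Rightarrow> bool" where
  "locally_integrable h \<longleftrightarrow> h \<in> borel_measurable borel \<and> (\<forall>r. integrable lborel (\<lambda>x. h x * indicator (cball 0 r) x))"

lemma locally_integrable_measurable: "locally_integrable h \<Longrightarrow> h \<in> borel_measurable borel"
  by (simp add: locally_integrable_def)

lemma locally_integrable_mult_bounded:
  assumes h: "locally_integrable h" and \<phi> [measurable]: "\<phi> \<in> borel_measurable borel"
    and C: "\<And>x. \<bar>\<phi> x\<bar> \<le> C" and supp: "\<And>x. norm x > r \<Longrightarrow> \<phi> x = 0"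
  shows "integrable lborel (\<lambda>x. h x * \<phi> x)"
proof (rule Bochner_Integration.integrable_bound)
  have [measurable]: "h \<in> borel_measurable borel" using h by (rule locally_integrable_measurable)
  show "integrable lborel (\<lambda>x. C * (h x * indicator (cball 0 r) x))"
    using h by (auto simp: locally_integrable_def)
  show "(\<lambda>x. h x * \<phi> x) \<in> borel_measurable lborel" by measurable
  have "\<bar>h x * \<phi> x\<bar> \<le> \<bar>C * (h x * indicator (cball 0 r) x)\<bar>" for x
  proof (cases "norm x > r")
    case False
    have "\<bar>\<phi> x\<bar> \<le> \<bar>C\<bar>" using C[of x] by linarith
    then have "\<bar>h x\<bar> * \<bar>\<phi> x\<bar> \<le> \<bar>h x\<bar> * \<bar>C\<bar>" by (rule mult_left_mono) simp
    then show ?thesis using False by (simp add: abs_mult mult.commute)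
  qed (simp add: supp)
  then show "AE x in lborel. norm (h x * \<phi> x) \<le> norm (C * (h x * indicator (cball 0 r) x))" by simp
qed

lemma integrable_mult_tensor:
  assumes h: "locally_integrable h" and u: "bump_factors r u"
  shows "integrable lborel (\<lambda>x. h x * tensor u x)"
proof -
  obtain C where "C \<ge> 0" "\<forall>x. \<bar>tensor u x\<bar> \<le> C" using tensor_bounded[OF u] by blast
  then show ?thesis
    using locally_integrable_mult_bounded[OF h tensor_measurable[OF u], of C "r * real DIM('a)"] tensor_support[OF u] by blast
qed

text \<open>
  As \<open>n\<close> grows, the products of these factors converge to the indicator function of the open box.
\<close>

definition box_bump :: "'a::euclidean_space \<Rightarrow> 'a \<Rightarrow> nat \<Rightarrow> 'a \<Rightarrow> real \<Rightarrow> real" where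
  "box_bump a c n b t = flat_exp 1 (real (Suc n) * t + - (real (Suc n) * (a \<bullet> b))) * flat_exp 1 ((- real (Suc n)) * t + real (Suc n) * (c \<bullet> b))"

lemma flat_exp_1_bounds: "0 \<le> flat_exp 1 y" "flat_exp 1 y \<le> 1"
  by (auto simp: flat_exp_def)

lemma box_bump_alt:
  "box_bump a c n b t = flat_exp 1 (real (Suc n) * (t - a \<bullet> b)) * flat_exp 1 (real (Suc n) * (c \<bullet> b - t))"
  by (simp add: box_bump_def algebra_simps)

lemma box_bump_factors: "bump_factors (norm a + norm c) (box_bump a c n)"
  unfolding bump_factors_def
proof (intro ballI conjI allI impI)
  fix b :: 'a and t assume b: "b \<in> Basis"
  show "box_bump a c n b \<in> smooth_functions"
    unfolding box_bump_def[abs_def] by (intro smooth_functions.intros)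
  assume "\<bar>t\<bar> > norm a + norm c"
  then have "t < a \<bullet> b \<or> t > c \<bullet> b"
    using Basis_le_norm[OF b, of a] Basis_le_norm[OF b, of c] norm_ge_zero[of a] norm_ge_zero[of c] by linarith
  then have "\<not> real (Suc n) * (t - a \<bullet> b) > 0 \<or> \<not> real (Suc n) * (c \<bullet> b - t) > 0"
    by (auto simp: zero_less_mult_iff)
  then show "box_bump a c n b t = 0" unfolding box_bump_alt by (auto simp: flat_exp_def)
qed

lemma flat_exp_1_tendsto: "(\<lambda>n. flat_exp 1 (real (Suc n) * y)) \<longlonglongrightarrow> (if y > 0 then 1 else 0)"
proof (cases "y > 0")
  case True
  have "(\<lambda>n. exp (- (1 / y * inverse (real (Suc n))))) \<longlonglongrightarrow> exp (- (1 / y * 0))"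
    by (intro tendsto_intros LIMSEQ_inverse_real_of_nat)
  moreover have "flat_exp 1 (real (Suc n) * y) = exp (- (1 / y * inverse (real (Suc n))))" for n
  proof -
    have "real (Suc n) * y > 0" using True by (intro mult_pos_pos) auto
    moreover have "1 / (real (Suc n) * y) = 1 / y * inverse (real (Suc n))" by (simp add: divide_inverse)
    ultimately show ?thesis unfolding flat_exp_def by (simp del: of_nat_Suc)
  qed
  ultimately show ?thesis using True by simp
next
  case False
  then have "flat_exp 1 (real (Suc n) * y) = 0" for n by (simp add: flat_exp_def zero_less_mult_iff not_less)
  then show ?thesis using False by simp
qed

lemma tensor_box_bump_tendsto: "(\<lambda>n. tensor (box_bump a c n) x) \<longlonglongrightarrow> indicator (box a c) x"
proof -
  have "(\<lambda>n. box_bump a c n b t) \<longlonglongrightarrow> (if a \<bullet> b < t \<and> t < c \<bullet> b then 1 else 0)" for b t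
    using tendsto_mult[OF flat_exp_1_tendsto[of "t - a \<bullet> b"] flat_exp_1_tendsto[of "c \<bullet> b - t"]]
    unfolding box_bump_alt by (auto split: if_splits)
  then have "(\<lambda>n. tensor (box_bump a c n) x) \<longlonglongrightarrow> (\<Prod>b\<in>Basis. if a \<bullet> b < x \<bullet> b \<and> x \<bullet> b < c \<bullet> b then 1 else 0)"
    unfolding tensor_def by (intro tendsto_prod)
  also have "(\<Prod>b\<in>Basis. if a \<bullet> b < x \<bullet> b \<and> x \<bullet> b < c \<bullet> b then 1 else 0) = (indicator (box a c) x :: real)"
    by (auto simp: indicator_def mem_box prod_zero_iff)
  finally show ?thesis .
qed

lemma tensor_box_bump_bounds: "0 \<le> tensor (box_bump a c n) x" "tensor (box_bump a c n) x \<le> 1"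
  unfolding tensor_def box_bump_alt using flat_exp_1_bounds
  by (auto intro!: prod_nonneg prod_le_1 mult_le_one)

text \<open>
  Products of bumps approximate indicators of boxes, so that \<open>h\<close> has integral 0 over every box. The
  positive and the negative part of \<open>h\<close> then are densities of the same measure.
\<close>

lemma fundamental_lemma_variations:
  fixes h :: "'a::euclidean_space \<Rightarrow> real"
  assumes h: "locally_integrable h"
    and test: "\<And>r u. bump_factors r u \<Longrightarrow> (\<integral>x. h x * tensor u x \<partial>lborel) = 0"
  shows "AE x in lborel. h x = 0"
proof -
  have hm [measurable]: "h \<in> borel_measurable borel" using h by (rule locally_integrable_measurable)
  have hbox: "integrable lborel (\<lambda>x. h x * indicator (box a c) x)" for a c :: 'a
  proof -
    obtain r where r: "\<forall>x\<in>box a c. norm x \<le> r" using bounded_box[of a c] unfolding bounded_iff by blast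
    show ?thesis
    proof (rule locally_integrable_mult_bounded[OF h, where C=1 and r=r])
      show "indicator (box a c) x = 0" if "norm x > r" for x using that r by (fastforce simp: indicator_def)
    qed (simp_all add: indicator_def)
  qed
  have box0: "(\<integral>x. h x * indicator (box a c) x \<partial>lborel) = 0" for a c :: 'a
  proof -
    define R where "R = (norm a + norm c) * real DIM('a)"
    have "(\<lambda>n. \<integral>x. h x * tensor (box_bump a c n) x \<partial>lborel) \<longlonglongrightarrow> (\<integral>x. h x * indicator (box a c) x \<partial>lborel)"
    proof (rule integral_dominated_convergence[where w="\<lambda>x. \<bar>h x * indicator (cball 0 R) x\<bar>"])
      show "integrable lborel (\<lambda>x. \<bar>h x * indicator (cball 0 R) x\<bar>)"
        using h by (intro integrable_abs) (auto simp: locally_integrable_def)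
      show "AE x in lborel. (\<lambda>n. h x * tensor (box_bump a c n) x) \<longlonglongrightarrow> h x * indicator (box a c) x"
        by (intro AE_I2 tendsto_mult tendsto_const tensor_box_bump_tendsto)
      show "(\<lambda>x. h x * tensor (box_bump a c n) x) \<in> borel_measurable lborel" for n
        using tensor_measurable[OF box_bump_factors[of a c n]] by measurable
      have "\<bar>h x * tensor (box_bump a c n) x\<bar> \<le> \<bar>h x * indicator (cball 0 R) x\<bar>" for n x
      proof (cases "norm x > R")
        case True
        then show ?thesis using tensor_support[OF box_bump_factors, of a c x n] by (simp add: R_def)
      next
        case False
        then show ?thesis using tensor_box_bump_bounds[of a c n x]
            mult_left_mono[of "tensor (box_bump a c n) x" 1 "\<bar>h x\<bar>"] by (simp add: abs_mult)
      qed
      then show "AE x in lborel. norm (h x * tensor (box_bump a c n) x) \<le> \<bar>h x * indicator (cball 0 R) x\<bar>" for n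
        by simp
    qed measurable
    then show ?thesis unfolding test[OF box_bump_factors] by (simp add: LIMSEQ_const_iff)
  qed
  \<comment> \<open>Conversion to \<^typ>\<open>ennreal\<close> cuts off at 0, so these are the positive and the negative part.\<close>
  define P N where "P x = ennreal (h x)" and "N x = ennreal (- h x)" for x
  have [measurable]: "P \<in> borel_measurable borel" "N \<in> borel_measurable borel" unfolding P_def N_def by measurable
  have PN: "(\<integral>\<^sup>+x. P x * indicator (box a c) x \<partial>lborel) = (\<integral>\<^sup>+x. N x * indicator (box a c) x \<partial>lborel)"
    "(\<integral>\<^sup>+x. P x * indicator (box a c) x \<partial>lborel) \<noteq> \<infinity>" for a c :: 'a
  proof -
    let ?g = "\<lambda>x. h x * indicator (box a c) x"
    have P': "(\<integral>\<^sup>+x. P x * indicator (box a c) x \<partial>lborel) = (\<integral>\<^sup>+x. ennreal (?g x) \<partial>lborel)"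
      by (intro nn_integral_cong) (auto simp: P_def indicator_def)
    have N': "(\<integral>\<^sup>+x. N x * indicator (box a c) x \<partial>lborel) = (\<integral>\<^sup>+x. ennreal (- ?g x) \<partial>lborel)"
      by (intro nn_integral_cong) (auto simp: N_def indicator_def)
    from real_integrable_def[of lborel ?g] hbox[of a c]
    have fin: "(\<integral>\<^sup>+x. ennreal (?g x) \<partial>lborel) \<noteq> \<infinity>" "(\<integral>\<^sup>+x. ennreal (- ?g x) \<partial>lborel) \<noteq> \<infinity>" by auto
    have "enn2real (\<integral>\<^sup>+x. ennreal (?g x) \<partial>lborel) = enn2real (\<integral>\<^sup>+x. ennreal (- ?g x) \<partial>lborel)"
      using real_lebesgue_integral_def[OF hbox[of a c]] box0[of a c] by simp
    then show "(\<integral>\<^sup>+x. P x * indicator (box a c) x \<partial>lborel) = (\<integral>\<^sup>+x. N x * indicator (box a c) x \<partial>lborel)"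
    proof -
      have eq: "X = Y" if "enn2real X = enn2real Y" "X \<noteq> \<infinity>" "Y \<noteq> \<infinity>" for X Y
        using that by (cases X; cases Y) auto
      show ?thesis unfolding P' N' by (rule eq) fact+
    qed
    show "(\<integral>\<^sup>+x. P x * indicator (box a c) x \<partial>lborel) \<noteq> \<infinity>" unfolding P' using fin by simp
  qed
  have "density lborel P = density lborel N"
  proof (rule measure_eqI_generator_eq)
    let ?E = "range (\<lambda>(a, b). box a b::'a set)"
    show "Int_stable ?E" by (auto simp: Int_stable_def box_Int_box)
    show "?E \<subseteq> Pow UNIV" "sets (density lborel P) = sigma_sets UNIV ?E" "sets (density lborel N) = sigma_sets UNIV ?E"
      by (simp_all add: borel_eq_box)
    let ?A = "\<lambda>n::nat. box (- (real n *\<^sub>R One)) (real n *\<^sub>R One) :: 'a set"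
    show "range ?A \<subseteq> ?E" "(\<Union>i. ?A i) = UNIV" unfolding UN_box_eq_UNIV by auto
    show "emeasure (density lborel P) (?A i) \<noteq> \<infinity>" for i using PN(2) by (simp add: emeasure_density)
    show "emeasure (density lborel P) X = emeasure (density lborel N) X" if "X \<in> ?E" for X
      using that PN(1) by (auto simp: emeasure_density)
  qed
  then have "AE x in lborel. P x = N x" by (intro sigma_finite_measure.density_unique lborel.sigma_finite_measure_axioms) auto
  moreover have "h x = 0" if "P x = N x" for x
  proof (cases "h x > 0")
    case True
    then have "ennreal (h x) = 0" using that by (simp add: P_def N_def ennreal_neg)
    then show ?thesis using True by (simp add: ennreal_eq_0_iff)
  next
    case False
    then have "ennreal (- h x) = 0" using that by (simp add: P_def N_def ennreal_neg)
    then show ?thesis using False by (simp add: ennreal_eq_0_iff)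
  qed
  ultimately show ?thesis by (auto elim: eventually_mono)
qed

section \<open>Weak directional derivatives\<close>

lemma integral_lborel_shift:
  fixes g :: "'a::euclidean_space \<Rightarrow> real"
  assumes [measurable]: "g \<in> borel_measurable borel"
  shows "(\<integral>x. g (x + h) \<partial>lborel) = (\<integral>x. g x \<partial>lborel)"
proof -
  have "(\<integral>x. g x \<partial>lborel) = (\<integral>x. g x \<partial>distr lborel borel ((+) h))" by (simp add: lborel_distr_plus)
  also have "\<dots> = (\<integral>x. g (h + x) \<partial>lborel)" by (subst integral_distr) auto
  finally show ?thesis by (simp add: add.commute)
qed

lemma integrable_lborel_shift:
  fixes g :: "'a::euclidean_space \<Rightarrow> real"
  assumes "integrable lborel g"
  shows "integrable lborel (\<lambda>x. g (x + h))"
proof -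
  have [measurable]: "g \<in> borel_measurable borel" using assms by (auto dest: borel_measurable_integrable)
  have "integrable (distr lborel borel ((+) h)) g" using assms by (simp add: lborel_distr_plus)
  then have "integrable lborel (\<lambda>x. g (h + x))" by (subst (asm) integrable_distr_eq) auto
  then show ?thesis by (simp add: add.commute)
qed

lemma locally_integrable_shift:
  assumes "locally_integrable h"
  shows "locally_integrable (shift a h)"
  unfolding locally_integrable_def
proof (intro conjI allI)
  have [measurable]: "h \<in> borel_measurable borel" using assms by (rule locally_integrable_measurable)
  show "shift a h \<in> borel_measurable borel" by measurable
  fix r
  have "integrable lborel (\<lambda>x. h x * indicator (cball 0 r) (x - a))"
  proof (rule locally_integrable_mult_bounded[OF assms, where C=1 and r="r + norm a"])
    fix x :: 'a assume "norm x > r + norm a"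
    moreover have "norm x \<le> norm (x - a) + norm a" using norm_triangle_ineq[of "x - a" a] by simp
    ultimately show "indicator (cball 0 r) (x - a) = (0::real)" by simp
  qed (auto simp: indicator_def)
  from integrable_lborel_shift[OF this, of a] show "integrable lborel (\<lambda>x. shift a h x * indicator (cball 0 r) x)"
    by (simp add: shift_def)
qed

lemma locally_integrable_diff:
  assumes "locally_integrable g" "locally_integrable h"
  shows "locally_integrable (\<lambda>x. g x - h x)"
  using assms by (auto simp: locally_integrable_def left_diff_distrib)

lemma locally_integrable_fdiff: "locally_integrable g \<Longrightarrow> locally_integrable (fdiff a g)"
  using locally_integrable_diff[OF locally_integrable_shift] by (simp add: fdiff_def shift_def)

definition dir_deriv :: "'a::euclidean_space \<Rightarrow> ('a \<Rightarrow> real \<Rightarrow> real) \<Rightarrow> 'a \<Rightarrow> real" where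
  "dir_deriv \<xi> u x = (\<Sum>b\<in>Basis. (\<xi> \<bullet> b) * tensor (u(b := deriv (u b))) x)"

text \<open>
  Tested only against products of bump functions, which is all that the fundamental lemma requires.
\<close>

definition weak_dir_deriv :: "'a::euclidean_space \<Rightarrow> ('a \<Rightarrow> real) \<Rightarrow> ('a \<Rightarrow> real) \<Rightarrow> bool" where
  "weak_dir_deriv \<xi> G G' \<longleftrightarrow> locally_integrable G \<and> locally_integrable G' \<and>
     (\<forall>r u. bump_factors r u \<longrightarrow> (\<integral>x. G x * dir_deriv \<xi> u x \<partial>lborel) = - (\<integral>x. G' x * tensor u x \<partial>lborel))"

abbreviation translate_factors :: "'a::euclidean_space \<Rightarrow> ('a \<Rightarrow> real \<Rightarrow> real) \<Rightarrow> 'a \<Rightarrow> real \<Rightarrow> real" where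
  "translate_factors a u \<equiv> (\<lambda>b t. u b (t + a \<bullet> b))"

lemma dir_deriv_translate:
  assumes u: "bump_factors r u"
  shows "dir_deriv \<xi> (translate_factors a u) x = dir_deriv \<xi> u (x + a)"
  unfolding dir_deriv_def
proof (intro sum.cong refl arg_cong2[where f="(*)"])
  fix b :: 'a assume b: "b \<in> Basis"
  have "(translate_factors a u)(b := deriv (translate_factors a u b)) = translate_factors a (u(b := deriv (u b)))"
    using deriv_translate[of "u b" "a \<bullet> b"] u b by (auto simp: bump_factors_def fun_eq_iff)
  then show "tensor ((translate_factors a u)(b := deriv (translate_factors a u b))) x = tensor (u(b := deriv (u b))) (x + a)"
    by (simp only: tensor_translate)
qed

lemma dir_deriv_measurable:
  assumes "bump_factors r u" shows "dir_deriv \<xi> u \<in> borel_measurable borel"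
proof -
  have [measurable]: "tensor (u(b := deriv (u b))) \<in> borel_measurable borel" if "b \<in> Basis" for b
    by (rule tensor_measurable[OF bump_factors_deriv[OF assms that]])
  show ?thesis
    unfolding dir_deriv_def[abs_def] by (intro borel_measurable_sum borel_measurable_times) auto
qed

lemma dir_deriv_continuous:
  assumes "bump_factors r u" shows "continuous_on UNIV (dir_deriv \<xi> u)"
proof -
  have "continuous_on UNIV (tensor (u(b := deriv (u b))))" if "b \<in> Basis" for b
    by (rule tensor_continuous[OF bump_factors_deriv[OF assms that]])
  then show ?thesis
    unfolding dir_deriv_def[abs_def] by (intro continuous_on_sum continuous_on_mult continuous_on_const) auto
qed

lemma dir_deriv_support:
  assumes "bump_factors r u" "norm x > r * real DIM('a)"
  shows "dir_deriv \<xi> u (x :: 'a::euclidean_space) = 0"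
  unfolding dir_deriv_def using tensor_support[OF bump_factors_deriv[OF assms(1)] assms(2)] by simp

lemma dir_deriv_bounded:
  assumes "bump_factors r u" shows "\<exists>C\<ge>0. \<forall>x. \<bar>dir_deriv \<xi> u x\<bar> \<le> C"
proof -
  have "\<exists>C. \<forall>b\<in>Basis. \<forall>x. \<bar>tensor (u(b := deriv (u b))) x\<bar> \<le> C b"
    using tensor_bounded[OF bump_factors_deriv[OF assms]] by (intro bchoice) blast
  then obtain C where C: "\<And>b x. b \<in> Basis \<Longrightarrow> \<bar>tensor (u(b := deriv (u b))) x\<bar> \<le> C b" by blast
  define K where "K = (\<Sum>b\<in>Basis. \<bar>\<xi> \<bullet> b\<bar> * C b)"
  have "\<bar>dir_deriv \<xi> u x\<bar> \<le> K" for x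
    unfolding dir_deriv_def K_def
    by (rule order_trans[OF sum_abs], intro sum_mono) (auto simp: abs_mult intro!: mult_left_mono C)
  moreover from this[of 0] have "K \<ge> 0" by linarith
  ultimately show ?thesis by blast
qed

lemma weak_dir_deriv_shift:
  fixes \<xi> :: "'a::euclidean_space"
  assumes W: "weak_dir_deriv \<xi> G G'"
  shows "weak_dir_deriv \<xi> (shift a G) (shift a G')"
  unfolding weak_dir_deriv_def
proof (intro conjI allI impI)
  show "locally_integrable (shift a G)" "locally_integrable (shift a G')"
    using W by (auto simp: weak_dir_deriv_def intro: locally_integrable_shift)
  have [measurable]: "G \<in> borel_measurable borel" "G' \<in> borel_measurable borel"
    using W by (auto simp: weak_dir_deriv_def intro: locally_integrable_measurable)
  fix r and u :: "'a \<Rightarrow> real \<Rightarrow> real" assume u: "bump_factors r u"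
  note [measurable] = dir_deriv_measurable[OF u, of \<xi>] tensor_measurable[OF u]
  have u': "bump_factors (r + norm (- a)) (translate_factors (- a) u)" by (rule bump_factors_translate[OF u])
  have "(\<integral>x. shift a G x * dir_deriv \<xi> u x \<partial>lborel) = (\<integral>x. G (x + a) * dir_deriv \<xi> u ((x + a) + - a) \<partial>lborel)"
    by (simp add: shift_def)
  also have "\<dots> = (\<integral>x. G x * dir_deriv \<xi> u (x + - a) \<partial>lborel)"
    by (rule integral_lborel_shift[of "\<lambda>x. G x * dir_deriv \<xi> u (x + - a)" a]) measurable
  also have "\<dots> = (\<integral>x. G x * dir_deriv \<xi> (translate_factors (- a) u) x \<partial>lborel)"
    unfolding dir_deriv_translate[OF u] ..
  also have "\<dots> = - (\<integral>x. G' x * tensor (translate_factors (- a) u) x \<partial>lborel)"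
    using W u' unfolding weak_dir_deriv_def by blast
  also have "(\<integral>x. G' x * tensor (translate_factors (- a) u) x \<partial>lborel) = (\<integral>x. G' x * tensor u (x + - a) \<partial>lborel)"
    unfolding tensor_translate ..
  also have "\<dots> = (\<integral>x. G' (x + a) * tensor u ((x + a) + - a) \<partial>lborel)"
    by (rule integral_lborel_shift[of "\<lambda>x. G' x * tensor u (x + - a)" a, symmetric]) measurable
  finally show "(\<integral>x. shift a G x * dir_deriv \<xi> u x \<partial>lborel) = - (\<integral>x. shift a G' x * tensor u x \<partial>lborel)"
    by (simp add: shift_def)
qed

lemma integrable_mult_dir_deriv:
  assumes h: "locally_integrable h" and u: "bump_factors r u"
  shows "integrable lborel (\<lambda>x. h x * dir_deriv \<xi> u x)"
proof -
  obtain C where "C \<ge> 0" "\<forall>x. \<bar>dir_deriv \<xi> u x\<bar> \<le> C" using dir_deriv_bounded[OF u] by blast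
  then show ?thesis
    using locally_integrable_mult_bounded[OF h dir_deriv_measurable[OF u], where C=C and r="r * real DIM('a)"] dir_deriv_support[OF u] by blast
qed

lemma weak_dir_deriv_fdiff:
  fixes \<xi> :: "'a::euclidean_space"
  assumes W: "weak_dir_deriv \<xi> G G'"
  shows "weak_dir_deriv \<xi> (fdiff a G) (fdiff a G')"
  unfolding weak_dir_deriv_def
proof (intro conjI allI impI)
  have loc: "locally_integrable G" "locally_integrable G'" using W by (auto simp: weak_dir_deriv_def)
  then show "locally_integrable (fdiff a G)" "locally_integrable (fdiff a G')" by (auto intro: locally_integrable_fdiff)
  fix r and u :: "'a \<Rightarrow> real \<Rightarrow> real" assume u: "bump_factors r u"
  have "(\<integral>x. fdiff a G x * dir_deriv \<xi> u x \<partial>lborel) = (\<integral>x. shift a G x * dir_deriv \<xi> u x - G x * dir_deriv \<xi> u x \<partial>lborel)"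
    by (simp add: fdiff_def shift_def left_diff_distrib)
  also have "\<dots> = (\<integral>x. shift a G x * dir_deriv \<xi> u x \<partial>lborel) - (\<integral>x. G x * dir_deriv \<xi> u x \<partial>lborel)"
    by (intro Bochner_Integration.integral_diff integrable_mult_dir_deriv[OF _ u] locally_integrable_shift loc)
  also have "\<dots> = (\<integral>x. G' x * tensor u x \<partial>lborel) - (\<integral>x. shift a G' x * tensor u x \<partial>lborel)"
    using W weak_dir_deriv_shift[OF W, of a] u by (simp add: weak_dir_deriv_def)
  also have "\<dots> = - (\<integral>x. shift a G' x * tensor u x - G' x * tensor u x \<partial>lborel)"
    by (subst Bochner_Integration.integral_diff) (auto intro!: integrable_mult_tensor[OF _ u] locally_integrable_shift loc)
  finally show "(\<integral>x. fdiff a G x * dir_deriv \<xi> u x \<partial>lborel) = - (\<integral>x. fdiff a G' x * tensor u x \<partial>lborel)"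
    by (simp add: fdiff_def shift_def left_diff_distrib)
qed

text \<open>
  The integrability that both applications of Fubini's theorem below rely on.
\<close>

lemma segment_integrable:
  fixes H \<psi> :: "'a::euclidean_space \<Rightarrow> real"
  assumes H: "locally_integrable H" and \<psi> [measurable]: "\<psi> \<in> borel_measurable borel"
    and C: "\<And>x. \<bar>\<psi> x\<bar> \<le> C" and supp: "\<And>x. norm x > r \<Longrightarrow> \<psi> x = 0" and \<xi>: "norm \<xi> = 1" and t: "t \<ge> 0"
  shows "integrable (lborel \<Otimes>\<^sub>M lborel) (\<lambda>(\<tau>, x). indicator {0..t} \<tau> * (H (x + \<tau> *\<^sub>R \<xi>) * \<psi> x))"
    and "integrable (lborel \<Otimes>\<^sub>M lborel) (\<lambda>(\<tau>, x). indicator {0..t} \<tau> * (H x * \<psi> (x - \<tau> *\<^sub>R \<xi>)))"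
proof -
  have [measurable]: "H \<in> borel_measurable borel" using H by (rule locally_integrable_measurable)
  define K where "K = (\<integral>\<^sup>+x. ennreal \<bar>C * (H x * indicator (cball 0 (r + t)) x)\<bar> \<partial>lborel)"
  have "integrable lborel (\<lambda>x. C * (H x * indicator (cball 0 (r + t)) x))"
    using H by (auto simp: locally_integrable_def)
  then have K: "K < \<infinity>" unfolding K_def integrable_iff_bounded real_norm_def by (rule conjunct2)
  have inner: "(\<integral>\<^sup>+x. ennreal \<bar>H x * \<psi> (x - \<tau> *\<^sub>R \<xi>)\<bar> \<partial>lborel) \<le> K" if \<tau>: "\<tau> \<in> {0..t}" for \<tau>
    unfolding K_def
  proof (intro nn_integral_mono ennreal_leI)
    fix x
    show "\<bar>H x * \<psi> (x - \<tau> *\<^sub>R \<xi>)\<bar> \<le> \<bar>C * (H x * indicator (cball 0 (r + t)) x)\<bar>"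
    proof (cases "norm x > r + t")
      case True
      have "norm x \<le> norm (x - \<tau> *\<^sub>R \<xi>) + norm (\<tau> *\<^sub>R \<xi>)" using norm_triangle_ineq[of "x - \<tau> *\<^sub>R \<xi>" "\<tau> *\<^sub>R \<xi>"] by simp
      then have "norm (x - \<tau> *\<^sub>R \<xi>) > r" using True \<tau> \<xi> by auto
      then show ?thesis by (simp add: supp)
    next
      case False
      have "\<bar>\<psi> (x - \<tau> *\<^sub>R \<xi>)\<bar> \<le> \<bar>C\<bar>" using C[of "x - \<tau> *\<^sub>R \<xi>"] by linarith
      then have "\<bar>H x\<bar> * \<bar>\<psi> (x - \<tau> *\<^sub>R \<xi>)\<bar> \<le> \<bar>H x\<bar> * \<bar>C\<bar>" by (rule mult_left_mono) simp
      then show ?thesis using False by (simp add: abs_mult mult.commute)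
    qed
  qed
  have inner2: "(\<integral>\<^sup>+x. ennreal \<bar>H (x + \<tau> *\<^sub>R \<xi>) * \<psi> x\<bar> \<partial>lborel) \<le> K" if \<tau>: "\<tau> \<in> {0..t}" for \<tau>
  proof -
    have "(\<integral>\<^sup>+x. ennreal \<bar>H (x + \<tau> *\<^sub>R \<xi>) * \<psi> x\<bar> \<partial>lborel) = (\<integral>\<^sup>+x. ennreal \<bar>H (x + \<tau> *\<^sub>R \<xi>) * \<psi> ((x + \<tau> *\<^sub>R \<xi>) - \<tau> *\<^sub>R \<xi>)\<bar> \<partial>lborel)"
      by simp
    also have "\<dots> = (\<integral>\<^sup>+x. ennreal \<bar>H x * \<psi> (x - \<tau> *\<^sub>R \<xi>)\<bar> \<partial>lborel)"
      by (rule nn_integral_lborel_shift[of "\<lambda>x. ennreal \<bar>H x * \<psi> (x - \<tau> *\<^sub>R \<xi>)\<bar>"]) measurable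
    finally show ?thesis using inner[OF \<tau>] by simp
  qed
  have tot: "integrable (lborel \<Otimes>\<^sub>M lborel) (\<lambda>(\<tau>, x). indicator {0..t} \<tau> * F \<tau> x)"
    if m [measurable]: "(\<lambda>(\<tau>, x). F \<tau> x) \<in> borel_measurable (lborel \<Otimes>\<^sub>M lborel)"
      and le: "\<And>\<tau>. \<tau> \<in> {0..t} \<Longrightarrow> (\<integral>\<^sup>+x. ennreal \<bar>F \<tau> x\<bar> \<partial>lborel) \<le> K" for F :: "real \<Rightarrow> 'a \<Rightarrow> real"
  proof (rule integrableI_bounded)
    show "(\<lambda>(\<tau>, x). indicator {0..t} \<tau> * F \<tau> x) \<in> borel_measurable (lborel \<Otimes>\<^sub>M lborel)" by measurable
    have "(\<integral>\<^sup>+z. ennreal (norm (case z of (\<tau>, x) \<Rightarrow> indicator {0..t} \<tau> * F \<tau> x)) \<partial>(lborel \<Otimes>\<^sub>M lborel))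
      = (\<integral>\<^sup>+\<tau>. \<integral>\<^sup>+x. ennreal (norm (indicator {0..t} \<tau> * F \<tau> x)) \<partial>lborel \<partial>lborel)"
      by (subst lborel.nn_integral_fst[symmetric]) (auto simp: split_beta')
    also have "\<dots> \<le> (\<integral>\<^sup>+\<tau>. K * indicator {0..t} \<tau> \<partial>lborel)"
    proof (rule nn_integral_mono)
      fix \<tau>
      show "(\<integral>\<^sup>+x. ennreal (norm (indicator {0..t} \<tau> * F \<tau> x)) \<partial>lborel) \<le> K * indicator {0..t} \<tau>"
        using le[of \<tau>] by (cases "\<tau> \<in> {0..t}") auto
    qed
    also have "\<dots> = K * ennreal t" using t by (subst nn_integral_cmult_indicator) auto
    also have "\<dots> < \<infinity>" using K by (simp add: ennreal_mult_less_top)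
    finally show "(\<integral>\<^sup>+z. ennreal (norm (case z of (\<tau>, x) \<Rightarrow> indicator {0..t} \<tau> * F \<tau> x)) \<partial>(lborel \<Otimes>\<^sub>M lborel)) < \<infinity>" .
  qed
  show "integrable (lborel \<Otimes>\<^sub>M lborel) (\<lambda>(\<tau>, x). indicator {0..t} \<tau> * (H (x + \<tau> *\<^sub>R \<xi>) * \<psi> x))"
    by (rule tot) (measurable, rule inner2)
  show "integrable (lborel \<Otimes>\<^sub>M lborel) (\<lambda>(\<tau>, x). indicator {0..t} \<tau> * (H x * \<psi> (x - \<tau> *\<^sub>R \<xi>)))"
    by (rule tot) (measurable, rule inner)
qed

lemma tensor_line_FTC:
  fixes \<xi> :: "'a::euclidean_space"
  assumes u: "bump_factors r u" and t: "t \<ge> 0"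
  shows "tensor u (x - t *\<^sub>R \<xi>) - tensor u x = - (\<integral>\<tau>. indicator {0..t} \<tau> * dir_deriv \<xi> u (x - \<tau> *\<^sub>R \<xi>) \<partial>lborel)"
proof -
  have "(\<integral>\<tau>. - dir_deriv \<xi> u (x - \<tau> *\<^sub>R \<xi>) * indicator {0..t} \<tau> \<partial>lborel) = tensor u (x - t *\<^sub>R \<xi>) - tensor u (x - 0 *\<^sub>R \<xi>)"
  proof (rule integral_FTC_Icc_real)
    fix \<tau>
    have "((\<lambda>\<tau>. x - \<tau> *\<^sub>R \<xi>) has_derivative (\<lambda>h. - (h *\<^sub>R \<xi>))) (at \<tau>)"
      by (auto intro!: derivative_eq_intros)
    then have "((\<lambda>\<tau>. tensor u (x - \<tau> *\<^sub>R \<xi>)) has_derivative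
        (\<lambda>h. \<Sum>b\<in>Basis. (- (h *\<^sub>R \<xi>) \<bullet> b) * tensor (u(b := deriv (u b))) (x - \<tau> *\<^sub>R \<xi>))) (at \<tau>)"
      by (rule has_derivative_compose[OF _ tensor_has_derivative[OF u]])
    moreover have "(\<lambda>h. \<Sum>b\<in>Basis. (- (h *\<^sub>R \<xi>) \<bullet> b) * tensor (u(b := deriv (u b))) (x - \<tau> *\<^sub>R \<xi>)) = (*) (- dir_deriv \<xi> u (x - \<tau> *\<^sub>R \<xi>))"
      by (auto simp: dir_deriv_def sum_distrib_left sum_negf[symmetric] mult_ac fun_eq_iff intro!: sum.cong)
    ultimately show "((\<lambda>\<tau>. tensor u (x - \<tau> *\<^sub>R \<xi>)) has_real_derivative - dir_deriv \<xi> u (x - \<tau> *\<^sub>R \<xi>)) (at \<tau>)"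
      by (simp add: has_field_derivative_def)
    have "continuous_on UNIV (\<lambda>\<tau>. - dir_deriv \<xi> u (x - \<tau> *\<^sub>R \<xi>))"
      by (intro continuous_intros continuous_on_compose2[OF dir_deriv_continuous[OF u]]) auto
    then show "isCont (\<lambda>\<tau>. - dir_deriv \<xi> u (x - \<tau> *\<^sub>R \<xi>)) \<tau>"
      by (simp add: continuous_on_eq_continuous_at)
  qed (use t in auto)
  then show ?thesis by (simp add: mult.commute)
qed

text \<open>
  The fundamental theorem of calculus for weak derivatives. Both sides have the same integral against
  every test function: move the difference onto the test function, where the classical theorem applies,
  exchange the integrals, and use the definition of the weak derivative.
\<close>

lemma weak_dir_deriv_segment:
  fixes G G' :: "'a::euclidean_space \<Rightarrow> real"
  assumes W: "weak_dir_deriv \<xi> G G'" and \<xi>: "norm \<xi> = 1" and t: "t \<ge> 0"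
  shows "AE x in lborel. fdiff (t *\<^sub>R \<xi>) G x = (\<integral>\<tau>. indicator {0..t} \<tau> * G' (x + \<tau> *\<^sub>R \<xi>) \<partial>lborel)"
proof -
  define A where "A x = (\<integral>\<tau>. indicator {0..t} \<tau> * G' (x + \<tau> *\<^sub>R \<xi>) \<partial>lborel)" for x
  have loc: "locally_integrable G" "locally_integrable G'" using W by (auto simp: weak_dir_deriv_def)
  have [measurable]: "G \<in> borel_measurable borel" "G' \<in> borel_measurable borel"
    using loc by (auto intro: locally_integrable_measurable)
  have A: "locally_integrable A"
    unfolding locally_integrable_def
  proof (intro conjI allI)
    have "(\<lambda>(x, \<tau>). indicator {0..t} \<tau> * G' (x + \<tau> *\<^sub>R \<xi>)) \<in> borel_measurable (borel \<Otimes>\<^sub>M lborel)" by measurable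
    then show "A \<in> borel_measurable borel" unfolding A_def[abs_def] by (rule lborel.borel_measurable_lebesgue_integral)
    fix r
    have "integrable (lborel \<Otimes>\<^sub>M lborel) (\<lambda>(\<tau>, x). indicator {0..t} \<tau> * (G' (x + \<tau> *\<^sub>R \<xi>) * indicator (cball 0 r) x))"
      by (rule segment_integrable(1)[OF loc(2), where C=1 and r=r]) (auto simp: indicator_def \<xi> t)
    from lborel_pair.integrable_snd[OF this]
    show "integrable lborel (\<lambda>x. A x * indicator (cball 0 r) x)"
      by (simp add: A_def mult.assoc[symmetric])
  qed
  have "AE x in lborel. fdiff (t *\<^sub>R \<xi>) G x - A x = 0"
  proof (rule fundamental_lemma_variations)
    show "locally_integrable (\<lambda>x. fdiff (t *\<^sub>R \<xi>) G x - A x)"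
      by (intro locally_integrable_diff locally_integrable_fdiff loc A)
    fix r and u :: "'a \<Rightarrow> real \<Rightarrow> real" assume u: "bump_factors r u"
    note [measurable] = dir_deriv_measurable[OF u, of \<xi>] tensor_measurable[OF u]
    obtain C where C: "\<And>x. \<bar>tensor u x\<bar> \<le> C" using tensor_bounded[OF u] by blast
    obtain C' where C': "\<And>x. \<bar>dir_deriv \<xi> u x\<bar> \<le> C'" using dir_deriv_bounded[OF u] by blast
    let ?u = "\<lambda>a. translate_factors a u"
    have tr: "bump_factors (r + norm a) (?u a)" for a by (rule bump_factors_translate[OF u])
    have "(\<integral>x. fdiff (t *\<^sub>R \<xi>) G x * tensor u x \<partial>lborel) = (\<integral>x. shift (t *\<^sub>R \<xi>) G x * tensor u x - G x * tensor u x \<partial>lborel)"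
      by (simp add: fdiff_def shift_def left_diff_distrib)
    also have "\<dots> = (\<integral>x. shift (t *\<^sub>R \<xi>) G x * tensor u x \<partial>lborel) - (\<integral>x. G x * tensor u x \<partial>lborel)"
      by (intro Bochner_Integration.integral_diff integrable_mult_tensor[OF _ u] locally_integrable_shift loc)
    also have "(\<integral>x. shift (t *\<^sub>R \<xi>) G x * tensor u x \<partial>lborel) = (\<integral>x. G x * tensor u (x - t *\<^sub>R \<xi>) \<partial>lborel)"
      using integral_lborel_shift[of "\<lambda>x. G x * tensor u (x - t *\<^sub>R \<xi>)" "t *\<^sub>R \<xi>"] by (simp add: shift_def)
    also have "(\<integral>x. G x * tensor u (x - t *\<^sub>R \<xi>) \<partial>lborel) - (\<integral>x. G x * tensor u x \<partial>lborel)
       = (\<integral>x. G x * tensor u (x - t *\<^sub>R \<xi>) - G x * tensor u x \<partial>lborel)"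
    proof (rule Bochner_Integration.integral_diff[symmetric])
      show "integrable lborel (\<lambda>x. G x * tensor u (x - t *\<^sub>R \<xi>))"
        using integrable_mult_tensor[OF loc(1) tr[of "- (t *\<^sub>R \<xi>)"]] unfolding tensor_translate by simp
    qed (rule integrable_mult_tensor[OF loc(1) u])
    also have "\<dots> = (\<integral>x. - (\<integral>\<tau>. indicator {0..t} \<tau> * (G x * dir_deriv \<xi> u (x - \<tau> *\<^sub>R \<xi>)) \<partial>lborel) \<partial>lborel)"
    proof (rule Bochner_Integration.integral_cong[OF refl])
      fix x
      have "G x * tensor u (x - t *\<^sub>R \<xi>) - G x * tensor u x = G x * (- (\<integral>\<tau>. indicator {0..t} \<tau> * dir_deriv \<xi> u (x - \<tau> *\<^sub>R \<xi>) \<partial>lborel))"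
        unfolding tensor_line_FTC[OF u t, symmetric] by (simp add: right_diff_distrib)
      also have "\<dots> = - (\<integral>\<tau>. G x * (indicator {0..t} \<tau> * dir_deriv \<xi> u (x - \<tau> *\<^sub>R \<xi>)) \<partial>lborel)" by simp
      finally show "G x * tensor u (x - t *\<^sub>R \<xi>) - G x * tensor u x = - (\<integral>\<tau>. indicator {0..t} \<tau> * (G x * dir_deriv \<xi> u (x - \<tau> *\<^sub>R \<xi>)) \<partial>lborel)"
        by (simp only: mult_ac)
    qed
    also have "\<dots> = - (\<integral>x. (\<integral>\<tau>. indicator {0..t} \<tau> * (G x * dir_deriv \<xi> u (x - \<tau> *\<^sub>R \<xi>)) \<partial>lborel) \<partial>lborel)" by simp
    also have "(\<integral>x. (\<integral>\<tau>. indicator {0..t} \<tau> * (G x * dir_deriv \<xi> u (x - \<tau> *\<^sub>R \<xi>)) \<partial>lborel) \<partial>lborel)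
      = (\<integral>\<tau>. (\<integral>x. indicator {0..t} \<tau> * (G x * dir_deriv \<xi> u (x - \<tau> *\<^sub>R \<xi>)) \<partial>lborel) \<partial>lborel)"
      by (rule lborel_pair.Fubini_integral)
        (rule segment_integrable(2)[OF loc(1) _ C' dir_deriv_support[OF u] \<xi> t], measurable)
    also have "\<dots> = (\<integral>\<tau>. - (\<integral>x. indicator {0..t} \<tau> * (G' (x + \<tau> *\<^sub>R \<xi>) * tensor u x) \<partial>lborel) \<partial>lborel)"
    proof (rule Bochner_Integration.integral_cong[OF refl])
      fix \<tau> :: real
      have "(\<integral>x. G x * dir_deriv \<xi> u (x - \<tau> *\<^sub>R \<xi>) \<partial>lborel) = (\<integral>x. G x * dir_deriv \<xi> (?u (- (\<tau> *\<^sub>R \<xi>))) x \<partial>lborel)"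
        unfolding dir_deriv_translate[OF u] by simp
      also have "\<dots> = - (\<integral>x. G' x * tensor (?u (- (\<tau> *\<^sub>R \<xi>))) x \<partial>lborel)"
        using W tr[of "- (\<tau> *\<^sub>R \<xi>)"] unfolding weak_dir_deriv_def by blast
      also have "(\<integral>x. G' x * tensor (?u (- (\<tau> *\<^sub>R \<xi>))) x \<partial>lborel) = (\<integral>x. G' x * tensor u (x - \<tau> *\<^sub>R \<xi>) \<partial>lborel)"
        unfolding tensor_translate by simp
      also have "\<dots> = (\<integral>x. G' (x + \<tau> *\<^sub>R \<xi>) * tensor u x \<partial>lborel)"
        using integral_lborel_shift[of "\<lambda>x. G' x * tensor u (x - \<tau> *\<^sub>R \<xi>)" "\<tau> *\<^sub>R \<xi>"] by simp
      finally show "(\<integral>x. indicator {0..t} \<tau> * (G x * dir_deriv \<xi> u (x - \<tau> *\<^sub>R \<xi>)) \<partial>lborel) =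
        - (\<integral>x. indicator {0..t} \<tau> * (G' (x + \<tau> *\<^sub>R \<xi>) * tensor u x) \<partial>lborel)"
        by simp
    qed
    also have "\<dots> = - (\<integral>\<tau>. (\<integral>x. indicator {0..t} \<tau> * (G' (x + \<tau> *\<^sub>R \<xi>) * tensor u x) \<partial>lborel) \<partial>lborel)" by simp
    also have "(\<integral>\<tau>. (\<integral>x. indicator {0..t} \<tau> * (G' (x + \<tau> *\<^sub>R \<xi>) * tensor u x) \<partial>lborel) \<partial>lborel)
      = (\<integral>x. (\<integral>\<tau>. indicator {0..t} \<tau> * (G' (x + \<tau> *\<^sub>R \<xi>) * tensor u x) \<partial>lborel) \<partial>lborel)"
      by (rule lborel_pair.Fubini_integral[symmetric])
        (rule segment_integrable(1)[OF loc(2) _ C tensor_support[OF u] \<xi> t], measurable)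
    also have "\<dots> = (\<integral>x. A x * tensor u x \<partial>lborel)"
      by (simp add: A_def mult.assoc[symmetric])
    finally have eq: "(\<integral>x. fdiff (t *\<^sub>R \<xi>) G x * tensor u x \<partial>lborel) = (\<integral>x. A x * tensor u x \<partial>lborel)" by simp
    show "(\<integral>x. (fdiff (t *\<^sub>R \<xi>) G x - A x) * tensor u x \<partial>lborel) = 0"
      unfolding left_diff_distrib
      by (subst Bochner_Integration.integral_diff)
        (auto simp: eq intro!: integrable_mult_tensor[OF _ u] locally_integrable_fdiff loc A)
  qed
  then show ?thesis by eventually_elim (simp add: A_def)
qed

text \<open>
  The graph of \<open>y\<^sup>p\<close> lies above its tangent at \<open>c\<close>.
\<close>

lemma powr_tangent_bound:
  assumes p: "p \<ge> 1" and c: "c > 0" and y: "y \<ge> (0::real)"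
  shows "p * c powr (p - 1) * y \<le> y powr p + (p - 1) * c powr p"
proof (cases "y = 0")
  case True
  then show ?thesis using p by simp
next
  case False
  have "y powr p - c powr p \<ge> (p * c powr (p - 1)) * (y - c)"
  proof (rule convex_on_imp_above_tangent[OF powr_convex[OF p]])
    show "((\<lambda>x. x powr p) has_real_derivative p * c powr (p - 1)) (at c within {0<..})"
      by (rule has_field_derivative_at_within[OF has_real_derivative_powr[OF c]])
    show "c \<in> interior {0<..}" using c by (simp add: interior_open)
  qed (use y False in auto)
  then have h: "p * c powr (p - 1) * (y - c) \<le> y powr p - c powr p" by simp
  have "c powr (p - 1) * c = c powr p" using c by (simp add: powr_diff)
  then have "p * c powr (p - 1) * (y - c) = p * c powr (p - 1) * y - p * c powr p"
    by (simp only: right_diff_distrib mult.assoc)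
  moreover have "(p - 1) * c powr p = p * c powr p - c powr p" by (simp add: left_diff_distrib)
  ultimately show ?thesis using h by linarith
qed

text \<open>
  Jensen's inequality in a form that allows the right-hand side to be infinite.
\<close>

lemma segment_Jensen:
  fixes g :: "real \<Rightarrow> real"
  assumes [measurable]: "g \<in> borel_measurable borel" and t: "t > 0" and p: "p \<ge> 1"
  shows "ennreal (\<bar>\<integral>\<tau>. indicator {0..t} \<tau> * g \<tau> \<partial>lborel\<bar> powr p) \<le>
    ennreal (t powr (p - 1)) * (\<integral>\<^sup>+\<tau>. ennreal (\<bar>g \<tau>\<bar> powr p) * indicator {0..t} \<tau> \<partial>lborel)"
proof (cases "integrable lborel (\<lambda>\<tau>. indicator {0..t} \<tau> * g \<tau>)")
  case False
  then have "(\<integral>\<tau>. indicator {0..t} \<tau> * g \<tau> \<partial>lborel) = 0" by (rule not_integrable_integral_eq)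
  then show ?thesis by simp
next
  case True
  then have int: "integrable lborel (\<lambda>\<tau>. \<bar>g \<tau>\<bar> * indicator {0..t} \<tau>)"
    using integrable_abs[OF True] by (simp add: abs_mult mult.commute)
  define I where "I = (\<integral>\<tau>. \<bar>g \<tau>\<bar> * indicator {0..t} \<tau> \<partial>lborel)"
  define c where "c = I / t"
  have I0: "I \<ge> 0" unfolding I_def by (intro integral_nonneg_AE) auto
  have le: "\<bar>\<integral>\<tau>. indicator {0..t} \<tau> * g \<tau> \<partial>lborel\<bar> \<le> I"
    unfolding I_def using integral_abs_bound[of lborel "\<lambda>\<tau>. indicator {0..t} \<tau> * g \<tau>"] by (simp add: abs_mult mult.commute)
  define X where "X = (\<integral>\<^sup>+\<tau>. ennreal (\<bar>g \<tau>\<bar> powr p) * indicator {0..t} \<tau> \<partial>lborel)"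
  have key: "ennreal (t * c powr p) \<le> X"
  proof (cases "c = 0 \<or> X = \<infinity>")
    case True
    then show ?thesis by auto
  next
    case False
    then have c: "c > 0" using I0 t by (auto simp: c_def less_le)
    obtain x where x: "X = ennreal x" "x \<ge> 0" using False by (cases X) auto
    have nnI: "(\<integral>\<^sup>+\<tau>. ennreal (\<bar>g \<tau>\<bar> * indicator {0..t} \<tau>) \<partial>lborel) = ennreal I"
      unfolding I_def by (rule nn_integral_eq_integral[OF int]) auto
    have "ennreal (p * c powr (p - 1) * I) = ennreal (p * c powr (p - 1)) * (\<integral>\<^sup>+\<tau>. ennreal (\<bar>g \<tau>\<bar> * indicator {0..t} \<tau>) \<partial>lborel)"
      unfolding nnI using p I0 by (simp add: ennreal_mult)
    also have "\<dots> = (\<integral>\<^sup>+\<tau>. ennreal (p * c powr (p - 1)) * ennreal (\<bar>g \<tau>\<bar> * indicator {0..t} \<tau>) \<partial>lborel)"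
      by (rule nn_integral_cmult[symmetric]) measurable
    also have "\<dots> \<le> (\<integral>\<^sup>+\<tau>. ennreal (\<bar>g \<tau>\<bar> powr p) * indicator {0..t} \<tau> + ennreal ((p - 1) * c powr p) * indicator {0..t} \<tau> \<partial>lborel)"
    proof (rule nn_integral_mono)
      fix \<tau>
      show "ennreal (p * c powr (p - 1)) * ennreal (\<bar>g \<tau>\<bar> * indicator {0..t} \<tau>) \<le>
        ennreal (\<bar>g \<tau>\<bar> powr p) * indicator {0..t} \<tau> + ennreal ((p - 1) * c powr p) * indicator {0..t} \<tau>"
        using powr_tangent_bound[OF p c, of "\<bar>g \<tau>\<bar>"] p
        by (cases "\<tau> \<in> {0..t}") (auto simp: ennreal_mult[symmetric] ennreal_plus[symmetric] simp del: ennreal_plus intro!: ennreal_leI)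
    qed
    also have "\<dots> = X + ennreal ((p - 1) * c powr p) * ennreal t"
      unfolding X_def using t by (subst nn_integral_add) (auto simp: nn_integral_cmult_indicator)
    also have "\<dots> = ennreal (x + (p - 1) * c powr p * t)"
      using x p t by (simp add: ennreal_mult[symmetric] ennreal_plus[symmetric] del: ennreal_plus)
    finally have h1: "p * c powr (p - 1) * I \<le> x + (p - 1) * c powr p * t"
      using x p t by (subst (asm) ennreal_le_iff) auto
    have "c powr (p - 1) * I = c powr p * t"
    proof -
      have "I = c * t" using t by (simp add: c_def)
      moreover have "c powr (p - 1) * c = c powr p" using c by (simp add: powr_diff)
      ultimately show ?thesis by (simp add: mult.assoc[symmetric])
    qed
    then have h2: "p * c powr (p - 1) * I = p * (c powr p * t)" by simp
    have h3: "(p - 1) * c powr p * t = p * (c powr p * t) - c powr p * t" by (simp add: left_diff_distrib)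
    have "t * c powr p \<le> x" using h1 unfolding h2 h3 by (simp add: mult.commute)
    then show ?thesis using x by (simp add: ennreal_leI)
  qed
  have "\<bar>\<integral>\<tau>. indicator {0..t} \<tau> * g \<tau> \<partial>lborel\<bar> powr p \<le> I powr p" using le p by (intro powr_mono2) auto
  also have "I powr p = t powr (p - 1) * (t * c powr p)"
  proof -
    have "I = t * c" using t by (simp add: c_def)
    moreover have "t powr (p - 1) * t = t powr p" using t by (simp add: powr_diff)
    ultimately show ?thesis by (simp add: powr_mult mult.assoc[symmetric])
  qed
  finally have "ennreal (\<bar>\<integral>\<tau>. indicator {0..t} \<tau> * g \<tau> \<partial>lborel\<bar> powr p) \<le> ennreal (t powr (p - 1)) * ennreal (t * c powr p)"
    using t by (simp add: ennreal_mult[symmetric] ennreal_leI)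
  also have "\<dots> \<le> ennreal (t powr (p - 1)) * X" by (intro mult_left_mono key) auto
  finally show ?thesis by (simp add: X_def)
qed

lemma Lpi_fdiff_le_weak_dir_deriv:
  fixes G G' :: "'a::euclidean_space \<Rightarrow> real"
  assumes W: "weak_dir_deriv \<xi> G G'" and \<xi>: "norm \<xi> = 1" and t: "t > 0" and p: "p \<ge> 1"
  shows "Lpi p (fdiff (t *\<^sub>R \<xi>) G) \<le> ennreal (t powr p) * Lpi p G'"
proof -
  have [measurable]: "G' \<in> borel_measurable borel"
    using W by (auto simp: weak_dir_deriv_def intro: locally_integrable_measurable)
  have "Lpi p (fdiff (t *\<^sub>R \<xi>) G) = Lpi p (\<lambda>x. \<integral>\<tau>. indicator {0..t} \<tau> * G' (x + \<tau> *\<^sub>R \<xi>) \<partial>lborel)"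
    using weak_dir_deriv_segment[OF W \<xi>, of t] t by (intro Lpi_cong_AE) auto
  also have "\<dots> \<le> (\<integral>\<^sup>+x. ennreal (t powr (p - 1)) * (\<integral>\<^sup>+\<tau>. ennreal (\<bar>G' (x + \<tau> *\<^sub>R \<xi>)\<bar> powr p) * indicator {0..t} \<tau> \<partial>lborel) \<partial>lborel)"
    unfolding Lpi_def by (intro nn_integral_mono segment_Jensen t p) measurable
  also have "\<dots> = ennreal (t powr (p - 1)) * (\<integral>\<^sup>+x. (\<integral>\<^sup>+\<tau>. ennreal (\<bar>G' (x + \<tau> *\<^sub>R \<xi>)\<bar> powr p) * indicator {0..t} \<tau> \<partial>lborel) \<partial>lborel)"
    by (rule nn_integral_cmult) measurable
  also have "(\<integral>\<^sup>+x. (\<integral>\<^sup>+\<tau>. ennreal (\<bar>G' (x + \<tau> *\<^sub>R \<xi>)\<bar> powr p) * indicator {0..t} \<tau> \<partial>lborel) \<partial>lborel)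
     = (\<integral>\<^sup>+\<tau>. (\<integral>\<^sup>+x. ennreal (\<bar>G' (x + \<tau> *\<^sub>R \<xi>)\<bar> powr p) * indicator {0..t} \<tau> \<partial>lborel) \<partial>lborel)"
    by (rule lborel_pair.Fubini'[symmetric]) measurable
  also have "\<dots> = (\<integral>\<^sup>+\<tau>. Lpi p G' * indicator {0..t} \<tau> \<partial>lborel)"
  proof (rule nn_integral_cong)
    fix \<tau> :: real
    have "(\<integral>\<^sup>+x. ennreal (\<bar>G' (x + \<tau> *\<^sub>R \<xi>)\<bar> powr p) * indicator {0..t} \<tau> \<partial>lborel) = Lpi p (\<lambda>x. G' (x + \<tau> *\<^sub>R \<xi>)) * indicator {0..t} \<tau>"
      unfolding Lpi_def by (rule nn_integral_multc) measurable
    then show "(\<integral>\<^sup>+x. ennreal (\<bar>G' (x + \<tau> *\<^sub>R \<xi>)\<bar> powr p) * indicator {0..t} \<tau> \<partial>lborel) = Lpi p G' * indicator {0..t} \<tau>"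
      by (simp add: Lpi_shift)
  qed
  also have "\<dots> = Lpi p G' * ennreal t" using t by (subst nn_integral_cmult_indicator) auto
  also have "ennreal (t powr (p - 1)) * (Lpi p G' * ennreal t) = ennreal (t powr p) * Lpi p G'"
  proof -
    have "t powr (p - 1) * t = t powr p" using t by (simp add: powr_diff)
    then have "ennreal (t powr p) = ennreal (t powr (p - 1)) * ennreal t" using t by (simp add: ennreal_mult[symmetric])
    then show ?thesis by (simp add: mult_ac)
  qed
  finally show ?thesis .
qed

lemma weak_dir_deriv_fdiff_pow: "weak_dir_deriv \<xi> G G' \<Longrightarrow> weak_dir_deriv \<xi> ((fdiff a ^^ m) G) ((fdiff a ^^ m) G')"
  by (induction m) (auto intro: weak_dir_deriv_fdiff)

text \<open>
  Differences commute with weak derivatives, so that each of the \<open>k\<close> differences can be exchanged for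
  one derivative.
\<close>

lemma Lpi_fdiff_pow_le_weak_dir_deriv:
  fixes G :: "nat \<Rightarrow> 'a::euclidean_space \<Rightarrow> real"
  assumes W: "\<And>j. j < k \<Longrightarrow> weak_dir_deriv \<xi> (G j) (G (Suc j))" and \<xi>: "norm \<xi> = 1" and t: "t > 0" and p: "p \<ge> 1"
  shows "Lpi p ((fdiff (t *\<^sub>R \<xi>) ^^ k) (G 0)) \<le> ennreal (t powr p) ^ k * Lpi p (G k)"
  using W
proof (induction k arbitrary: G)
  case (Suc k)
  have "Lpi p ((fdiff (t *\<^sub>R \<xi>) ^^ Suc k) (G 0)) \<le> ennreal (t powr p) * Lpi p ((fdiff (t *\<^sub>R \<xi>) ^^ k) (G 1))"
    using Lpi_fdiff_le_weak_dir_deriv[OF weak_dir_deriv_fdiff_pow[OF Suc.prems[of 0]] \<xi> t p] by simp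
  also have "\<dots> \<le> ennreal (t powr p) * (ennreal (t powr p) ^ k * Lpi p (G (Suc k)))"
    using Suc.IH[of "\<lambda>j. G (Suc j)"] Suc.prems by (intro mult_left_mono) auto
  finally show ?case by (simp add: mult.assoc)
qed simp

section \<open>Interpolation and polarization of forms\<close>

text \<open>
  The weights are the coefficients of a divided difference of order \<open>n\<close>.
\<close>

lemma Lagrange_leading_coefficient:
  fixes \<tau> :: "nat \<Rightarrow> real"
  assumes sep: "\<And>i j. i \<le> n \<Longrightarrow> j \<le> n \<Longrightarrow> i \<noteq> j \<Longrightarrow> \<eta> \<le> \<bar>\<tau> i - \<tau> j\<bar>" and \<eta>: "\<eta> > 0"
  shows "\<exists>w. (\<forall>i\<le>n. \<bar>w i\<bar> \<le> (1 / \<eta>) ^ n) \<and> (\<forall>P. degree P \<le> n \<longrightarrow> coeff P n = (\<Sum>i\<le>n. w i * poly P (\<tau> i)))"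
proof -
  define B where "B i = (\<Prod>j\<in>{..n} - {i}. [:- \<tau> j, 1:])" for i
  define w where "w i = (\<Prod>j\<in>{..n} - {i}. 1 / (\<tau> i - \<tau> j))" for i
  have ne: "\<tau> i \<noteq> \<tau> j" if "i \<le> n" "j \<le> n" "i \<noteq> j" for i j using sep[OF that] \<eta> by auto
  have card: "card ({..n} - {i}) = n" if "i \<le> n" for i using that by simp
  have degB: "degree (B i) = n" if "i \<le> n" for i
    using card[OF that] unfolding B_def by (subst degree_prod_eq_sum_degree) auto
  have lcB: "coeff (B i) n = 1" if "i \<le> n" for i
    using lead_coeff_prod[of "\<lambda>j. [:- \<tau> j, 1:]" "{..n} - {i}"] degB[OF that] by (simp add: B_def)
  have polyB: "poly (B i) (\<tau> i) * w i = 1" if "i \<le> n" for i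
    unfolding B_def w_def poly_prod prod.distrib[symmetric]
    using ne[OF that] by (intro prod.neutral) (auto simp: that)
  have polyB0: "poly (B i) (\<tau> l) = 0" if "i \<le> n" "l \<le> n" "i \<noteq> l" for i l
    unfolding B_def poly_prod using that by (intro prod_zero) auto
  have wb: "\<bar>w i\<bar> \<le> (1 / \<eta>) ^ n" if "i \<le> n" for i
  proof -
    have "\<bar>w i\<bar> = (\<Prod>j\<in>{..n} - {i}. \<bar>1 / (\<tau> i - \<tau> j)\<bar>)" by (simp add: w_def abs_prod)
    also have "\<dots> \<le> (\<Prod>j\<in>{..n} - {i}. 1 / \<eta>)"
    proof (intro prod_mono conjI)
      fix j assume j: "j \<in> {..n} - {i}"
      have "\<eta> \<le> \<bar>\<tau> i - \<tau> j\<bar>" using sep[OF that] j by auto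
      then show "\<bar>1 / (\<tau> i - \<tau> j)\<bar> \<le> 1 / \<eta>" using \<eta> unfolding abs_divide by (simp add: frac_le)
    qed simp
    also have "\<dots> = (1 / \<eta>) ^ n" using card[OF that] by simp
    finally show ?thesis .
  qed
  have lead: "coeff P n = (\<Sum>i\<le>n. w i * poly P (\<tau> i))" if P: "degree P \<le> n" for P
  proof -
    define R where "R = P - (\<Sum>i\<le>n. smult (w i * poly P (\<tau> i)) (B i))"
    have "degree (\<Sum>i\<le>n. smult (w i * poly P (\<tau> i)) (B i)) \<le> n"
      using degB by (intro degree_sum_le order_trans[OF degree_smult_le]) auto
    then have "degree R \<le> n" unfolding R_def using P by (intro degree_diff_le)
    moreover have "R = 0 \<or> n < degree R"
    proof (rule disjCI, rule ccontr)
      assume R: "\<not> n < degree R" and "R \<noteq> 0"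
      have "poly R (\<tau> l) = 0" if l: "l \<le> n" for l
      proof -
        have "poly R (\<tau> l) = poly P (\<tau> l) - (\<Sum>i\<le>n. w i * poly P (\<tau> i) * poly (B i) (\<tau> l))"
          by (simp add: R_def poly_sum)
        also have "(\<Sum>i\<le>n. w i * poly P (\<tau> i) * poly (B i) (\<tau> l)) = (\<Sum>i\<le>n. if i = l then poly P (\<tau> l) else 0)"
        proof (rule sum.cong[OF refl])
          fix i assume "i \<in> {..n}"
          then show "w i * poly P (\<tau> i) * poly (B i) (\<tau> l) = (if i = l then poly P (\<tau> l) else 0)"
            using polyB[of i] polyB0[of i l] l by (auto simp: mult_ac)
        qed
        finally show ?thesis using l by simp
      qed
      then have "\<tau> ` {..n} \<subseteq> {x. poly R x = 0}" by auto
      then have "card (\<tau> ` {..n}) \<le> card {x. poly R x = 0}" by (intro card_mono poly_roots_finite \<open>R \<noteq> 0\<close>)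
      also have "\<dots> \<le> degree R" using \<open>R \<noteq> 0\<close> by (rule card_poly_roots_bound)
      also have "card (\<tau> ` {..n}) = Suc n" using ne by (subst card_image) (auto simp: inj_on_def)
      finally show False using R by simp
    qed
    ultimately have "R = 0" by auto
    then have "coeff P n = coeff (\<Sum>i\<le>n. smult (w i * poly P (\<tau> i)) (B i)) n" by (simp add: R_def)
    also have "\<dots> = (\<Sum>i\<le>n. w i * poly P (\<tau> i))" using lcB by (simp add: coeff_sum)
    finally show ?thesis .
  qed
  show ?thesis using wb lead by blast
qed

lemma prod_linear_poly:
  fixes a b :: "nat \<Rightarrow> real"
  shows "degree (\<Prod>i<k. [:a i, b i:]) \<le> k \<and> coeff (\<Prod>i<k. [:a i, b i:]) k = (\<Prod>i<k. b i)"
proof (induction k)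
  case (Suc k)
  define P where "P = (\<Prod>i<k. [:a i, b i:])"
  have P: "degree P \<le> k" "coeff P k = (\<Prod>i<k. b i)" using Suc by (auto simp: P_def)
  have eq: "(\<Prod>i<Suc k. [:a i, b i:]) = [:a k, b k:] * P" by (simp add: P_def mult.commute)
  have "degree ([:a k, b k:] * P) \<le> degree [:a k, b k:] + degree P" by (rule degree_mult_le)
  moreover have "degree [:a k, b k:] \<le> 1" by simp
  ultimately have "degree ([:a k, b k:] * P) \<le> Suc k" using P(1) by linarith
  moreover have "coeff ([:a k, b k:] * P) (Suc k) = b k * coeff P k"
    using P(1) by (simp add: coeff_eq_0)
  ultimately show ?case unfolding eq P(2) by (simp add: mult.commute)
qed simp

definition basis_lists :: "nat \<Rightarrow> 'a::euclidean_space list set" where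
  "basis_lists k = {bs. set bs \<subseteq> Basis \<and> length bs = k}"

lemma finite_basis_lists: "finite (basis_lists k)"
  unfolding basis_lists_def by (rule finite_lists_length_eq) simp

text \<open>
  The value on the diagonal of the multilinear form with coefficients \<open>c\<close>, a form of degree \<open>k\<close> in \<open>\<xi>\<close>.
\<close>

definition tensor_form :: "nat \<Rightarrow> ('a::euclidean_space list \<Rightarrow> real) \<Rightarrow> 'a \<Rightarrow> real" where
  "tensor_form k c \<xi> = (\<Sum>bs\<in>basis_lists k. c bs * (\<Prod>i<k. \<xi> \<bullet> (bs ! i)))"

lemma tensor_form_scale: "tensor_form k c (a *\<^sub>R \<xi>) = a ^ k * tensor_form k c \<xi>"
  by (simp add: tensor_form_def prod.distrib sum_distrib_left mult_ac)

text \<open>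
  Along the line \<open>x + \<tau> e\<close> the form is a polynomial in \<open>\<tau>\<close> of degree at most \<open>k\<close> whose
  coefficient of \<open>\<tau>\<^sup>k\<close> is the value at \<open>e\<close>.
\<close>

lemma tensor_form_leading_coefficient:
  assumes w: "\<And>P. degree P \<le> k \<Longrightarrow> coeff P k = (\<Sum>i\<le>k. w i * poly P (\<tau> i))"
  shows "tensor_form k c e = (\<Sum>i\<le>k. w i * tensor_form k c (x + \<tau> i *\<^sub>R e))"
proof -
  have "(\<Prod>l<k. e \<bullet> (bs ! l)) = (\<Sum>i\<le>k. w i * (\<Prod>l<k. (x + \<tau> i *\<^sub>R e) \<bullet> (bs ! l)))" for bs
  proof -
    let ?P = "\<Prod>l<k. [:x \<bullet> (bs ! l), e \<bullet> (bs ! l):]"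
    have "(\<Prod>l<k. e \<bullet> (bs ! l)) = coeff ?P k" using prod_linear_poly[where a="\<lambda>l. x \<bullet> (bs ! l)" and b="\<lambda>l. e \<bullet> (bs ! l)" and k=k] by simp
    also have "\<dots> = (\<Sum>i\<le>k. w i * poly ?P (\<tau> i))"
      using prod_linear_poly[where a="\<lambda>l. x \<bullet> (bs ! l)" and b="\<lambda>l. e \<bullet> (bs ! l)" and k=k] by (intro w) simp
    finally show ?thesis by (simp add: poly_prod inner_add_left)
  qed
  then have "tensor_form k c e = (\<Sum>bs\<in>basis_lists k. \<Sum>i\<le>k. c bs * (w i * (\<Prod>l<k. (x + \<tau> i *\<^sub>R e) \<bullet> (bs ! l))))"
    by (simp add: tensor_form_def sum_distrib_left)
  also have "\<dots> = (\<Sum>i\<le>k. \<Sum>bs\<in>basis_lists k. c bs * (w i * (\<Prod>l<k. (x + \<tau> i *\<^sub>R e) \<bullet> (bs ! l))))"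
    by (rule sum.swap)
  also have "\<dots> = (\<Sum>i\<le>k. w i * tensor_form k c (x + \<tau> i *\<^sub>R e))"
    by (simp add: tensor_form_def sum_distrib_left mult_ac)
  finally show ?thesis .
qed

text \<open>
  The sum factors over the coordinates \<open>i\<close>. A factor whose \<open>i\<close> is not in the image of \<open>\<phi>\<close> is
  \<open>1 + (-1) = 0\<close>; if \<open>\<phi>\<close> is a permutation every factor is \<open>1 + 1\<close>.
\<close>

lemma sign_sum_over_maps:
  assumes \<phi>: "\<phi> \<in> PiE {..<k} (\<lambda>_. {..<k})"
  shows "(\<Sum>\<epsilon>\<in>PiE {..<k} (\<lambda>_. {-1, 1::real}). (\<Prod>i<k. \<epsilon> i) * (\<Prod>l<k. \<epsilon> (\<phi> l))) =
     (if \<phi> ` {..<k} = {..<k} then 2 ^ k else 0)"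
proof -
  \<comment> \<open>The sign of index \<open>i\<close> occurs once in the first product and \<open>n i\<close> times in the second.\<close>
  define n where "n i = card {l\<in>{..<k}. \<phi> l = i}" for i
  have "(\<Prod>l<k. \<epsilon> (\<phi> l)) = (\<Prod>i<k. \<epsilon> i ^ n i)" for \<epsilon> :: "nat \<Rightarrow> real"
  proof -
    have "(\<Prod>l<k. \<epsilon> (\<phi> l)) = (\<Prod>i<k. \<Prod>l\<in>{l\<in>{..<k}. \<phi> l = i}. \<epsilon> (\<phi> l))"
      by (rule prod.group[symmetric]) (use \<phi> in \<open>auto simp: PiE_iff\<close>)
    also have "\<dots> = (\<Prod>i<k. \<epsilon> i ^ n i)" by (intro prod.cong) (auto simp: n_def)
    finally show ?thesis .
  qed
  then have "(\<Sum>\<epsilon>\<in>PiE {..<k} (\<lambda>_. {-1, 1::real}). (\<Prod>i<k. \<epsilon> i) * (\<Prod>l<k. \<epsilon> (\<phi> l))) =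
    (\<Sum>\<epsilon>\<in>PiE {..<k} (\<lambda>_. {-1, 1::real}). \<Prod>i<k. \<epsilon> i ^ Suc (n i))"
    by (simp add: prod.distrib[symmetric])
  also have "\<dots> = (\<Prod>i<k. \<Sum>e\<in>{-1, 1::real}. e ^ Suc (n i))" by (rule prod_sum_PiE[symmetric]) auto
  also have "\<dots> = (if \<phi> ` {..<k} = {..<k} then 2 ^ k else 0)"
  proof (cases "\<phi> ` {..<k} = {..<k}")
    case True
    then have inj: "inj_on \<phi> {..<k}" by (intro eq_card_imp_inj_on) auto
    have "n i = 1" if "i < k" for i
    proof -
      obtain l where l: "l < k" "\<phi> l = i" using True \<open>i < k\<close> by (metis imageE lessThan_iff)
      then have "{l\<in>{..<k}. \<phi> l = i} = {l}" using inj by (auto simp: inj_on_def)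
      then show ?thesis by (simp add: n_def)
    qed
    then show ?thesis using True by simp
  next
    case False
    moreover have "\<phi> ` {..<k} \<subseteq> {..<k}" using \<phi> by (auto simp: PiE_iff)
    ultimately obtain i where i: "i < k" "i \<notin> \<phi> ` {..<k}" by auto
    then have "n i = 0" by (auto simp: n_def)
    then have "(\<Prod>i<k. \<Sum>e\<in>{-1, 1::real}. e ^ Suc (n i)) = 0" using i(1) by (intro prod_zero) (auto intro!: bexI[of _ i])
    then show ?thesis using False by simp
  qed
  finally show ?thesis .
qed

text \<open>
  Polarization with random signs: the average of \<open>(\<Prod>i. \<epsilon>\<^sub>i)\<close> times the form at \<open>\<Sum>i. \<epsilon>\<^sub>i b\<^sub>i\<close> keeps
  exactly the coefficients at permutations of \<open>b\<close>, which are all equal by symmetry.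
\<close>

lemma polarization_bound:
  fixes c :: "'a::euclidean_space list \<Rightarrow> real"
  assumes sym: "\<And>as bs. as \<in> basis_lists k \<Longrightarrow> bs \<in> basis_lists k \<Longrightarrow> mset as = mset bs \<Longrightarrow> c as = c bs"
    and b: "b \<in> basis_lists k"
  shows "\<bar>c b\<bar> \<le> (\<Sum>\<epsilon>\<in>PiE {..<k} (\<lambda>_. {-1, 1::real}). \<bar>tensor_form k c (\<Sum>i<k. \<epsilon> i *\<^sub>R (b ! i))\<bar>)"
proof -
  let ?E = "PiE {..<k} (\<lambda>_. {-1, 1::real})" and ?M = "PiE {..<k} (\<lambda>_. {..<k})"
  define m where "m \<phi> = map (\<lambda>l. b ! \<phi> l) [0..<k]" for \<phi> :: "nat \<Rightarrow> nat"
  have bB: "b ! i \<in> Basis" if "i < k" for i using b that by (auto simp: basis_lists_def)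
  have mB: "m \<phi> \<in> basis_lists k" if "\<phi> \<in> ?M" for \<phi>
    using that bB by (auto simp: m_def basis_lists_def PiE_iff)
  have finM: "finite ?M" and finE: "finite ?E" by (auto intro!: finite_PiE)
  have expand: "tensor_form k c (\<Sum>i<k. \<epsilon> i *\<^sub>R (b ! i)) = (\<Sum>\<phi>\<in>?M. (\<Prod>l<k. \<epsilon> (\<phi> l)) * c (m \<phi>))" for \<epsilon>
  proof -
    have "(\<Prod>l<k. (\<Sum>i<k. \<epsilon> i *\<^sub>R (b ! i)) \<bullet> (bs ! l)) = (\<Sum>\<phi>\<in>?M. (\<Prod>l<k. \<epsilon> (\<phi> l)) * (if bs = m \<phi> then 1 else 0))"
      if bs: "bs \<in> basis_lists k" for bs
    proof -
      have bsB: "bs ! l \<in> Basis" "length bs = k" if "l < k" for l using bs that by (auto simp: basis_lists_def)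
      have len: "length bs = k" using bs by (simp add: basis_lists_def)
      have "(\<Prod>l<k. (\<Sum>i<k. \<epsilon> i *\<^sub>R (b ! i)) \<bullet> (bs ! l)) = (\<Prod>l<k. \<Sum>i<k. \<epsilon> i * (if b ! i = bs ! l then 1 else 0))"
        using bsB bB by (intro prod.cong refl) (simp add: inner_sum_left inner_Basis)
      also have "\<dots> = (\<Sum>\<phi>\<in>?M. \<Prod>l<k. \<epsilon> (\<phi> l) * (if b ! \<phi> l = bs ! l then 1 else 0))"
        by (rule prod_sum_PiE) auto
      also have "\<dots> = (\<Sum>\<phi>\<in>?M. (\<Prod>l<k. \<epsilon> (\<phi> l)) * (if bs = m \<phi> then 1 else 0))"
      proof (intro sum.cong refl)
        fix \<phi> assume "\<phi> \<in> ?M"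
        have "(\<Prod>l<k. if b ! \<phi> l = bs ! l then 1 else 0) = (if bs = m \<phi> then 1 else (0::real))"
        proof (cases "bs = m \<phi>")
          case True
          then show ?thesis by (simp add: m_def)
        next
          case False
          then obtain l where "l < k" "bs ! l \<noteq> m \<phi> ! l" using len by (metis length_map length_upt minus_nat.diff_0 m_def nth_equalityI)
          then have "l < k" "b ! \<phi> l \<noteq> bs ! l" by (auto simp: m_def)
          then have "(\<Prod>l<k. if b ! \<phi> l = bs ! l then 1 else (0::real)) = 0" by (intro prod_zero) auto
          then show ?thesis using False by simp
        qed
        then show "(\<Prod>l<k. \<epsilon> (\<phi> l) * (if b ! \<phi> l = bs ! l then 1 else 0)) = (\<Prod>l<k. \<epsilon> (\<phi> l)) * (if bs = m \<phi> then 1 else 0)"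
          by (simp only: prod.distrib)
      qed
      finally show ?thesis .
    qed
    then have "tensor_form k c (\<Sum>i<k. \<epsilon> i *\<^sub>R (b ! i)) = (\<Sum>bs\<in>basis_lists k. \<Sum>\<phi>\<in>?M. c bs * ((\<Prod>l<k. \<epsilon> (\<phi> l)) * (if bs = m \<phi> then 1 else 0)))"
      by (simp add: tensor_form_def sum_distrib_left)
    also have "\<dots> = (\<Sum>\<phi>\<in>?M. \<Sum>bs\<in>basis_lists k. c bs * ((\<Prod>l<k. \<epsilon> (\<phi> l)) * (if bs = m \<phi> then 1 else 0)))"
      by (rule sum.swap)
    also have "\<dots> = (\<Sum>\<phi>\<in>?M. (\<Prod>l<k. \<epsilon> (\<phi> l)) * c (m \<phi>))"
    proof (rule sum.cong[OF refl])
      fix \<phi> assume "\<phi> \<in> ?M"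
      have "(\<Sum>bs\<in>basis_lists k. c bs * ((\<Prod>l<k. \<epsilon> (\<phi> l)) * (if bs = m \<phi> then 1 else 0))) =
        (\<Sum>bs\<in>basis_lists k. if bs = m \<phi> then (\<Prod>l<k. \<epsilon> (\<phi> l)) * c (m \<phi>) else 0)"
        by (intro sum.cong) auto
      then show "(\<Sum>bs\<in>basis_lists k. c bs * ((\<Prod>l<k. \<epsilon> (\<phi> l)) * (if bs = m \<phi> then 1 else 0))) = (\<Prod>l<k. \<epsilon> (\<phi> l)) * c (m \<phi>)"
        using mB[OF \<open>\<phi> \<in> ?M\<close>] by (simp add: finite_basis_lists)
    qed
    finally show ?thesis .
  qed
  let ?S = "{\<phi> \<in> ?M. \<phi> ` {..<k} = {..<k}}"
  have "(\<Sum>\<epsilon>\<in>?E. (\<Prod>i<k. \<epsilon> i) * tensor_form k c (\<Sum>i<k. \<epsilon> i *\<^sub>R (b ! i))) =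
     (\<Sum>\<epsilon>\<in>?E. \<Sum>\<phi>\<in>?M. c (m \<phi>) * ((\<Prod>i<k. \<epsilon> i) * (\<Prod>l<k. \<epsilon> (\<phi> l))))"
    unfolding expand by (simp add: sum_distrib_left mult_ac)
  also have "\<dots> = (\<Sum>\<phi>\<in>?M. \<Sum>\<epsilon>\<in>?E. c (m \<phi>) * ((\<Prod>i<k. \<epsilon> i) * (\<Prod>l<k. \<epsilon> (\<phi> l))))" by (rule sum.swap)
  also have "\<dots> = (\<Sum>\<phi>\<in>?M. c (m \<phi>) * (if \<phi> ` {..<k} = {..<k} then 2 ^ k else 0))"
    unfolding sum_distrib_left[symmetric] by (intro sum.cong refl arg_cong2[where f="(*)"] sign_sum_over_maps)
  also have "\<dots> = (\<Sum>\<phi>\<in>?M. if \<phi> ` {..<k} = {..<k} then c b * 2 ^ k else 0)"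
  proof (rule sum.cong[OF refl])
    fix \<phi> assume \<phi>: "\<phi> \<in> ?M"
    show "c (m \<phi>) * (if \<phi> ` {..<k} = {..<k} then 2 ^ k else 0) = (if \<phi> ` {..<k} = {..<k} then c b * 2 ^ k else 0)"
    proof (cases "\<phi> ` {..<k} = {..<k}")
      case True
      then have "inj_on \<phi> {..<k}" by (intro eq_card_imp_inj_on) auto
      then have bij: "bij_betw \<phi> {..<k} {..<k}" using True by (simp add: bij_betw_def)
      have len: "length b = k" using b by (simp add: basis_lists_def)
      have "mset (m \<phi>) = image_mset (\<lambda>i. b ! i) (image_mset \<phi> (mset_set {..<k}))"
        by (simp add: m_def mset_upt atLeast0LessThan multiset.map_comp o_def)
      also have "image_mset \<phi> (mset_set {..<k}) = mset_set {..<k}"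
        using \<open>inj_on \<phi> {..<k}\<close> True by (simp add: image_mset_mset_set)
      also have "image_mset (\<lambda>i. b ! i) (mset_set {..<k}) = mset (map (\<lambda>i. b ! i) [0..<k])"
        by (simp add: mset_upt atLeast0LessThan)
      also have "map (\<lambda>i. b ! i) [0..<k] = b" using len by (metis map_nth)
      finally have "c (m \<phi>) = c b" by (intro sym mB \<phi> b)
      then show ?thesis using True by simp
    qed simp
  qed
  also have "\<dots> = (\<Sum>\<phi>\<in>?S. c b * 2 ^ k)"
    by (rule sum.inter_filter[OF finM, symmetric])
  also have "\<dots> = real (card ?S) * (c b * 2 ^ k)" by simp
  finally have eq: "real (card ?S) * (c b * 2 ^ k) = (\<Sum>\<epsilon>\<in>?E. (\<Prod>i<k. \<epsilon> i) * tensor_form k c (\<Sum>i<k. \<epsilon> i *\<^sub>R (b ! i)))" by simp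
  \<comment> \<open>The identity is a permutation, so the count of permutations does not vanish.\<close>
  have "restrict id {..<k} \<in> ?S" by auto
  moreover have "finite ?S" using finM by simp
  ultimately have "card ?S > 0" unfolding card_gt_0_iff by blast
  then have "card ?S \<ge> 1" by simp
  then have "real (card ?S) * 2 ^ k \<ge> 1 * 1" by (intro mult_mono) auto
  then have "\<bar>c b\<bar> \<le> \<bar>c b\<bar> * (real (card ?S) * 2 ^ k)" by (simp add: mult_le_cancel_left1)
  also have "\<dots> = \<bar>real (card ?S) * (c b * 2 ^ k)\<bar>" by (simp add: abs_mult)
  also have "\<dots> \<le> (\<Sum>\<epsilon>\<in>?E. \<bar>(\<Prod>i<k. \<epsilon> i) * tensor_form k c (\<Sum>i<k. \<epsilon> i *\<^sub>R (b ! i))\<bar>)"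
    unfolding eq by (rule sum_abs)
  also have "\<dots> = (\<Sum>\<epsilon>\<in>?E. \<bar>tensor_form k c (\<Sum>i<k. \<epsilon> i *\<^sub>R (b ! i))\<bar>)"
  proof (intro sum.cong refl)
    fix \<epsilon> assume "\<epsilon> \<in> ?E"
    then have "\<bar>\<epsilon> i\<bar> = 1" if "i < k" for i
    proof -
      have "i \<in> {..<k}" using that by simp
      from PiE_mem[OF \<open>\<epsilon> \<in> ?E\<close> this] show ?thesis by auto
    qed
    then have "\<bar>\<Prod>i<k. \<epsilon> i\<bar> = 1" by (simp add: abs_prod)
    then show "\<bar>(\<Prod>i<k. \<epsilon> i) * tensor_form k c (\<Sum>i<k. \<epsilon> i *\<^sub>R (b ! i))\<bar> = \<bar>tensor_form k c (\<Sum>i<k. \<epsilon> i *\<^sub>R (b ! i))\<bar>"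
      by (simp add: abs_mult)
  qed
  finally show ?thesis .
qed

lemma Lpi_sum:
  assumes "finite I" and m: "\<And>i. i \<in> I \<Longrightarrow> h i \<in> borel_measurable borel" and p: "p \<ge> 1"
  shows "Lpi p (\<lambda>x. \<Sum>i\<in>I. h i x) \<le> ennreal ((2 powr p) ^ card I) * (\<Sum>i\<in>I. Lpi p (h i))"
  using assms(1) m
proof (induction I rule: finite_induct)
  case empty
  then show ?case by (simp add: Lpi_def)
next
  case (insert a I)
  have b1: "1 \<le> 2 powr p" using p ge_one_powr_ge_zero[of 2 p] by simp
  have "Lpi p (\<lambda>x. \<Sum>i\<in>insert a I. h i x) = Lpi p (\<lambda>x. h a x + (\<Sum>i\<in>I. h i x))"
    using insert by simp
  also have "\<dots> \<le> ennreal (2 powr p) * (Lpi p (h a) + Lpi p (\<lambda>x. \<Sum>i\<in>I. h i x))"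
    using insert by (intro Lpi_add p) auto
  also have "\<dots> \<le> ennreal (2 powr p) * (ennreal ((2 powr p) ^ card I) * Lpi p (h a) + ennreal ((2 powr p) ^ card I) * (\<Sum>i\<in>I. Lpi p (h i)))"
  proof (intro mult_left_mono add_mono)
    have "1 \<le> ennreal ((2 powr p) ^ card I)" using one_le_power[OF b1] ennreal_leI by fastforce
    then show "Lpi p (h a) \<le> ennreal ((2 powr p) ^ card I) * Lpi p (h a)"
      using mult_right_mono[of 1 _ "Lpi p (h a)"] by simp
    show "Lpi p (\<lambda>x. \<Sum>i\<in>I. h i x) \<le> ennreal ((2 powr p) ^ card I) * (\<Sum>i\<in>I. Lpi p (h i))"
      using insert by auto
  qed auto
  also have "\<dots> = ennreal ((2 powr p) ^ card (insert a I)) * (\<Sum>i\<in>insert a I. Lpi p (h i))"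
    using insert by (simp add: ennreal_mult distrib_left[symmetric] mult.assoc)
  finally show ?case .
qed

section \<open>The integer case\<close>

lemma L1_loc_representative:
  fixes F c :: "'a::euclidean_space \<Rightarrow> real"
  assumes F: "F \<in> L1_loc" and c [measurable]: "c \<in> borel_measurable borel" and eq: "AE x in lborel. F x = c x"
  shows "locally_integrable c"
    and "\<And>\<phi>. \<phi> \<in> borel_measurable borel \<Longrightarrow> (\<integral>x. F x * \<phi> x \<partial>lebesgue) = (\<integral>x. c x * \<phi> x \<partial>lborel)"
proof -
  have Fm [measurable]: "F \<in> borel_measurable lebesgue" using F by (simp add: L1_loc_def)
  have cm: "c \<in> borel_measurable lebesgue" by (rule measurable_completion) simp
  have eq': "AE x in lebesgue. F x = c x" using eq by (rule AE_completion)
  show "locally_integrable c"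
    unfolding locally_integrable_def
  proof (intro conjI allI)
    fix r
    have "set_integrable lebesgue (cball 0 r) F" using F by (simp add: L1_loc_def)
    then have 1: "integrable lebesgue (\<lambda>x. F x * indicator (cball 0 r) x)"
      by (simp add: set_integrable_def mult.commute)
    have "integrable lebesgue (\<lambda>x. c x * indicator (cball 0 r) x)"
    proof (rule Bochner_Integration.integrable_cong_AE_imp[OF 1])
      have "(\<lambda>x. c x * indicator (cball 0 r) x) \<in> borel_measurable lborel"
        by (intro borel_measurable_times borel_measurable_indicator) auto
      then show "(\<lambda>x. c x * indicator (cball 0 r) x) \<in> borel_measurable lebesgue" by (rule measurable_completion)
      show "AE x in lebesgue. F x * indicator (cball 0 r) x = c x * indicator (cball 0 r) x"
        using eq' by eventually_elim simp
    qed
    then show "integrable lborel (\<lambda>x. c x * indicator (cball 0 r) x)"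
      by (subst (asm) integrable_completion) (auto intro!: borel_measurable_times borel_measurable_indicator)
  qed fact
  fix \<phi> :: "'a \<Rightarrow> real" assume \<phi> [measurable]: "\<phi> \<in> borel_measurable borel"
  have \<phi>m: "\<phi> \<in> borel_measurable lebesgue" by (rule measurable_completion) simp
  have "(\<integral>x. F x * \<phi> x \<partial>lebesgue) = (\<integral>x. c x * \<phi> x \<partial>lebesgue)"
  proof (rule integral_cong_AE)
    show "(\<lambda>x. F x * \<phi> x) \<in> borel_measurable lebesgue" using Fm \<phi>m by (rule borel_measurable_times)
    show "(\<lambda>x. c x * \<phi> x) \<in> borel_measurable lebesgue" using cm \<phi>m by (rule borel_measurable_times)
    show "AE x in lebesgue. F x * \<phi> x = c x * \<phi> x" using eq' by eventually_elim simp
  qed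
  also have "\<dots> = (\<integral>x. c x * \<phi> x \<partial>lborel)" by (rule integral_completion) measurable
  finally show "(\<integral>x. F x * \<phi> x \<partial>lebesgue) = (\<integral>x. c x * \<phi> x \<partial>lborel)" .
qed

text \<open>
  Borel representatives of all weak partial derivatives. The one of order 0 is set to \<open>g\<close>, so that
  the chain of directional derivatives starts at \<open>g\<close> itself.
\<close>

lemma weak_partial_representatives:
  fixes f g :: "'a::euclidean_space \<Rightarrow> real"
  assumes f: "f \<in> Wk1_loc k" and g: "g \<in> borel_measurable borel" "AE x in lborel. f x = g x"
  obtains c where "c [] = g"
    "\<And>bs. set bs \<subseteq> Basis \<Longrightarrow> length bs \<le> k \<Longrightarrow> locally_integrable (c bs)"
    "\<And>bs. set bs \<subseteq> Basis \<Longrightarrow> length bs \<le> k \<Longrightarrow> bs \<noteq> [] \<Longrightarrow> AE x in lborel. weak_partial bs f x = c bs x"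
    "\<And>bs r u. set bs \<subseteq> Basis \<Longrightarrow> length bs \<le> k \<Longrightarrow> bump_factors r u \<Longrightarrow>
       (\<integral>x. g x * iter_partial bs (tensor u) x \<partial>lborel) = (-1) ^ length bs * (\<integral>x. c bs x * tensor u x \<partial>lborel)"
proof -
  have fL: "f \<in> L1_loc" using f by (simp add: Wk1_loc_def)
  note gr = L1_loc_representative[OF fL g]
  have wp: "is_weak_partial bs f (weak_partial bs f)" if "set bs \<subseteq> Basis" "length bs \<le> k" for bs
  proof -
    have "\<exists>h. is_weak_partial bs f h" using f that by (auto simp: Wk1_loc_def)
    then show ?thesis unfolding weak_partial_def by (rule someI_ex)
  qed
  have "\<exists>c. c \<in> borel_measurable borel \<and> (AE x in lborel. weak_partial bs f x = c x)" if "set bs \<subseteq> Basis" "length bs \<le> k" for bs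
    using completion_ex_borel_measurable_real[of "weak_partial bs f" lborel] wp[OF that]
    by (auto simp: is_weak_partial_def L1_loc_def)
  then have "\<forall>bs. \<exists>c. set bs \<subseteq> Basis \<and> length bs \<le> k \<longrightarrow> c \<in> borel_measurable borel \<and> (AE x in lborel. weak_partial bs f x = c x)"
    by blast
  from choice[OF this] obtain c0 where c0: "\<And>bs. set bs \<subseteq> Basis \<Longrightarrow> length bs \<le> k \<Longrightarrow> c0 bs \<in> borel_measurable borel"
     "\<And>bs. set bs \<subseteq> Basis \<Longrightarrow> length bs \<le> k \<Longrightarrow> AE x in lborel. weak_partial bs f x = c0 bs x" by blast
  show ?thesis
  proof (rule that[of "c0([] := g)"])
    fix bs :: "'a list" assume bs: "set bs \<subseteq> Basis" "length bs \<le> k"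
    note wL = wp[OF bs, unfolded is_weak_partial_def, THEN conjunct1]
    note cr = L1_loc_representative[OF wL c0(1)[OF bs] c0(2)[OF bs]]
    show "locally_integrable ((c0([] := g)) bs)" using gr(1) cr(1) by simp
    show "AE x in lborel. weak_partial bs f x = (c0([] := g)) bs x" if "bs \<noteq> []" using c0(2)[OF bs] that by simp
    fix r and u :: "'a \<Rightarrow> real \<Rightarrow> real" assume u: "bump_factors r u"
    show "(\<integral>x. g x * iter_partial bs (tensor u) x \<partial>lborel) = (-1) ^ length bs * (\<integral>x. (c0([] := g)) bs x * tensor u x \<partial>lborel)"
    proof (cases "bs = []")
      case False
      have it: "iter_partial bs (tensor u) \<in> borel_measurable borel"
        using iter_partial_tensor[OF u bs(1)] tensor_measurable by metis
      have "(\<integral>x. g x * iter_partial bs (tensor u) x \<partial>lborel) = (\<integral>x. f x * iter_partial bs (tensor u) x \<partial>lebesgue)"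
        by (rule gr(2)[OF it, symmetric])
      also have "\<dots> = (-1) ^ length bs * (\<integral>x. weak_partial bs f x * tensor u x \<partial>lebesgue)"
        using wp[OF bs] tensor_test_fun[OF u] unfolding is_weak_partial_def by blast
      also have "(\<integral>x. weak_partial bs f x * tensor u x \<partial>lebesgue) = (\<integral>x. c0 bs x * tensor u x \<partial>lborel)"
        by (rule cr(2)[OF tensor_measurable[OF u]])
      finally show ?thesis using False by simp
    qed simp
  qed simp
qed

lemma iter_partial_append: "iter_partial (bs @ cs) \<phi> = iter_partial bs (iter_partial cs \<phi>)"
  by (induction bs) auto

lemma basis_lists_Suc: "bij_betw (\<lambda>(bs, b). bs @ [b]) (basis_lists j \<times> Basis) (basis_lists (Suc j) :: 'a::euclidean_space list set)"
proof (rule bij_betwI[where g="\<lambda>cs. (butlast cs, last cs)"])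
  show "(\<lambda>cs. (butlast cs, last cs)) \<in> (basis_lists (Suc j) :: 'a list set) \<rightarrow> basis_lists j \<times> Basis"
  proof
    fix cs :: "'a list" assume cs: "cs \<in> basis_lists (Suc j)"
    then have "cs \<noteq> []" by (auto simp: basis_lists_def)
    then have "last cs \<in> set cs" by (rule last_in_set)
    then show "(butlast cs, last cs) \<in> basis_lists j \<times> Basis"
      using cs by (auto simp: basis_lists_def dest: in_set_butlastD)
  qed
  show "(\<lambda>(bs, b). bs @ [b]) ((\<lambda>cs. (butlast cs, last cs)) y) = y" if "y \<in> basis_lists (Suc j)" for y :: "'a list"
  proof -
    have "y \<noteq> []" using that by (auto simp: basis_lists_def)
    then show ?thesis by (simp add: append_butlast_last_id)
  qed
qed (auto simp: basis_lists_def)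

text \<open>
  The form of degree \<open>j + 1\<close> in \<open>\<xi>\<close> is the weak \<open>\<xi>\<close>-derivative of the form of degree \<open>j\<close>: a list of
  length \<open>j + 1\<close> is a list of length \<open>j\<close> followed by one more direction.
\<close>

lemma weak_dir_deriv_chain:
  fixes c :: "'a::euclidean_space list \<Rightarrow> 'a \<Rightarrow> real"
  assumes loc: "\<And>bs. set bs \<subseteq> Basis \<Longrightarrow> length bs \<le> k \<Longrightarrow> locally_integrable (c bs)"
    and weak: "\<And>bs r u. set bs \<subseteq> Basis \<Longrightarrow> length bs \<le> k \<Longrightarrow> bump_factors r u \<Longrightarrow>
       (\<integral>x. g x * iter_partial bs (tensor u) x \<partial>lborel) = (-1) ^ length bs * (\<integral>x. c bs x * tensor u x \<partial>lborel)"
    and j: "j < k"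
  shows "weak_dir_deriv \<xi> (\<lambda>x. tensor_form j (\<lambda>bs. c bs x) \<xi>) (\<lambda>x. tensor_form (Suc j) (\<lambda>bs. c bs x) \<xi>)"
  unfolding weak_dir_deriv_def
proof (intro conjI allI impI)
  have cl: "locally_integrable (c bs)" if "bs \<in> basis_lists i" "i \<le> k" for bs :: "'a list" and i
    using loc that by (auto simp: basis_lists_def)
  have tl: "locally_integrable (\<lambda>x. tensor_form i (\<lambda>bs. c bs x) \<xi>)" if "i \<le> k" for i
    unfolding locally_integrable_def tensor_form_def sum_distrib_right
  proof (intro conjI allI borel_measurable_sum Bochner_Integration.integrable_sum)
    fix bs :: "'a list" assume bs: "bs \<in> basis_lists i"
    show "(\<lambda>x. c bs x * (\<Prod>i<i. \<xi> \<bullet> bs ! i)) \<in> borel_measurable borel"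
      using locally_integrable_measurable[OF cl[OF bs that]] by measurable
    fix r
    have "integrable lborel (\<lambda>x. (\<Prod>i<i. \<xi> \<bullet> bs ! i) * (c bs x * indicator (cball 0 r) x))"
      using cl[OF bs that] by (intro integrable_mult_right) (auto simp: locally_integrable_def)
    then show "integrable lborel (\<lambda>x. c bs x * (\<Prod>i<i. \<xi> \<bullet> bs ! i) * indicator (cball 0 r) x)"
      by (simp add: mult_ac)
  qed
  show "locally_integrable (\<lambda>x. tensor_form j (\<lambda>bs. c bs x) \<xi>)" "locally_integrable (\<lambda>x. tensor_form (Suc j) (\<lambda>bs. c bs x) \<xi>)"
    using j by (auto intro: tl)
  fix r and u :: "'a \<Rightarrow> real \<Rightarrow> real" assume u: "bump_factors r u"
  have step: "(\<integral>x. c bs x * tensor (u(b := deriv (u b))) x \<partial>lborel) = - (\<integral>x. c (bs @ [b]) x * tensor u x \<partial>lborel)"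
    if bs: "bs \<in> basis_lists j" and b: "b \<in> Basis" for bs :: "'a list" and b
  proof -
    have s: "set bs \<subseteq> Basis" "length bs = j" using bs by (auto simp: basis_lists_def)
    have ub: "bump_factors r (u(b := deriv (u b)))" by (rule bump_factors_deriv[OF u b])
    have it: "iter_partial [b] (tensor u) = tensor (u(b := deriv (u b)))" using tensor_partial[OF u b] by simp
    have "(-1) ^ j * (\<integral>x. c bs x * tensor (u(b := deriv (u b))) x \<partial>lborel) = (\<integral>x. g x * iter_partial bs (tensor (u(b := deriv (u b)))) x \<partial>lborel)"
      using weak[OF s(1) _ ub] s j by simp
    also have "\<dots> = (\<integral>x. g x * iter_partial (bs @ [b]) (tensor u) x \<partial>lborel)"
      unfolding iter_partial_append it ..
    also have "\<dots> = (-1) ^ Suc j * (\<integral>x. c (bs @ [b]) x * tensor u x \<partial>lborel)"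
      using weak[of "bs @ [b]", OF _ _ u] s b j by simp
    finally have "(-1) ^ j * ((-1) ^ j * (\<integral>x. c bs x * tensor (u(b := deriv (u b))) x \<partial>lborel)) = (-1) ^ j * ((-1) ^ Suc j * (\<integral>x. c (bs @ [b]) x * tensor u x \<partial>lborel))"
      by simp
    moreover have "(-1 :: real) ^ j * (-1) ^ j = 1" by (simp add: power_mult_distrib[symmetric])
    ultimately show ?thesis by (simp add: mult.assoc[symmetric])
  qed
  have "(\<integral>x. tensor_form j (\<lambda>bs. c bs x) \<xi> * dir_deriv \<xi> u x \<partial>lborel) =
    (\<integral>x. (\<Sum>(bs, b)\<in>basis_lists j \<times> Basis. ((\<Prod>i<j. \<xi> \<bullet> bs ! i) * (\<xi> \<bullet> b)) * (c bs x * tensor (u(b := deriv (u b))) x)) \<partial>lborel)"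
    unfolding tensor_form_def dir_deriv_def sum_product sum.cartesian_product by (simp add: mult_ac)
  also have "\<dots> = (\<Sum>(bs, b)\<in>basis_lists j \<times> Basis. ((\<Prod>i<j. \<xi> \<bullet> bs ! i) * (\<xi> \<bullet> b)) * (\<integral>x. c bs x * tensor (u(b := deriv (u b))) x \<partial>lborel))"
  proof (subst Bochner_Integration.integral_sum)
    show "integrable lborel (\<lambda>x. case z of (bs, b) \<Rightarrow> ((\<Prod>i<j. \<xi> \<bullet> bs ! i) * (\<xi> \<bullet> b)) * (c bs x * tensor (u(b := deriv (u b))) x))"
      if "z \<in> basis_lists j \<times> Basis" for z
    proof -
      obtain bs b where z: "z = (bs, b)" "bs \<in> basis_lists j" "b \<in> Basis" using \<open>z \<in> _\<close> by auto
      show ?thesis unfolding z(1) prod.case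
        using j by (intro integrable_mult_right integrable_mult_tensor[OF cl[OF z(2)] bump_factors_deriv[OF u z(3)]]) auto
    qed
  qed (auto simp: split_beta' intro!: sum.cong)
  also have "\<dots> = (\<Sum>(bs, b)\<in>basis_lists j \<times> Basis. - ((\<Prod>i<Suc j. \<xi> \<bullet> (bs @ [b]) ! i) * (\<integral>x. c (bs @ [b]) x * tensor u x \<partial>lborel)))"
  proof (rule sum.cong[OF refl], clarify)
    fix bs :: "'a list" and b :: 'a assume bs: "bs \<in> basis_lists j" and b: "b \<in> Basis"
    have "length bs = j" using bs by (simp add: basis_lists_def)
    then have "(\<Prod>i<Suc j. \<xi> \<bullet> (bs @ [b]) ! i) = (\<Prod>i<j. \<xi> \<bullet> bs ! i) * (\<xi> \<bullet> b)"
      by (simp add: nth_append)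
    then show "((\<Prod>i<j. \<xi> \<bullet> bs ! i) * (\<xi> \<bullet> b)) * (\<integral>x. c bs x * tensor (u(b := deriv (u b))) x \<partial>lborel) =
       - ((\<Prod>i<Suc j. \<xi> \<bullet> (bs @ [b]) ! i) * (\<integral>x. c (bs @ [b]) x * tensor u x \<partial>lborel))"
      using step[OF bs b] by simp
  qed
  also have "\<dots> = - (\<Sum>cs\<in>basis_lists (Suc j). (\<Prod>i<Suc j. \<xi> \<bullet> cs ! i) * (\<integral>x. c cs x * tensor u x \<partial>lborel))"
    unfolding sum.reindex_bij_betw[OF basis_lists_Suc, symmetric] by (simp add: sum_negf split_beta')
  also have "(\<Sum>cs\<in>basis_lists (Suc j). (\<Prod>i<Suc j. \<xi> \<bullet> cs ! i) * (\<integral>x. c cs x * tensor u x \<partial>lborel)) =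
     (\<integral>x. (\<Sum>cs\<in>basis_lists (Suc j). (\<Prod>i<Suc j. \<xi> \<bullet> cs ! i) * (c cs x * tensor u x)) \<partial>lborel)"
  proof (subst Bochner_Integration.integral_sum)
    show "integrable lborel (\<lambda>x. (\<Prod>i<Suc j. \<xi> \<bullet> cs ! i) * (c cs x * tensor u x))" if "cs \<in> basis_lists (Suc j)" for cs
      using j by (intro integrable_mult_right integrable_mult_tensor[OF cl[OF that] u]) auto
  qed simp
  also have "\<dots> = (\<integral>x. tensor_form (Suc j) (\<lambda>bs. c bs x) \<xi> * tensor u x \<partial>lborel)"
    unfolding tensor_form_def sum_distrib_right by (simp only: mult_ac)
  finally show "(\<integral>x. tensor_form j (\<lambda>bs. c bs x) \<xi> * dir_deriv \<xi> u x \<partial>lborel) = - (\<integral>x. tensor_form (Suc j) (\<lambda>bs. c bs x) \<xi> * tensor u x \<partial>lborel)" .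
qed

text \<open>
  The iterated derivatives of product test functions do not depend on the order of differentiation, and
  weak derivatives are determined by them.
\<close>

lemma weak_partials_symmetric:
  fixes c :: "'a::euclidean_space list \<Rightarrow> 'a \<Rightarrow> real"
  assumes loc: "\<And>bs. set bs \<subseteq> Basis \<Longrightarrow> length bs \<le> k \<Longrightarrow> locally_integrable (c bs)"
    and weak: "\<And>bs r u. set bs \<subseteq> Basis \<Longrightarrow> length bs \<le> k \<Longrightarrow> bump_factors r u \<Longrightarrow>
       (\<integral>x. g x * iter_partial bs (tensor u) x \<partial>lborel) = (-1) ^ length bs * (\<integral>x. c bs x * tensor u x \<partial>lborel)"
    and as: "as \<in> basis_lists k" and bs: "bs \<in> basis_lists k" and eq: "mset as = mset bs"
  shows "AE x in lborel. c as x = c bs x"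
proof -
  have s: "set as \<subseteq> Basis" "length as \<le> k" "set bs \<subseteq> Basis" "length bs \<le> k" "length as = length bs"
    using as bs by (auto simp: basis_lists_def)
  note l = loc[OF s(1,2)] loc[OF s(3,4)]
  have "AE x in lborel. c as x - c bs x = 0"
  proof (rule fundamental_lemma_variations[OF locally_integrable_diff[OF l]])
    fix r and u :: "'a \<Rightarrow> real \<Rightarrow> real" assume u: "bump_factors r u"
    have "iter_partial as (tensor u) = iter_partial bs (tensor u)"
      using iter_partial_tensor[OF u s(1)] iter_partial_tensor[OF u s(3)] eq by simp
    then have "(-1) ^ length as * (\<integral>x. c as x * tensor u x \<partial>lborel) = (-1) ^ length as * (\<integral>x. c bs x * tensor u x \<partial>lborel)"
      using weak[OF s(1,2) u] weak[OF s(3,4) u] s(5) by simp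
    then have "(\<integral>x. c as x * tensor u x \<partial>lborel) = (\<integral>x. c bs x * tensor u x \<partial>lborel)" by simp
    then show "(\<integral>x. (c as x - c bs x) * tensor u x \<partial>lborel) = 0"
      unfolding left_diff_distrib
      by (subst Bochner_Integration.integral_diff) (auto intro!: integrable_mult_tensor[OF _ u] l)
  qed
  then show ?thesis by eventually_elim simp
qed

lemma tensor_form_line_interpolation:
  fixes c :: "'a::euclidean_space list \<Rightarrow> 'a \<Rightarrow> real"
  assumes cm: "\<And>bs. bs \<in> basis_lists k \<Longrightarrow> c bs \<in> borel_measurable borel" and p: "p \<ge> 1"
  shows "line_interpolation (real k * p) ((2 powr p) ^ Suc k * real (Suc k)) k (\<lambda>\<xi>. Lpi p (\<lambda>x. tensor_form k (\<lambda>bs. c bs x) \<xi>))"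
  unfolding line_interpolation_def
proof (intro allI impI)
  define T where "T \<xi> x = tensor_form k (\<lambda>bs. c bs x) \<xi>" for \<xi> x
  have Tm: "T \<xi> \<in> borel_measurable borel" for \<xi>
    unfolding T_def[abs_def] tensor_form_def using cm by (intro borel_measurable_sum borel_measurable_times) auto
  fix e x0 :: 'a and \<tau> :: "nat \<Rightarrow> real" and \<eta> l
  assume \<eta>: "(0::real) < \<eta>" and le: "\<forall>i\<le>k. Lpi p (\<lambda>x. tensor_form k (\<lambda>bs. c bs x) (x0 + \<tau> i *\<^sub>R e)) \<le> l"
    and sep: "\<forall>i\<le>k. \<forall>j\<le>k. i \<noteq> j \<longrightarrow> \<eta> \<le> \<bar>\<tau> i - \<tau> j\<bar>"
  obtain w where w: "\<And>i. i \<le> k \<Longrightarrow> \<bar>w i\<bar> \<le> (1 / \<eta>) ^ k"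
    "\<And>P. degree P \<le> k \<Longrightarrow> coeff P k = (\<Sum>i\<le>k. w i * poly P (\<tau> i))"
    using Lagrange_leading_coefficient[of k \<eta> \<tau>] sep \<eta> by blast
  have \<eta>p: "((1 / \<eta>) ^ k) powr p = \<eta> powr (- (real k * p))"
    using \<eta> by (simp add: powr_realpow[symmetric] powr_powr powr_divide powr_minus_divide)
  have "Lpi p (T e) = Lpi p (\<lambda>x. \<Sum>i\<le>k. w i * T (x0 + \<tau> i *\<^sub>R e) x)"
    unfolding T_def by (intro arg_cong[where f="Lpi p"] ext tensor_form_leading_coefficient w(2))
  also have "\<dots> \<le> ennreal ((2 powr p) ^ card {..k}) * (\<Sum>i\<le>k. Lpi p (\<lambda>x. w i * T (x0 + \<tau> i *\<^sub>R e) x))"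
    using Tm by (intro Lpi_sum p) auto
  also have "\<dots> \<le> ennreal ((2 powr p) ^ card {..k}) * (\<Sum>i\<le>k. ennreal (\<eta> powr (- (real k * p))) * l)"
  proof (intro mult_left_mono sum_mono)
    fix i assume i: "i \<in> {..k}"
    have "Lpi p (\<lambda>x. w i * T (x0 + \<tau> i *\<^sub>R e) x) = ennreal (\<bar>w i\<bar> powr p) * Lpi p (T (x0 + \<tau> i *\<^sub>R e))"
      by (rule Lpi_cmult[OF Tm])
    also have "\<dots> \<le> ennreal (\<eta> powr (- (real k * p))) * l"
    proof (rule mult_mono)
      show "ennreal (\<bar>w i\<bar> powr p) \<le> ennreal (\<eta> powr (- (real k * p)))"
        unfolding \<eta>p[symmetric] using w(1)[of i] i p by (intro ennreal_leI powr_mono2) auto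
      show "Lpi p (T (x0 + \<tau> i *\<^sub>R e)) \<le> l" using le i by (simp add: T_def[abs_def])
    qed auto
    finally show "Lpi p (\<lambda>x. w i * T (x0 + \<tau> i *\<^sub>R e) x) \<le> ennreal (\<eta> powr (- (real k * p))) * l" .
  qed simp
  also have "\<dots> = ennreal ((2 powr p) ^ Suc k * real (Suc k) * \<eta> powr (- (real k * p))) * l"
  proof -
    have "(\<Sum>i\<le>k. ennreal (\<eta> powr (- (real k * p))) * l) = ennreal (real (Suc k)) * (ennreal (\<eta> powr (- (real k * p))) * l)"
      by (simp add: ennreal_of_nat_eq_real_of_nat del: of_nat_Suc)
    then show ?thesis by (simp add: ennreal_mult mult.assoc del: of_nat_Suc power_Suc)
  qed
  finally show "Lpi p (\<lambda>x. tensor_form k (\<lambda>bs. c bs x) e) \<le> ennreal ((2 powr p) ^ Suc k * real (Suc k) * \<eta> powr (- (real k * p))) * l"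
    by (simp add: T_def[abs_def])
qed

lemma form_norm_le_coefficients:
  fixes c :: "'a::euclidean_space list \<Rightarrow> real"
  shows "form_norm k (\<lambda>vs. \<Sum>bs\<in>basis_lists k. c bs * (\<Prod>i<k. (vs ! i) \<bullet> (bs ! i))) \<le> (\<Sum>bs\<in>basis_lists k. \<bar>c bs\<bar>)"
    and "form_norm k (\<lambda>vs. \<Sum>bs\<in>basis_lists k. c bs * (\<Prod>i<k. (vs ! i) \<bullet> (bs ! i))) \<ge> 0"
proof -
  let ?V = "{vs :: 'a list. length vs = k \<and> (\<forall>v\<in>set vs. norm v \<le> 1)}"
  let ?\<eta> = "\<lambda>vs. \<Sum>bs\<in>basis_lists k. c bs * (\<Prod>i<k. (vs ! i) \<bullet> (bs ! i))"
  have z: "replicate k 0 \<in> ?V" by auto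
  have bound: "\<bar>?\<eta> vs\<bar> \<le> (\<Sum>bs\<in>basis_lists k. \<bar>c bs\<bar>)" if vs: "vs \<in> ?V" for vs
  proof (rule order_trans[OF sum_abs], rule sum_mono)
    fix bs :: "'a list" assume bs: "bs \<in> basis_lists k"
    have "\<bar>\<Prod>i<k. (vs ! i) \<bullet> (bs ! i)\<bar> = (\<Prod>i<k. \<bar>(vs ! i) \<bullet> (bs ! i)\<bar>)" by (rule abs_prod)
    also have "\<dots> \<le> 1"
    proof (rule prod_le_1)
      fix i assume "i \<in> {..<k}"
      then have "vs ! i \<in> set vs" "bs ! i \<in> Basis" using vs bs by (auto simp: basis_lists_def)
      then have "norm (vs ! i) \<le> 1" "bs ! i \<in> Basis" using vs by auto
      then show "0 \<le> \<bar>(vs ! i) \<bullet> (bs ! i)\<bar> \<and> \<bar>(vs ! i) \<bullet> (bs ! i)\<bar> \<le> 1"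
        using Basis_le_norm[of "bs ! i" "vs ! i"] by linarith
    qed
    finally have "\<bar>c bs\<bar> * \<bar>\<Prod>i<k. (vs ! i) \<bullet> (bs ! i)\<bar> \<le> \<bar>c bs\<bar> * 1" by (rule mult_left_mono) simp
    then show "\<bar>c bs * (\<Prod>i<k. (vs ! i) \<bullet> (bs ! i))\<bar> \<le> \<bar>c bs\<bar>" by (simp add: abs_mult)
  qed
  show "form_norm k ?\<eta> \<le> (\<Sum>bs\<in>basis_lists k. \<bar>c bs\<bar>)"
    unfolding form_norm_def using z by (intro cSUP_least bound) blast+
  have "bdd_above ((\<lambda>vs. \<bar>?\<eta> vs\<bar>) ` ?V)" using bound by (intro bdd_aboveI2)
  from cSUP_upper[OF z this] show "form_norm k ?\<eta> \<ge> 0"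
    unfolding form_norm_def by (rule order_trans[OF abs_ge_zero])
qed

text \<open>
  The lower bound by the Lp norm comes from comparing the \<open>k\<close>-th difference with step \<open>2 R\<close> to the
  \<open>k\<close>-th directional derivative; the Sobolev energy is bounded by the coefficients, and these by the
  form on the vectors \<open>\<Sum>i. \<plusminus>b\<^sub>i\<close> of norm at most \<open>k\<close>.
\<close>

lemma integer_affine_inequality:
  fixes s p R :: real
  assumes N: "DIM('a::euclidean_space) \<ge> 2" and s: "s > 0" "s \<in> \<int>" and p: "1 \<le> p" and R: "R > 0"
  shows "\<exists>K::real. \<forall>f :: 'a \<Rightarrow> real.
           f \<in> sobolev_space s p \<and> (AE x in lebesgue. x \<notin> ball 0 R \<longrightarrow> f x = 0) \<longrightarrow>
           epowr (Lp_norm p f) (1 - 1 / real DIM('a)) *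
             epowr (sobolev_seminorm s p f) (1 / real DIM('a))
           \<le> ennreal K * affine_energy s p f"
proof -
  define k where "k = nat \<lfloor>s\<rfloor>"
  have sk: "s = real k" using s by (auto simp: k_def elim!: Ints_cases)
  have k1: "k \<ge> 1" using s sk by (cases k) auto
  let ?L = "basis_lists k :: 'a list set"
  let ?E = "PiE {..<k} (\<lambda>_. {-1, 1::real})"
  have finE: "finite ?E" by (auto intro!: finite_PiE)
  define C where "C = (2 powr p) ^ Suc k * real (Suc k)"
  define c0 where "c0 = 1 / ((2 * R) powr p) ^ k"
  define A where "A = (2 powr p) ^ card ?E * (real (card ?E) * real k powr (real k * p))"
  define C3 where "C3 = (2 powr p) ^ card ?L * (real (card ?L) * A)"
  note fin = sobolev_space_finite[where s=s, OF _ p]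
  show ?thesis
  proof (rule affine_inequality_criterion[OF N s(1) p])
    show "c0 > 0" using R by (simp add: c0_def)
    show "C \<ge> 0" "C3 \<ge> 0" by (simp_all add: C_def C3_def A_def)
    fix f :: "'a \<Rightarrow> real"
    assume f: "f \<in> sobolev_space s p \<and> (AE x in lebesgue. x \<notin> ball 0 R \<longrightarrow> f x = 0)"
    show "Lp_integral p f < \<infinity>" "sobolev_energy s p f < \<infinity>" using f fin by auto
    have fm: "f \<in> borel_measurable lebesgue" using f by (simp add: sobolev_space_def Lp_space_def)
    have fW: "f \<in> Wk1_loc k" using f s(2) by (simp add: sobolev_space_def hom_sobolev_space_def k_def)
    obtain g where g: "g \<in> borel_measurable borel" "\<And>x. x \<notin> ball 0 R \<Longrightarrow> g x = 0" "AE x in lborel. f x = g x"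
      using borel_representative[OF fm conjunct2[OF f]] by blast
    obtain c where c: "c [] = g"
      "\<And>bs. set bs \<subseteq> Basis \<Longrightarrow> length bs \<le> k \<Longrightarrow> locally_integrable (c bs)"
      "\<And>bs. set bs \<subseteq> Basis \<Longrightarrow> length bs \<le> k \<Longrightarrow> bs \<noteq> [] \<Longrightarrow> AE x in lborel. weak_partial bs f x = c bs x"
      "\<And>bs r u. set bs \<subseteq> Basis \<Longrightarrow> length bs \<le> k \<Longrightarrow> bump_factors r u \<Longrightarrow>
         (\<integral>x. g x * iter_partial bs (tensor u) x \<partial>lborel) = (-1) ^ length bs * (\<integral>x. c bs x * tensor u x \<partial>lborel)"
      using weak_partial_representatives[OF fW g(1,3)] by blast
    have cm: "c bs \<in> borel_measurable borel" if "bs \<in> ?L" for bs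
      using c(2)[of bs] that by (auto simp: basis_lists_def intro: locally_integrable_measurable)
    have "AE x in lborel. \<forall>bs\<in>?L. weak_partial bs f x = c bs x"
    proof (rule AE_finite_allI[OF finite_basis_lists])
      fix bs assume "bs \<in> ?L"
      then show "AE x in lborel. weak_partial bs f x = c bs x" using k1 by (intro c(3)) (auto simp: basis_lists_def)
    qed
    note wc = this
    have weak_D_eq: "weak_D k f x vs = (\<Sum>bs\<in>?L. weak_partial bs f x * (\<Prod>i<k. (vs ! i) \<bullet> (bs ! i)))" for x vs
      unfolding weak_D_def basis_lists_def ..
    define T where "T \<xi> x = tensor_form k (\<lambda>bs. c bs x) \<xi>" for \<xi> x
    have Tm: "T \<xi> \<in> borel_measurable borel" for \<xi>
      unfolding T_def[abs_def] tensor_form_def using cm by (intro borel_measurable_sum borel_measurable_times) auto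
    define D where "D \<xi> = Lpi p (T \<xi>)" for \<xi>
    have L: "Lp_integral p f = Lpi p g" unfolding Lp_integral_eq_Lpi by (intro Lpi_cong_AE g)
    have Dhom: "D (a *\<^sub>R \<xi>) = ennreal (a powr (s * p)) * D \<xi>" if "a > 0" for a \<xi>
    proof -
      have "D (a *\<^sub>R \<xi>) = Lpi p (\<lambda>x. a ^ k * T \<xi> x)" unfolding D_def T_def tensor_form_scale ..
      also have "\<dots> = ennreal (\<bar>a ^ k\<bar> powr p) * D \<xi>" unfolding D_def by (rule Lpi_cmult[OF Tm])
      also have "\<bar>a ^ k\<bar> powr p = a powr (s * p)"
        using that by (simp add: sk powr_realpow[symmetric] powr_powr)
      finally show ?thesis .
    qed
    have Dsup: "D v \<le> ennreal (real k powr (real k * p)) * M" if M: "\<forall>e. norm e = 1 \<longrightarrow> D e \<le> M" and v: "norm v \<le> real k" for v M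
    proof (cases "v = 0")
      case True
      have "T 0 x = 0" for x using tensor_form_scale[of k "\<lambda>bs. c bs x" 0 0] k1 by (auto simp: T_def power_0_left)
      then have "D v = 0" unfolding D_def Lpi_def True by simp
      then show ?thesis by simp
    next
      case False
      have "D v = D (norm v *\<^sub>R (v /\<^sub>R norm v))" using False by simp
      also have "\<dots> = ennreal (norm v powr (s * p)) * D (v /\<^sub>R norm v)" using False by (intro Dhom) simp
      also have "\<dots> \<le> ennreal (real k powr (real k * p)) * M"
        using False v M p by (intro mult_mono ennreal_leI) (auto simp: sk intro!: powr_mono2)
      finally show ?thesis .
    qed
    have Q: "sobolev_energy s p f \<le> ennreal C3 * M" if M: "\<forall>e. norm e = 1 \<longrightarrow> D e \<le> M" for M
    proof -
      have "sobolev_energy s p f = (\<integral>\<^sup>+x. ennreal (form_norm k (weak_D k f x) powr p) \<partial>lborel)"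
        using s(2) by (simp add: sobolev_energy_def k_def nn_integral_completion)
      also have "\<dots> \<le> (\<integral>\<^sup>+x. ennreal (\<bar>\<Sum>bs\<in>?L. \<bar>c bs x\<bar>\<bar> powr p) \<partial>lborel)"
      proof (rule nn_integral_mono_AE)
        show "AE x in lborel. ennreal (form_norm k (weak_D k f x) powr p) \<le> ennreal (\<bar>\<Sum>bs\<in>?L. \<bar>c bs x\<bar>\<bar> powr p)"
          using wc
        proof eventually_elim
          case (elim x)
          have eq: "weak_D k f x = (\<lambda>vs. \<Sum>bs\<in>?L. c bs x * (\<Prod>i<k. (vs ! i) \<bullet> (bs ! i)))"
            unfolding weak_D_eq[abs_def] using elim by (intro ext sum.cong) auto
          show ?case
            unfolding eq using form_norm_le_coefficients[of k "\<lambda>bs. c bs x"] p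
            by (intro ennreal_leI powr_mono2) (auto intro: order_trans[OF _ abs_ge_self])
        qed
      qed
      also have "\<dots> = Lpi p (\<lambda>x. \<Sum>bs\<in>?L. \<bar>c bs x\<bar>)" by (simp add: Lpi_def)
      also have "\<dots> \<le> ennreal ((2 powr p) ^ card ?L) * (\<Sum>bs\<in>?L. Lpi p (\<lambda>x. \<bar>c bs x\<bar>))"
        using cm by (intro Lpi_sum finite_basis_lists p) auto
      also have "\<dots> \<le> ennreal ((2 powr p) ^ card ?L) * (\<Sum>bs\<in>?L. ennreal A * M)"
      proof (intro mult_left_mono sum_mono)
        fix b assume b: "b \<in> ?L"
        have "AE x in lborel. \<forall>z\<in>{z\<in>?L \<times> ?L. mset (fst z) = mset (snd z)}. c (fst z) x = c (snd z) x"
        proof (rule AE_finite_allI)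
          show "finite {z\<in>?L \<times> ?L. mset (fst z) = mset (snd z)}" 
            by (rule finite_subset[of _ "?L \<times> ?L"]) (blast, simp add: finite_basis_lists)
          fix z assume "z \<in> {z\<in>?L \<times> ?L. mset (fst z) = mset (snd z)}"
          then show "AE x in lborel. c (fst z) x = c (snd z) x"
            by (intro weak_partials_symmetric[OF c(2,4)]) auto
        qed
        then have pol: "AE x in lborel. \<bar>c b x\<bar> \<le> (\<Sum>\<epsilon>\<in>?E. \<bar>T (\<Sum>i<k. \<epsilon> i *\<^sub>R (b ! i)) x\<bar>)"
        proof eventually_elim
          case (elim x)
          have "c as x = c bs x" if "as \<in> ?L" "bs \<in> ?L" "mset as = mset bs" for as bs
            using bspec[OF elim, of "(as, bs)"] that by simp
          then show ?case unfolding T_def by (intro polarization_bound b)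
        qed
        have "Lpi p (\<lambda>x. \<bar>c b x\<bar>) \<le> Lpi p (\<lambda>x. \<Sum>\<epsilon>\<in>?E. \<bar>T (\<Sum>i<k. \<epsilon> i *\<^sub>R (b ! i)) x\<bar>)"
          unfolding Lpi_def
        proof (rule nn_integral_mono_AE)
          show "AE x in lborel. ennreal (\<bar>\<bar>c b x\<bar>\<bar> powr p) \<le> ennreal (\<bar>\<Sum>\<epsilon>\<in>?E. \<bar>T (\<Sum>i<k. \<epsilon> i *\<^sub>R (b ! i)) x\<bar>\<bar> powr p)"
            using pol by eventually_elim (use p in \<open>auto intro!: ennreal_leI powr_mono2 intro: order_trans[OF _ abs_ge_self]\<close>)
        qed
        also have "\<dots> \<le> ennreal ((2 powr p) ^ card ?E) * (\<Sum>\<epsilon>\<in>?E. Lpi p (\<lambda>x. \<bar>T (\<Sum>i<k. \<epsilon> i *\<^sub>R (b ! i)) x\<bar>))"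
          using Tm by (intro Lpi_sum finE p) auto
        also have "\<dots> \<le> ennreal ((2 powr p) ^ card ?E) * (\<Sum>\<epsilon>\<in>?E. ennreal (real k powr (real k * p)) * M)"
        proof (intro mult_left_mono sum_mono)
          fix \<epsilon> assume \<epsilon>: "\<epsilon> \<in> ?E"
          have "norm (\<Sum>i<k. \<epsilon> i *\<^sub>R (b ! i)) \<le> (\<Sum>i<k. 1)"
          proof (rule order_trans[OF norm_sum], rule sum_mono)
            fix i assume i: "i \<in> {..<k}"
            from PiE_mem[OF \<epsilon> i] have "\<bar>\<epsilon> i\<bar> = 1" by auto
            moreover have "b ! i \<in> Basis" using b i by (auto simp: basis_lists_def)
            ultimately show "norm (\<epsilon> i *\<^sub>R (b ! i)) \<le> 1" by simp
          qed
          then have "D (\<Sum>i<k. \<epsilon> i *\<^sub>R (b ! i)) \<le> ennreal (real k powr (real k * p)) * M" by (intro Dsup M) simp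
          then show "Lpi p (\<lambda>x. \<bar>T (\<Sum>i<k. \<epsilon> i *\<^sub>R (b ! i)) x\<bar>) \<le> ennreal (real k powr (real k * p)) * M"
            by (simp add: D_def Lpi_def)
        qed simp
        also have "\<dots> = ennreal A * M"
          by (simp add: A_def ennreal_mult ennreal_of_nat_eq_real_of_nat mult.assoc)
        finally show "Lpi p (\<lambda>x. \<bar>c b x\<bar>) \<le> ennreal A * M" .
      qed simp
      also have "\<dots> = ennreal C3 * M"
        by (simp add: C3_def A_def ennreal_mult ennreal_of_nat_eq_real_of_nat mult.assoc)
      finally show ?thesis .
    qed
    show "\<exists>D. D \<in> borel_measurable borel \<and> (\<forall>\<xi>. norm \<xi> = 1 \<longrightarrow> directional_energy s p f \<xi> = D \<xi>) \<and>
       (\<forall>c x. c > 0 \<longrightarrow> D (c *\<^sub>R x) = ennreal (c powr (s * p)) * D x) \<and>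
       line_interpolation (s * p) C k D \<and>
       (\<forall>\<xi>. norm \<xi> = 1 \<longrightarrow> ennreal c0 * Lp_integral p f \<le> D \<xi>) \<and>
       (\<forall>M. (\<forall>e. norm e = 1 \<longrightarrow> D e \<le> M) \<longrightarrow> sobolev_energy s p f \<le> ennreal C3 * M)"
    proof (intro exI[of _ D] conjI allI impI)
      have "(\<lambda>(\<xi>, x). tensor_form k (\<lambda>bs. c bs x) \<xi>) \<in> borel_measurable (borel \<Otimes>\<^sub>M lborel)"
        unfolding tensor_form_def split_beta'
      proof (intro borel_measurable_sum borel_measurable_times borel_measurable_prod)
        fix bs assume "bs \<in> ?L"
        note [measurable] = cm[OF this]
        show "(\<lambda>z :: 'a \<times> 'a. c bs (snd z)) \<in> borel_measurable (borel \<Otimes>\<^sub>M lborel)" by measurable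
        show "(\<lambda>z :: 'a \<times> 'a. fst z \<bullet> bs ! i) \<in> borel_measurable (borel \<Otimes>\<^sub>M lborel)" for i by measurable
      qed
      then have "(\<lambda>(\<xi>, x). ennreal (\<bar>T \<xi> x\<bar> powr p)) \<in> borel_measurable (borel \<Otimes>\<^sub>M lborel)"
        unfolding T_def split_beta' by measurable
      then show "D \<in> borel_measurable borel"
        unfolding D_def[abs_def] Lpi_def by (rule lborel.borel_measurable_nn_integral)
      show "directional_energy s p f \<xi> = D \<xi>" for \<xi>
      proof -
        have "directional_energy s p f \<xi> = Lpi p (\<lambda>x. weak_D k f x (replicate k \<xi>))"
          using s(2) by (simp add: directional_energy_def k_def Lpi_def nn_integral_completion)
        also have "\<dots> = D \<xi>"
          unfolding D_def
        proof (rule Lpi_cong_AE)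
          show "AE x in lborel. weak_D k f x (replicate k \<xi>) = T \<xi> x"
            using wc by eventually_elim (simp add: weak_D_eq T_def tensor_form_def)
        qed
        finally show ?thesis .
      qed
      show "D (a *\<^sub>R x) = ennreal (a powr (s * p)) * D x" if "a > 0" for a x using that by (rule Dhom)
      show "line_interpolation (s * p) C k D"
        using tensor_form_line_interpolation[OF cm p] unfolding D_def[abs_def] T_def[abs_def] C_def sk by simp
      show "ennreal c0 * Lp_integral p f \<le> D \<xi>" if \<xi>: "norm \<xi> = 1" for \<xi>
      proof -
        have T0: "(\<lambda>x. tensor_form 0 (\<lambda>bs. c bs x) \<xi>) = g"
        proof -
          have "basis_lists 0 = {[] :: 'a list}" by (auto simp: basis_lists_def)
          then show ?thesis by (simp add: tensor_form_def c(1))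
        qed
        have "Lpi p g \<le> Lpi p ((fdiff ((2 * R) *\<^sub>R \<xi>) ^^ k) g)"
          using Lpi_le_diff_modulus[OF g(2), where h="(2 * R) *\<^sub>R \<xi>" and m=k] \<xi> R p by (simp add: diff_modulus_def)
        also have "\<dots> \<le> ennreal ((2 * R) powr p) ^ k * Lpi p (\<lambda>x. tensor_form k (\<lambda>bs. c bs x) \<xi>)"
          using Lpi_fdiff_pow_le_weak_dir_deriv[where G="\<lambda>j x. tensor_form j (\<lambda>bs. c bs x) \<xi>" and k=k and t="2 * R",
              OF weak_dir_deriv_chain[OF c(2,4)] \<xi> _ p] R unfolding T0 by simp
        finally have "ennreal c0 * Lpi p g \<le> ennreal c0 * (ennreal ((2 * R) powr p) ^ k * D \<xi>)"
          unfolding D_def T_def[abs_def] by (rule mult_left_mono) simp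
        also have "\<dots> = D \<xi>"
          using R by (simp add: c0_def mult.assoc[symmetric] ennreal_power ennreal_mult[symmetric])
        finally show ?thesis unfolding L .
      qed
      show "sobolev_energy s p f \<le> ennreal C3 * M" if "\<forall>e. norm e = 1 \<longrightarrow> D e \<le> M" for M
        using that by (rule Q)
    qed
  qed
qed

theorem theorem1p8:
  fixes s p R :: real
  assumes "CARD('n::finite) \<ge> 2"
    and "s > 0" and "1 \<le> p" and "R > 0"
    and "\<not> (p = 1 \<and> s \<in> \<int> \<and> s \<ge> 2)"
  shows "\<exists>K::real. \<forall>f :: real ^ 'n \<Rightarrow> real.
           f \<in> sobolev_space s p \<longrightarrow>
           (AE x in lebesgue. x \<notin> ball 0 R \<longrightarrow> f x = 0) \<longrightarrow>
           epowr (Lp_norm p f) (1 - 1 / real CARD('n)) *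
             epowr (sobolev_seminorm s p f) (1 / real CARD('n))
           \<le> ennreal K * affine_energy s p f"
proof -
  have N: "DIM(real ^ 'n) \<ge> 2" and D: "DIM(real ^ 'n) = CARD('n)" using assms(1) by auto
  have "\<exists>K::real. \<forall>f :: real ^ 'n \<Rightarrow> real.
           f \<in> sobolev_space s p \<and> (AE x in lebesgue. x \<notin> ball 0 R \<longrightarrow> f x = 0) \<longrightarrow>
           epowr (Lp_norm p f) (1 - 1 / real DIM(real ^ 'n)) *
             epowr (sobolev_seminorm s p f) (1 / real DIM(real ^ 'n))
           \<le> ennreal K * affine_energy s p f"
  proof (cases "s \<in> \<int>")
    case True
    show ?thesis by (rule integer_affine_inequality[OF N assms(2) True assms(3,4)])
  next
    case False
    show ?thesis by (rule fractional_affine_inequality[OF N assms(2) False assms(3,4)])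
  qed
  then show ?thesis unfolding D by blast
qed

end
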